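(* With the symmetrizers and $c$-functions defined in the context, $$\mathbf{1}_0=p_0^Xc_{w_0}^{X^{-1}}\quad\text{and}\quad\varepsilon_0=c_{w_0}^Xe_0^X$$ in the localized affine Hecke algebra generated by the $T_i$ and $X_i^{\pm1}$, and $$\mathbf{1}_0=p_0^Yc_{w_0}^{Y}\quad\text{and}\quad\varepsilon_0=c_{w_0}^{Y^{-1}}e_0^Y$$ in the localized affine Hecke algebra generated by the $T_i$ and $Y_i^{\pm1}$.
   Context: Let $n\ge1$ and $t^{1/2}\in\mathbb{C}^\times$, $t=(t^{1/2})^2$. Let $T_1,\ldots,T_{n-1}$ satisfy $T_iT_{i+1}T_i=T_{i+1}T_iT_{i+1}$, $T_iT_j=T_jT_i$ for $|i-j|>1$, and $T_i^2=(t^{\frac12}-t^{-\frac12})T_i+1$. Let $H_X$ be the algebra generated by $T_1,\ldots,T_{n-1}$ and commuting invertible $X_1,\ldots,X_n$ with additional relations $X_{i+1}=T_iX_iT_i$ and $T_iX_j=X_jT_i$ for $j\notin\{i,i+1\}$. Let $H_Y$ be the algebra generated by $T_1,\ldots,T_{n-1}$ and commuting invertible $Y_1,\ldots,Y_n$ with additional relations $Y_{i+1}=T_i^{-1}Y_iT_i^{-1}$ and $T_iY_j=Y_jT_i$ for $j\notin\{i,i+1\}$. (Both are subalgebras of the type $GL_n$ double affine Hecke algebra.) The identities take place in the localizations of $H_X$, respectively $H_Y$, obtained by inverting all nonzero elements of $\mathbb{C}[X_1^{\pm1},\ldots,X_n^{\pm1}]$, respectively $\mathbb{C}[Y_1^{\pm1},\ldots,Y_n^{\pm1}]$.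 For $i\neq j$ let $$c^X_{ij}=\frac{t^{-\frac12}-t^{\frac12}X_iX_j^{-1}}{1-X_iX_j^{-1}},\qquad c^Y_{ij}=\frac{t^{-\frac12}-t^{\frac12}Y_iY_j^{-1}}{1-Y_iY_j^{-1}},$$ $c^X_{w_0}=\prod_{i<j}c^X_{ij}$, $c^Y_{w_0}=\prod_{i<j}c^Y_{ij}$, $c^{X^{-1}}_{w_0}=\prod_{i<j}\frac{t^{-\frac12}-t^{\frac12}X_i^{-1}X_j}{1-X_i^{-1}X_j}$, $c^{Y^{-1}}_{w_0}=\prod_{i<j}\frac{t^{-\frac12}-t^{\frac12}Y_i^{-1}Y_j}{1-Y_i^{-1}Y_j}$ (products over $1\le i<j\le n$). With $C_{s_i}=T_i+t^{-\frac12}$, the normalized intertwiners are $$\xi_{s_i}=\frac1{c^X_{i,i+1}}\big(C_{s_i}-c^X_{i+1,i}\big),\qquad \eta_{s_i}=\frac1{c^Y_{i+1,i}}\big(C_{s_i}-c^Y_{i,i+1}\big).$$ For $w\in S_n$ with reduced word $w=s_{i_1}\cdots s_{i_\ell}$ (where $s_i=(i,i+1)$) put $T_w=T_{i_1}\cdots T_{i_\ell}$, $\xi_w=\xi_{s_{i_1}}\cdots\xi_{s_{i_\ell}}$, $\eta_w=\eta_{s_{i_1}}\cdots\eta_{s_{i_\ell}}$ (independent of the reduced word). Let $w_0$ be the longest element of $S_n$, $\ell$ the length, and $$p_0^X=\sum_{w\in S_n}\xi_w,\quad e_0^X=\sum_{w\in S_n}(-1)^{\ell(w)-\ell(w_0)}\xi_w,\quad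 p_0^Y=\sum_{w\in S_n}\eta_w,\quad e_0^Y=\sum_{w\in S_n}(-1)^{\ell(w)-\ell(w_0)}\eta_w,$$ $$\mathbf{1}_0=\sum_{w\in S_n}(t^{\frac12})^{\ell(w)-\ell(w_0)}T_w,\qquad\varepsilon_0=\sum_{w\in S_n}(-t^{-\frac12})^{\ell(w)-\ell(w_0)}T_w .$$ *)

theory Defs
  imports Complex_Main "HOL-Algebra.QuotRing" "HOL-Library.Poly_Mapping"
    "HOL-Combinatorics.Permutations"
begin

section \<open>Complex algebras given by generators and relations\<close>

datatype 'g word = Word (letters: "'g list")

instantiation word :: (type) monoid_add
begin
definition zero_word :: "'a word" where "zero_word = Word []"
definition plus_word :: "'a word \<Rightarrow> 'a word \<Rightarrow> 'a word"
  where "plus_word v w = Word (letters v @ letters w)"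
instance by standard (simp_all add: zero_word_def plus_word_def)
end

text \<open>Since addition of words is concatenation, the convolution product of
  \<^typ>\<open>'g word \<Rightarrow>\<^sub>0 complex\<close> is the product of noncommutative polynomials.\<close>

type_synonym 'g ncpoly = "'g word \<Rightarrow>\<^sub>0 complex"

definition free_algebra :: "'g set \<Rightarrow> 'g ncpoly ring" where
  "free_algebra G =
    \<lparr>carrier = {p. \<forall>w\<in>Poly_Mapping.keys p. set (letters w) \<subseteq> G},
     monoid.mult = (*), one = 1, zero = 0, add = (+)\<rparr>"

definition nc_gen :: "'g \<Rightarrow> 'g ncpoly"
  where "nc_gen g = Poly_Mapping.single (Word [g]) 1"

definition nc_const :: "complex \<Rightarrow> 'g ncpoly"
  where "nc_const a = Poly_Mapping.single 0 a"

text \<open>A relation \<open>(l, r)\<close> stands for the equation \<open>l = r\<close>. Ideals in \<open>HOL-Algebra\<close> are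
  two-sided.\<close>

definition relation_ideal :: "'g set \<Rightarrow> ('g ncpoly \<times> 'g ncpoly) set \<Rightarrow> 'g ncpoly set" where
  "relation_ideal G rels = genideal (free_algebra G) {l - r | l r. (l, r) \<in> rels}"

definition presented_algebra ::
    "'g set \<Rightarrow> ('g ncpoly \<times> 'g ncpoly) set \<Rightarrow> 'g ncpoly set ring" where
  "presented_algebra G rels = free_algebra G Quot relation_ideal G rels"

lemma ring_free_algebra: "ring (free_algebra G)"
proof (rule ringI)
  show "abelian_group (free_algebra G)"
  proof (rule abelian_groupI)
    fix x y assume "x \<in> carrier (free_algebra G)" "y \<in> carrier (free_algebra G)"
    then show "x \<oplus>\<^bsub>free_algebra G\<^esub> y \<in> carrier (free_algebra G)"
      using Poly_Mapping.keys_add[of x y] by (auto simp: free_algebra_def)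
  next
    fix x assume "x \<in> carrier (free_algebra G)"
    then have "- x \<in> carrier (free_algebra G) \<and> - x \<oplus>\<^bsub>free_algebra G\<^esub> x = \<zero>\<^bsub>free_algebra G\<^esub>"
      by (simp add: free_algebra_def)
    then show "\<exists>y\<in>carrier (free_algebra G). y \<oplus>\<^bsub>free_algebra G\<^esub> x = \<zero>\<^bsub>free_algebra G\<^esub>"
      by blast
  qed (auto simp: free_algebra_def add.assoc add.commute)
  show "Group.monoid (free_algebra G)"
  proof (rule monoidI)
    fix x y assume "x \<in> carrier (free_algebra G)" "y \<in> carrier (free_algebra G)"
    then show "x \<otimes>\<^bsub>free_algebra G\<^esub> y \<in> carrier (free_algebra G)"
      using Poly_Mapping.keys_mult[of x y] by (fastforce simp: free_algebra_def plus_word_def)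
  qed (auto simp: free_algebra_def mult.assoc zero_word_def)
qed (auto simp: free_algebra_def algebra_simps)

section \<open>The localized affine Hecke algebras\<close>

text \<open>\<open>LX\<close> selects the algebra generated by the \<open>T\<^sub>i\<close> and \<open>X\<^sub>i\<close>, \<open>LY\<close> the one generated by the
  \<open>T\<^sub>i\<close> and \<open>Y\<^sub>i\<close>; a lattice generator \<open>X\<^sub>i\<close> or \<open>Y\<^sub>i\<close> is written \<open>Z\<^sub>i\<close> when both are treated at
  once. The complex number \<open>s\<close> is \<open>t\<^sup>1\<^sup>/\<^sup>2\<close>.\<close>

datatype side = LX | LY

text \<open>Laurent polynomials are finitely supported functions on exponent vectors.\<close>

type_synonym laurent = "(nat \<Rightarrow>\<^sub>0 int) \<Rightarrow>\<^sub>0 complex"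

definition laurent_polys :: "nat \<Rightarrow> laurent set" where
  "laurent_polys n = {p. \<forall>m\<in>Poly_Mapping.keys p. Poly_Mapping.keys m \<subseteq> {1..n}}"

text \<open>\<open>GInv p\<close> is the formal inverse of the Laurent polynomial \<open>p\<close> evaluated at the \<open>Z\<^sub>i\<close>.\<close>

datatype gen = GT nat | GZ nat | GZinv nat | GInv laurent

definition laurent_word :: "nat \<Rightarrow> (nat \<Rightarrow>\<^sub>0 int) \<Rightarrow> gen word" where
  "laurent_word n m = Word (concat (map (\<lambda>i.
      replicate (nat (Poly_Mapping.lookup m i)) (GZ i) @
      replicate (nat (- Poly_Mapping.lookup m i)) (GZinv i)) [1..<Suc n]))"

definition laurent_eval :: "nat \<Rightarrow> laurent \<Rightarrow> gen ncpoly" where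
  "laurent_eval n p = (\<Sum>m\<in>Poly_Mapping.keys p.
      Poly_Mapping.single (laurent_word n m) (Poly_Mapping.lookup p m))"

definition hecke_gens :: "nat \<Rightarrow> gen set" where
  "hecke_gens n = GT ` {1..<n} \<union> GZ ` {1..n} \<union> GZinv ` {1..n}"

text \<open>The inverse of \<open>T\<^sub>i\<close>: the quadratic relation reads \<open>T\<^sub>i (T\<^sub>i - (s - s\<^sup>-\<^sup>1)) = 1\<close>.\<close>

definition nc_Tinv :: "complex \<Rightarrow> nat \<Rightarrow> gen ncpoly" where
  "nc_Tinv s i = nc_gen (GT i) - nc_const (s - inverse s)"

fun crossing :: "side \<Rightarrow> complex \<Rightarrow> nat \<Rightarrow> gen ncpoly" where
  "crossing LX s i = nc_gen (GT i) * nc_gen (GZ i) * nc_gen (GT i)"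
| "crossing LY s i = nc_Tinv s i * nc_gen (GZ i) * nc_Tinv s i"

definition hecke_rels :: "side \<Rightarrow> nat \<Rightarrow> complex \<Rightarrow> (gen ncpoly \<times> gen ncpoly) set" where
  "hecke_rels k n s =
    {(nc_gen (GT i) * nc_gen (GT (Suc i)) * nc_gen (GT i),
      nc_gen (GT (Suc i)) * nc_gen (GT i) * nc_gen (GT (Suc i))) | i. 1 \<le> i \<and> Suc i < n} \<union>
    {(nc_gen (GT i) * nc_gen (GT j), nc_gen (GT j) * nc_gen (GT i)) | i j.
      i \<in> {1..<n} \<and> j \<in> {1..<n} \<and> \<bar>int i - int j\<bar> > 1} \<union>
    {(nc_gen (GT i) * nc_gen (GT i), nc_const (s - inverse s) * nc_gen (GT i) + 1) | i.
      i \<in> {1..<n}} \<union>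
    {(nc_gen (GZ i) * nc_gen (GZ j), nc_gen (GZ j) * nc_gen (GZ i)) | i j.
      i \<in> {1..n} \<and> j \<in> {1..n}} \<union>
    {(nc_gen (GZ i) * nc_gen (GZinv i), 1) | i. i \<in> {1..n}} \<union>
    {(nc_gen (GZinv i) * nc_gen (GZ i), 1) | i. i \<in> {1..n}} \<union>
    {(nc_gen (GZ (Suc i)), crossing k s i) | i. i \<in> {1..<n}} \<union>
    {(nc_gen (GT i) * nc_gen (GZ j), nc_gen (GZ j) * nc_gen (GT i)) | i j.
      i \<in> {1..<n} \<and> j \<in> {1..n} \<and> j \<noteq> i \<and> j \<noteq> Suc i}"

text \<open>Localization at the nonzero Laurent polynomials: two-sided inverses are adjoined universally.
  As these form an Ore set of regular elements of the affine Hecke algebra (which contains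
  the Laurent polynomial ring, by the Bernstein--Lusztig basis), this is the ring of fractions.\<close>

definition loc_gens :: "nat \<Rightarrow> gen set" where
  "loc_gens n = hecke_gens n \<union> GInv ` (laurent_polys n - {0})"

definition loc_rels :: "side \<Rightarrow> nat \<Rightarrow> complex \<Rightarrow> (gen ncpoly \<times> gen ncpoly) set" where
  "loc_rels k n s = hecke_rels k n s \<union>
    {(laurent_eval n p * nc_gen (GInv p), 1) | p. p \<in> laurent_polys n - {0}} \<union>
    {(nc_gen (GInv p) * laurent_eval n p, 1) | p. p \<in> laurent_polys n - {0}}"

definition hecke_loc :: "side \<Rightarrow> nat \<Rightarrow> complex \<Rightarrow> gen ncpoly set ring" where
  "hecke_loc k n s = presented_algebra (loc_gens n) (loc_rels k n s)"

definition hecke_class :: "side \<Rightarrow> nat \<Rightarrow> complex \<Rightarrow> gen ncpoly \<Rightarrow> gen ncpoly set" where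
  "hecke_class k n s x =
    relation_ideal (loc_gens n) (loc_rels k n s) +>\<^bsub>free_algebra (loc_gens n)\<^esub> x"

definition hT :: "side \<Rightarrow> nat \<Rightarrow> complex \<Rightarrow> nat \<Rightarrow> gen ncpoly set"
  where "hT k n s i = hecke_class k n s (nc_gen (GT i))"

definition hZ :: "side \<Rightarrow> nat \<Rightarrow> complex \<Rightarrow> nat \<Rightarrow> gen ncpoly set"
  where "hZ k n s i = hecke_class k n s (nc_gen (GZ i))"

definition hconst :: "side \<Rightarrow> nat \<Rightarrow> complex \<Rightarrow> complex \<Rightarrow> gen ncpoly set"
  where "hconst k n s a = hecke_class k n s (nc_const a)"

text \<open>The generated ideal is an intersection of ideals containing the relations, so it would
  be the whole type if some relation left the free algebra. The following lemmas exclude this.\<close>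

lemma nc_gen_carrier: "g \<in> G \<Longrightarrow> nc_gen g \<in> carrier (free_algebra G)"
  by (simp add: nc_gen_def free_algebra_def)

lemma nc_const_carrier: "nc_const a \<in> carrier (free_algebra G)"
  by (simp add: nc_const_def free_algebra_def zero_word_def)

lemma free_algebra_closed:
  shows "1 \<in> carrier (free_algebra G)"
    and "x \<in> carrier (free_algebra G) \<Longrightarrow> y \<in> carrier (free_algebra G) \<Longrightarrow>
      x + y \<in> carrier (free_algebra G)"
    and "x \<in> carrier (free_algebra G) \<Longrightarrow> y \<in> carrier (free_algebra G) \<Longrightarrow>
      x - y \<in> carrier (free_algebra G)"
    and "x \<in> carrier (free_algebra G) \<Longrightarrow> y \<in> carrier (free_algebra G) \<Longrightarrow>
      x * y \<in> carrier (free_algebra G)"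
proof -
  interpret R: ring "free_algebra G" by (rule ring_free_algebra)
  show "1 \<in> carrier (free_algebra G)"
    using R.one_closed by (simp add: free_algebra_def)
  assume x: "x \<in> carrier (free_algebra G)" and y: "y \<in> carrier (free_algebra G)"
  show "x + y \<in> carrier (free_algebra G)"
    using R.a_closed[OF x y] by (simp add: free_algebra_def)
  show "x * y \<in> carrier (free_algebra G)"
    using R.m_closed[OF x y] by (simp add: free_algebra_def)
  have "- y \<in> carrier (free_algebra G)"
    using y by (simp add: free_algebra_def)
  then show "x - y \<in> carrier (free_algebra G)"
    using R.a_closed[OF x, of "- y"] by (simp add: free_algebra_def)
qed

lemma laurent_eval_carrier: "laurent_eval n p \<in> carrier (free_algebra (loc_gens n))"
proof -
  have w: "set (letters (laurent_word n m)) \<subseteq> loc_gens n" for m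
    by (auto simp: laurent_word_def loc_gens_def hecke_gens_def)
  have "Poly_Mapping.keys (laurent_eval n p) \<subseteq> (\<Union>m\<in>Poly_Mapping.keys p. {laurent_word n m})"
    unfolding laurent_eval_def
    by (rule order_trans[OF keys_sum]) (auto split: if_splits)
  with w show ?thesis by (fastforce simp: free_algebra_def)
qed

lemma loc_rels_carrier:
  "{l - r | l r. (l, r) \<in> loc_rels k n s} \<subseteq> carrier (free_algebra (loc_gens n))"
proof -
  have T: "i \<in> {1..<n} \<Longrightarrow> nc_gen (GT i) \<in> carrier (free_algebra (loc_gens n))"
    and Z: "j \<in> {1..n} \<Longrightarrow> nc_gen (GZ j) \<in> carrier (free_algebra (loc_gens n))"
    and Zi: "j \<in> {1..n} \<Longrightarrow> nc_gen (GZinv j) \<in> carrier (free_algebra (loc_gens n))"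
    and I: "p \<in> laurent_polys n - {0} \<Longrightarrow> nc_gen (GInv p) \<in> carrier (free_algebra (loc_gens n))"
    for i j p
    by (auto intro!: nc_gen_carrier simp: loc_gens_def hecke_gens_def)
  have C: "i \<in> {1..<n} \<Longrightarrow> crossing k s i \<in> carrier (free_algebra (loc_gens n))" for i
    by (cases k) (auto intro!: free_algebra_closed T Z nc_const_carrier simp: nc_Tinv_def)
  show ?thesis
    unfolding loc_rels_def hecke_rels_def
    by (auto intro!: free_algebra_closed T Z Zi I C nc_const_carrier laurent_eval_carrier)
qed

lemma ring_hecke_loc: "ring (hecke_loc k n s)"
  unfolding hecke_loc_def presented_algebra_def relation_ideal_def
  by (intro ideal.quotient_is_ring ring.genideal_ideal ring_free_algebra loc_rels_carrier)

section \<open>The symmetric group\<close>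

text \<open>Permutations of \<open>{1..n}\<close> are multiplied by composition of functions.\<close>

definition word_perm :: "nat list \<Rightarrow> nat \<Rightarrow> nat" where
  "word_perm js = foldr (\<lambda>i w. transpose i (Suc i) \<circ> w) js id"

definition perm_length :: "nat \<Rightarrow> (nat \<Rightarrow> nat) \<Rightarrow> nat" where
  "perm_length n w = (LEAST l. \<exists>js. set js \<subseteq> {1..<n} \<and> word_perm js = w \<and> length js = l)"

definition reduced_word :: "nat \<Rightarrow> (nat \<Rightarrow> nat) \<Rightarrow> nat list \<Rightarrow> bool" where
  "reduced_word n w js \<longleftrightarrow>
    set js \<subseteq> {1..<n} \<and> word_perm js = w \<and> length js = perm_length n w"

definition longest_perm :: "nat \<Rightarrow> nat \<Rightarrow> nat" where
  "longest_perm n = (ARG_MAX (perm_length n) w. w permutes {1..n})"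

definition colength :: "nat \<Rightarrow> (nat \<Rightarrow> nat) \<Rightarrow> int" where
  "colength n w = int (perm_length n w) - int (perm_length n (longest_perm n))"

section \<open>The \<open>c\<close>-functions, intertwiners and symmetrizers\<close>

text \<open>Below, \<open>inv\<close> and the operations are those of the algebra \<open>hecke_loc k n s\<close>.\<close>

definition ratio :: "side \<Rightarrow> nat \<Rightarrow> complex \<Rightarrow> nat \<Rightarrow> nat \<Rightarrow> gen ncpoly set" where
  "ratio k n s i j = hZ k n s i \<otimes>\<^bsub>hecke_loc k n s\<^esub> inv\<^bsub>hecke_loc k n s\<^esub> (hZ k n s j)"

definition ratio_inv :: "side \<Rightarrow> nat \<Rightarrow> complex \<Rightarrow> nat \<Rightarrow> nat \<Rightarrow> gen ncpoly set" where
  "ratio_inv k n s i j = inv\<^bsub>hecke_loc k n s\<^esub> (hZ k n s i) \<otimes>\<^bsub>hecke_loc k n s\<^esub> hZ k n s j"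

text \<open>\<open>(t\<^sup>-\<^sup>1\<^sup>/\<^sup>2 - t\<^sup>1\<^sup>/\<^sup>2 u) / (1 - u)\<close>; numerator and denominator commute in all uses.\<close>

definition c_of :: "side \<Rightarrow> nat \<Rightarrow> complex \<Rightarrow> gen ncpoly set \<Rightarrow> gen ncpoly set" where
  "c_of k n s u =
    (hconst k n s (inverse s) \<ominus>\<^bsub>hecke_loc k n s\<^esub> (hconst k n s s \<otimes>\<^bsub>hecke_loc k n s\<^esub> u))
      \<otimes>\<^bsub>hecke_loc k n s\<^esub>
    inv\<^bsub>hecke_loc k n s\<^esub> (\<one>\<^bsub>hecke_loc k n s\<^esub> \<ominus>\<^bsub>hecke_loc k n s\<^esub> u)"

definition c_fun :: "side \<Rightarrow> nat \<Rightarrow> complex \<Rightarrow> nat \<Rightarrow> nat \<Rightarrow> gen ncpoly set" where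
  "c_fun k n s i j = c_of k n s (ratio k n s i j)"

definition hprod :: "side \<Rightarrow> nat \<Rightarrow> complex \<Rightarrow> gen ncpoly set list \<Rightarrow> gen ncpoly set" where
  "hprod k n s xs = foldr (\<otimes>\<^bsub>hecke_loc k n s\<^esub>) xs \<one>\<^bsub>hecke_loc k n s\<^esub>"

text \<open>The factors \<open>c\<^sub>i\<^sub>j\<close> commute, so the (lexicographic) order of the pairs is immaterial.\<close>

definition index_pairs :: "nat \<Rightarrow> (nat \<times> nat) list" where
  "index_pairs n = [(i, j). i \<leftarrow> [1..<Suc n], j \<leftarrow> [Suc i..<Suc n]]"

definition c_w0 :: "side \<Rightarrow> nat \<Rightarrow> complex \<Rightarrow> gen ncpoly set" where
  "c_w0 k n s = hprod k n s (map (\<lambda>(i, j). c_fun k n s i j) (index_pairs n))"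

definition c_w0_inv :: "side \<Rightarrow> nat \<Rightarrow> complex \<Rightarrow> gen ncpoly set" where
  "c_w0_inv k n s = hprod k n s (map (\<lambda>(i, j). c_of k n s (ratio_inv k n s i j)) (index_pairs n))"

definition C_simple :: "side \<Rightarrow> nat \<Rightarrow> complex \<Rightarrow> nat \<Rightarrow> gen ncpoly set" where
  "C_simple k n s i = hT k n s i \<oplus>\<^bsub>hecke_loc k n s\<^esub> hconst k n s (inverse s)"

text \<open>The intertwiners \<open>\<xi>\<^sub>s\<^sub>i\<close> (for \<open>LX\<close>) and \<open>\<eta>\<^sub>s\<^sub>i\<close> (for \<open>LY\<close>).\<close>

fun intertwiner :: "side \<Rightarrow> nat \<Rightarrow> complex \<Rightarrow> nat \<Rightarrow> gen ncpoly set" where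
  "intertwiner LX n s i =
    inv\<^bsub>hecke_loc LX n s\<^esub> (c_fun LX n s i (Suc i)) \<otimes>\<^bsub>hecke_loc LX n s\<^esub>
      (C_simple LX n s i \<ominus>\<^bsub>hecke_loc LX n s\<^esub> c_fun LX n s (Suc i) i)"
| "intertwiner LY n s i =
    inv\<^bsub>hecke_loc LY n s\<^esub> (c_fun LY n s (Suc i) i) \<otimes>\<^bsub>hecke_loc LY n s\<^esub>
      (C_simple LY n s i \<ominus>\<^bsub>hecke_loc LY n s\<^esub> c_fun LY n s i (Suc i))"

text \<open>By the braid relations of the \<open>T\<^sub>i\<close> and of the intertwiners, the next two products do not
  depend on the reduced word that is chosen.\<close>

definition T_perm :: "side \<Rightarrow> nat \<Rightarrow> complex \<Rightarrow> (nat \<Rightarrow> nat) \<Rightarrow> gen ncpoly set" where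
  "T_perm k n s w = hprod k n s (map (hT k n s) (SOME js. reduced_word n w js))"

definition intertwiner_perm :: "side \<Rightarrow> nat \<Rightarrow> complex \<Rightarrow> (nat \<Rightarrow> nat) \<Rightarrow> gen ncpoly set" where
  "intertwiner_perm k n s w =
    hprod k n s (map (intertwiner k n s) (SOME js. reduced_word n w js))"

definition p_zero :: "side \<Rightarrow> nat \<Rightarrow> complex \<Rightarrow> gen ncpoly set" where
  "p_zero k n s =
    (\<Oplus>\<^bsub>hecke_loc k n s\<^esub> w \<in> {w. w permutes {1..n}}. intertwiner_perm k n s w)"

definition e_zero :: "side \<Rightarrow> nat \<Rightarrow> complex \<Rightarrow> gen ncpoly set" where
  "e_zero k n s =
    (\<Oplus>\<^bsub>hecke_loc k n s\<^esub> w \<in> {w. w permutes {1..n}}.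
      hconst k n s ((- 1) powi colength n w) \<otimes>\<^bsub>hecke_loc k n s\<^esub> intertwiner_perm k n s w)"

definition one_zero :: "side \<Rightarrow> nat \<Rightarrow> complex \<Rightarrow> gen ncpoly set" where
  "one_zero k n s =
    (\<Oplus>\<^bsub>hecke_loc k n s\<^esub> w \<in> {w. w permutes {1..n}}.
      hconst k n s (s powi colength n w) \<otimes>\<^bsub>hecke_loc k n s\<^esub> T_perm k n s w)"

definition eps_zero :: "side \<Rightarrow> nat \<Rightarrow> complex \<Rightarrow> gen ncpoly set" where
  "eps_zero k n s =
    (\<Oplus>\<^bsub>hecke_loc k n s\<^esub> w \<in> {w. w permutes {1..n}}.
      hconst k n s ((- inverse s) powi colength n w) \<otimes>\<^bsub>hecke_loc k n s\<^esub> T_perm k n s w)"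

end

theory Submission
  imports Defs
begin

text \<open>Both sides are built up along the chain of symmetric groups. A sum over \<open>S\<^sub>m\<^sub>+\<^sub>1\<close> of products along
  reduced words is \<open>L\<^sub>m\<close> times the sum over \<open>S\<^sub>m\<close>, where \<open>L\<^sub>m\<close> is the sum over the coset representatives
  \<open>s\<^sub>k \<dots> s\<^sub>m\<close>. On an element \<open>x\<close> that is fixed by the intertwiners of \<open>S\<^sub>m\<close>, the sum \<open>L\<^sub>m\<close> formed with the
  \<open>s T\<^sub>i\<close> acts like \<open>s\<^sup>m\<close> times the one formed with the intertwiners followed by the product of the
  \<open>c\<^sub>m\<^sub>+\<^sub>1\<^sub>,\<^sub>i\<close> for \<open>i \<le> m\<close>; this is an induction on \<open>m\<close> that comes down to the partial fraction
  decomposition of such a product. Since the sum over \<open>S\<^sub>m\<close> of the intertwiners is invariant, the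
  symmetrizer factors as claimed. The antisymmetrizer is obtained by exchanging \<open>s\<close> with \<open>- s\<^sup>-\<^sup>1\<close>, which
  preserves the Hecke relations and turns \<open>c\<^sub>i\<^sub>j\<close> into \<open>- c\<^sub>j\<^sub>i\<close>. The case of the \<open>Y\<^sub>i\<close> is that of the
  \<open>X\<^sub>i\<close> with \<open>X\<^sub>i = Y\<^sub>i\<^sup>-\<^sup>1\<close>.\<close>


text \<open>The algebra is known only through generators and relations, so coefficients with respect
  to a basis of intertwiners cannot be compared. Every step is instead a consequence of the
  relations, valid in any ring where they hold and the required fractions exist. This explains the
  variables. With D_ij = q / (1 - Z_i / Z_j) and q = s - s^-1, the generator T_i is the unnormalized
  intertwiner plus D_{i,i+1}, and c_ij = s - D_ij = s^-1 + D_ji. All that is used of rational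
  functions is then D_ij + D_ji = q, one quadratic identity among three indices, and the way the
  intertwiners permute the D_ij. These relations do not distinguish s from - s^-1, which makes the
  sign duality possible. The products over w are formed along a chosen reduced word, so Matsumoto's
  theorem is needed first. The unique normal words s_k ... s_m v provide it and at the same time the
  factorization of sums along S_m. The shift of the exponents by the length n(n-1)/2 of w_0 is the
  total of the powers s^-m spent in the steps from S_m to S_{m+1}.\<close>

declare upt_Suc [simp del]

section \<open>Reduced words of permutations\<close>

text \<open>The congruence generated by the braid relations alone, without s_i^2 = 1. It preserves
  length, and products over letters are constant on its classes for every family satisfying the
  braid relations, whatever its quadratic relation.\<close>

inductive braid_equiv :: "nat \<Rightarrow> nat list \<Rightarrow> nat list \<Rightarrow> bool" for n where
  far: "1 \<le> i \<Longrightarrow> Suc i < j \<Longrightarrow> j < n \<Longrightarrow> braid_equiv n [i, j] [j, i]"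
| braid: "1 \<le> i \<Longrightarrow> Suc i < n \<Longrightarrow> braid_equiv n [i, Suc i, i] [Suc i, i, Suc i]"
| equiv_refl: "braid_equiv n u u"
| equiv_sym: "braid_equiv n u v \<Longrightarrow> braid_equiv n v u"
| equiv_trans: "braid_equiv n u v \<Longrightarrow> braid_equiv n v w \<Longrightarrow> braid_equiv n u w"
| append: "braid_equiv n u v \<Longrightarrow> braid_equiv n (a @ u @ b) (a @ v @ b)"

lemma braid_equiv_append_left: "braid_equiv n u v \<Longrightarrow> braid_equiv n (a @ u) (a @ v)"
  using braid_equiv.append[of n u v a "[]"] by simp

lemma braid_equiv_append_right: "braid_equiv n u v \<Longrightarrow> braid_equiv n (u @ b) (v @ b)"
  using braid_equiv.append[of n u v "[]" b] by simp

lemma braid_equiv_Cons: "braid_equiv n u v \<Longrightarrow> braid_equiv n (i # u) (i # v)"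
  using braid_equiv_append_left[of n u v "[i]"] by simp

lemma braid_equiv_length: "braid_equiv n u v \<Longrightarrow> length u = length v"
  by (induction rule: braid_equiv.induct) auto

lemma word_perm_Nil [simp]: "word_perm [] = id"
  and word_perm_Cons: "word_perm (i # u) = transpose i (Suc i) \<circ> word_perm u"
  by (simp_all add: word_perm_def)

lemma word_perm_append: "word_perm (u @ v) = word_perm u \<circ> word_perm v"
  by (induction u) (auto simp: word_perm_Cons)

lemma braid_equiv_word_perm: "braid_equiv n u v \<Longrightarrow> word_perm u = word_perm v"
proof (induction rule: braid_equiv.induct)
  case (far i j)
  then show ?case by (auto simp: word_perm_Cons fun_eq_iff transpose_def)
next
  case (braid i)
  then show ?case by (auto simp: word_perm_Cons fun_eq_iff transpose_def)
qed (auto simp: word_perm_append)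

lemma braid_equiv_prod_list:
  fixes f :: "nat \<Rightarrow> 'a::monoid_mult"
  assumes "braid_equiv n u v"
    and "\<And>i j. 1 \<le> i \<Longrightarrow> Suc i < j \<Longrightarrow> j < n \<Longrightarrow> f i * f j = f j * f i"
    and "\<And>i. 1 \<le> i \<Longrightarrow> Suc i < n \<Longrightarrow> f i * f (Suc i) * f i = f (Suc i) * f i * f (Suc i)"
  shows "prod_list (map f u) = prod_list (map f v)"
  using assms(1)
proof (induction rule: braid_equiv.induct)
  case (far i j)
  then show ?case using assms(2)[of i j] by simp
next
  case (braid i)
  then show ?case using assms(3)[of i] by (simp add: mult.assoc)
qed simp_all

lemma braid_equiv_move_right:
  assumes "1 \<le> i" "i < n" "\<And>j. j \<in> set u \<Longrightarrow> 1 \<le> j \<and> j < n \<and> (Suc i < j \<or> Suc j < i)"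
  shows "braid_equiv n (i # u) (u @ [i])"
  using assms(3)
proof (induction u)
  case Nil
  show ?case by (simp add: braid_equiv.equiv_refl)
next
  case (Cons j u)
  have "braid_equiv n [i, j] [j, i]"
    using assms Cons.prems[of j] braid_equiv.far[of i j n] braid_equiv.equiv_sym[OF braid_equiv.far[of j i n]]
    by auto
  from braid_equiv_append_right[OF this, of u] have "braid_equiv n (i # j # u) (j # i # u)"
    by simp
  moreover have "braid_equiv n (j # i # u) (j # u @ [i])"
    by (rule braid_equiv_Cons[OF Cons.IH]) (use Cons.prems in auto)
  ultimately show ?case by (auto intro: braid_equiv.equiv_trans)
qed

text \<open>The letter \<open>i\<close> commutes past \<open>k\<close>, ..., \<open>i - 2\<close>;
  one braid relation turns \<open>i, i - 1, i\<close> into \<open>i - 1, i, i - 1\<close>; the last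
  letter \<open>i - 1\<close> then commutes past \<open>i + 1\<close>, ...,
  \<open>m\<close>.\<close>

lemma braid_equiv_move_through_upt:
  assumes "1 \<le> k" "k < i" "i \<le> m" "m < n"
  shows "braid_equiv n (i # [k..<Suc m]) ([k..<Suc m] @ [i - 1])"
proof -
  define a b where "a = [k..<i - 1]" and "b = [Suc i..<Suc m]"
  obtain j where j: "i = Suc j" using assms by (cases i) auto
  have eq: "[k..<Suc m] = a @ [j, i] @ b"
  proof -
    have "[k..<Suc m] = [k..<j] @ [j..<Suc m]"
      using assms j upt_add_eq_append[of k j "Suc m - j"] by simp
    also have "[j..<Suc m] = j # i # b"
      using assms j by (simp add: b_def upt_conv_Cons)
    finally show ?thesis by (simp add: a_def j)
  qed
  have "braid_equiv n (i # a) (a @ [i])"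
    by (rule braid_equiv_move_right) (use assms in \<open>auto simp: a_def\<close>)
  from braid_equiv_append_right[OF this, of "[j, i] @ b"]
  have 1: "braid_equiv n (i # [k..<Suc m]) (a @ [i, j, i] @ b)" by (simp add: eq)
  have "braid_equiv n [i, j, i] [j, i, j]"
    using braid_equiv.braid[of j n, THEN braid_equiv.equiv_sym] assms j by auto
  from braid_equiv.append[OF this, of a b]
  have 2: "braid_equiv n (a @ [i, j, i] @ b) (a @ [j, i] @ j # b)" by simp
  have "braid_equiv n (j # b) (b @ [j])"
    by (rule braid_equiv_move_right) (use assms j in \<open>auto simp: b_def\<close>)
  from braid_equiv_append_left[OF this, of "a @ [j, i]"]
  have 3: "braid_equiv n (a @ [j, i] @ j # b) ([k..<Suc m] @ [i - 1])" by (simp add: eq j)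
  show ?thesis by (rule braid_equiv.equiv_trans[OF 1 braid_equiv.equiv_trans[OF 2 3]])
qed

text \<open>\<open>s\<^sub>k s\<^sub>k\<^sub>+\<^sub>1 \<dots> s\<^sub>m\<close> are the minimal representatives of the cosets of \<open>S\<^sub>m\<close> in \<open>S\<^sub>m\<^sub>+\<^sub>1\<close>.\<close>

fun normal_words :: "nat \<Rightarrow> nat list set" where
  "normal_words 0 = {[]}"
| "normal_words (Suc m) = (\<lambda>(k, v). [k..<Suc m] @ v) ` ({1..Suc m} \<times> normal_words m)"

lemma normal_words_letters: "v \<in> normal_words m \<Longrightarrow> set v \<subseteq> {1..<m}"
  by (induction m arbitrary: v) fastforce+

lemma word_perm_permutes: "set v \<subseteq> {1..<m} \<Longrightarrow> word_perm v permutes {1..m}"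
proof (induction v)
  case (Cons i v)
  have "transpose i (Suc i) permutes {1..m}"
    by (rule permutes_swap_id) (use Cons.prems in auto)
  with Cons show ?case unfolding word_perm_Cons by (intro permutes_compose) auto
qed (simp add: permutes_id)

lemma word_perm_upt_apply: "k \<le> Suc m \<Longrightarrow> word_perm [k..<Suc m] (Suc m) = k"
proof (induction k rule: inc_induct)
  case base
  show ?case by simp
next
  case (step k)
  have "[k..<Suc m] = k # [Suc k..<Suc m]" using step by (simp add: upt_conv_Cons)
  then show ?case using step by (simp add: word_perm_Cons)
qed

lemma bij_word_perm: "bij (word_perm u)"
proof (induction u)
  case (Cons i u)
  then show ?case unfolding word_perm_Cons by (intro bij_comp) auto
qed (simp only: word_perm_Nil bij_id)

text \<open>\<open>k\<close> is read off as the image of \<open>m + 1\<close>, which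
  \<open>v\<close> fixes and s_k ... s_m sends to \<open>k\<close>. Cancelling this prefix leaves
  the permutation of \<open>v\<close>.\<close>

lemma word_perm_normal_inj:
  "inj_on (word_perm \<circ> (\<lambda>(k, v). [k..<Suc m] @ v)) ({1..Suc m} \<times> normal_words m)"
  if inj: "inj_on word_perm (normal_words m)"
proof (rule inj_onI, clarsimp simp only: o_apply split_conv mem_Sigma_iff prod.inject)
  fix k v k' v'
  assume k: "k \<in> {1..Suc m}" "k' \<in> {1..Suc m}" and v: "v \<in> normal_words m" "v' \<in> normal_words m"
    and eq: "word_perm ([k..<Suc m] @ v) = word_perm ([k'..<Suc m] @ v')"
  have top: "word_perm v (Suc m) = Suc m" if "v \<in> normal_words m" for v
    using word_perm_permutes[OF normal_words_letters[OF that]] by (auto simp: permutes_def)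
  have val: "word_perm ([k..<Suc m] @ v) (Suc m) = k" if "k \<in> {1..Suc m}" "v \<in> normal_words m" for k v
    using that top[OF that(2)] word_perm_upt_apply[of k m] by (simp only: word_perm_append o_apply atLeastAtMost_iff)
  have kk: "k = k'" using val[OF k(1) v(1)] val[OF k(2) v(2)] eq by metis
  have "word_perm [k..<Suc m] \<circ> word_perm v = word_perm [k..<Suc m] \<circ> word_perm v'"
    using eq unfolding word_perm_append kk .
  then have "word_perm v = word_perm v'"
    by (simp add: fun_eq_iff inj_eq[OF bij_is_inj[OF bij_word_perm]])
  with inj v kk show "k = k' \<and> v = v'" by (auto dest: inj_onD)
qed

lemma inj_on_word_perm: "inj_on word_perm (normal_words m)"
proof (induction m)
  case (Suc m)
  show ?case
    using word_perm_normal_inj[OF Suc]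
    unfolding normal_words.simps by (rule inj_on_imageI)
qed simp

lemma inj_on_normal_words:
  "inj_on (\<lambda>(k, v). [k..<Suc m] @ v) ({1..Suc m} \<times> normal_words m)"
  by (rule inj_on_imageI2[OF word_perm_normal_inj[OF inj_on_word_perm]])

lemma card_normal_words: "card (normal_words m) = fact m"
proof (induction m)
  case (Suc m)
  show ?case
    unfolding normal_words.simps card_image[OF inj_on_normal_words] by (simp add: Suc card_cartesian_product)
qed simp

text \<open>Given injectivity, surjectivity is a matter of counting: both sides have n!
  elements.\<close>

lemma word_perm_bij_betw: "bij_betw word_perm (normal_words n) {w. w permutes {1..n}}"
proof -
  have "word_perm ` normal_words n \<subseteq> {w. w permutes {1..n}}"
    using word_perm_permutes normal_words_letters by blast
  moreover have "card (word_perm ` normal_words n) = card {w. w permutes {1..n}}"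
    by (simp add: card_image inj_on_word_perm card_normal_words card_permutations)
  ultimately show ?thesis
    by (simp add: bij_betw_def inj_on_word_perm card_subset_eq finite_permutations)
qed

text \<open>Left multiplication by a generator either lengthens a normal word or cancels a letter. This is
  the exchange condition in a form from which Matsumoto's theorem follows.\<close>

lemma normal_word_step:
  assumes "v \<in> normal_words m" "1 \<le> i" "i < m" "m \<le> n"
  shows "\<exists>v'\<in>normal_words m. braid_equiv n (i # v) v' \<or> braid_equiv n (i # v') v"
  using assms
proof (induction m arbitrary: v i)
  case (Suc m)
  from Suc.prems(1) obtain k u where v: "v = [k..<Suc m] @ u" and k: "1 \<le> k" "k \<le> Suc m"
    and u: "u \<in> normal_words m" by auto
  have mem: "[j..<Suc m] @ w \<in> normal_words (Suc m)" if "1 \<le> j" "j \<le> Suc m" "w \<in> normal_words m" for j w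
    using that by force
  \<comment> \<open>Once the new letter has passed through the prefix and come out as
    \<open>j\<close>, the induction hypothesis adds \<open>j\<close> to the tail \<open>u\<close> or
    cancels it there.\<close>
  have push: ?case if p: "braid_equiv n (i # [k..<Suc m]) ([k..<Suc m] @ [j])" and j: "1 \<le> j" "j < m" for j
  proof -
    obtain u' where u': "u' \<in> normal_words m" "braid_equiv n (j # u) u' \<or> braid_equiv n (j # u') u"
      using Suc.IH[OF u, of j] j Suc.prems by auto
    have pu: "braid_equiv n (i # [k..<Suc m] @ w) ([k..<Suc m] @ j # w)" for w
      using braid_equiv_append_right[OF p, of w] by simp
    have "braid_equiv n (i # v) ([k..<Suc m] @ u') \<or> braid_equiv n (i # [k..<Suc m] @ u') v"
      using u'(2) unfolding v
      by (meson braid_equiv.equiv_trans braid_equiv_append_left pu)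
    then show ?thesis using mem[OF k u'(1)] by blast
  qed
  \<comment> \<open>Positions of the new letter relative to the run \<open>k, ..., m\<close>: it
    commutes past the run, prolongs it downwards, cancels its first letter, or passes through it as
    \<open>i - 1\<close>.\<close>
  consider "Suc i < k" | "k = Suc i" | "k = i" | "k < i" by linarith
  then show ?case
  proof cases
    case 1
    have "braid_equiv n (i # [k..<Suc m]) ([k..<Suc m] @ [i])"
      by (rule braid_equiv_move_right) (use 1 Suc.prems in auto)
    then show ?thesis by (rule push) (use 1 k Suc.prems in auto)
  next
    case 2
    then have "i # v = [i..<Suc m] @ u"
      using v k by (simp add: upt_conv_Cons)
    then show ?thesis using mem[of i u] Suc.prems u braid_equiv.equiv_refl[of n "i # v"] by auto
  next
    case 3
    then have "v = i # [Suc i..<Suc m] @ u"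
      using v Suc.prems by (simp add: upt_conv_Cons)
    then show ?thesis using mem[of "Suc i" u] Suc.prems u braid_equiv.equiv_refl[of n v] by auto
  next
    case 4
    then show ?thesis
      by (intro push[of "i - 1"] braid_equiv_move_through_upt) (use k Suc.prems in auto)
  qed
qed simp

text \<open>The word is normalized from its right end, one letter at a time. Equality of lengths
  means that no step was a cancellation, and the lengthening steps are braid equivalences.\<close>

lemma word_normal_form:
  assumes "set js \<subseteq> {1..<n}"
  shows "\<exists>v\<in>normal_words n. word_perm v = word_perm js \<and> length v \<le> length js \<and>
    (length v = length js \<longrightarrow> braid_equiv n js v)"
  using assms
proof (induction js)
  case Nil
  have "[] \<in> normal_words n"
  proof (induction n)
    case (Suc m)
    then have "[Suc m..<Suc m] @ [] \<in> normal_words (Suc m)" unfolding normal_words.simps by force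
    then show ?case by simp
  qed simp
  then show ?case by (auto intro: braid_equiv.equiv_refl)
next
  case (Cons i js)
  then obtain v where v: "v \<in> normal_words n" "word_perm v = word_perm js" "length v \<le> length js"
    "length v = length js \<longrightarrow> braid_equiv n js v" by auto
  obtain v' where v': "v' \<in> normal_words n" "braid_equiv n (i # v) v' \<or> braid_equiv n (i # v') v"
    using normal_word_step[OF v(1), of i n] Cons.prems by auto
  from v'(2) show ?case
  proof
    assume *: "braid_equiv n (i # v) v'"
    show ?thesis
      using braid_equiv_length[OF *] braid_equiv_word_perm[OF *] v v'(1) *
      by (intro bexI[of _ v'])
         (auto simp: word_perm_Cons intro: braid_equiv.equiv_trans braid_equiv_Cons)
  next
    assume *: "braid_equiv n (i # v') v"
    have "word_perm v' = transpose i (Suc i) \<circ> (transpose i (Suc i) \<circ> word_perm v')"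
      by (simp add: fun_eq_iff)
    then have "word_perm v' = word_perm (i # js)"
      using braid_equiv_word_perm[OF *] v(2) by (simp add: word_perm_Cons)
    \<comment> \<open>After a cancellation the normal word is at least two letters shorter than
      \<open>i # js\<close>, so the claim about equal lengths is vacuous.\<close>
    then show ?thesis
      using braid_equiv_length[OF *] v(3) v'(1) by (intro bexI[of _ v']) auto
  qed
qed

lemma normal_word_of_word:
  assumes "v \<in> normal_words n" "set js \<subseteq> {1..<n}" "word_perm js = word_perm v"
  shows "length v \<le> length js" "length v = length js \<Longrightarrow> braid_equiv n js v"
proof -
  obtain v' where v': "v' \<in> normal_words n" "word_perm v' = word_perm js" "length v' \<le> length js"
    "length v' = length js \<longrightarrow> braid_equiv n js v'"
    using word_normal_form[OF assms(2)] by auto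
  then have "v' = v" using assms inj_on_word_perm[of n] by (auto dest: inj_onD)
  with v' show "length v \<le> length js" "length v = length js \<Longrightarrow> braid_equiv n js v" by auto
qed

lemma perm_length_normal_word:
  assumes "v \<in> normal_words n"
  shows "perm_length n (word_perm v) = length v"
  unfolding perm_length_def
proof (rule Least_equality)
  show "\<exists>js. set js \<subseteq> {1..<n} \<and> word_perm js = word_perm v \<and> length js = length v"
    using normal_words_letters[OF assms] by blast
qed (use normal_word_of_word(1)[OF assms] in auto)

lemma reduced_word_normal_word:
  assumes "v \<in> normal_words n"
  shows "reduced_word n (word_perm v) v"
  using normal_words_letters[OF assms] by (simp add: reduced_word_def perm_length_normal_word[OF assms])

text \<open>Matsumoto's theorem for the symmetric group. It will be applied to the word that
  \<open>SOME\<close> picks in \<open>T_perm\<close> and \<open>intertwiner_perm\<close>.\<close>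

lemma reduced_word_braid_equiv_normal_word:
  assumes "v \<in> normal_words n" "reduced_word n (word_perm v) js"
  shows "braid_equiv n js v"
  using assms(2) normal_word_of_word(2)[OF assms(1)]
  by (simp add: reduced_word_def perm_length_normal_word[OF assms(1)])

lemma normal_words_length_le: "v \<in> normal_words m \<Longrightarrow> length v \<le> (\<Sum>k<m. k)"
proof (induction m arbitrary: v)
  case (Suc m)
  from Suc.prems obtain k u where v: "v = [k..<Suc m] @ u" "1 \<le> k" and u: "u \<in> normal_words m"
    by auto
  show ?case using Suc.IH[OF u] v by simp
qed simp

lemma ex_normal_word_max: "\<exists>v\<in>normal_words m. length v = (\<Sum>k<m. k)"
proof (induction m)
  case (Suc m)
  then obtain v where "v \<in> normal_words m" "length v = (\<Sum>k<m. k)" by auto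
  moreover from this have "[1..<Suc m] @ v \<in> normal_words (Suc m)"
    unfolding normal_words.simps by (intro image_eqI[of _ _ "(1, v)"]) simp_all
  ultimately show ?case by (intro bexI[of _ "[1..<Suc m] @ v"]) auto
qed simp

text \<open>\<open>longest_perm\<close> is given only as a maximizer, so the maximal length is
  computed and the permutation itself is never identified. The bound is attained by the normal word
  all of whose runs start at 1.\<close>

lemma perm_length_longest_perm: "perm_length n (longest_perm n) = (\<Sum>k<n. k)"
proof -
  obtain v where v: "v \<in> normal_words n" "length v = (\<Sum>k<n. k)"
    using ex_normal_word_max[of n] by (elim bexE)
  have vp: "word_perm v permutes {1..n}" by (rule word_perm_permutes[OF normal_words_letters[OF v(1)]])
  have bd: "perm_length n w \<le> (\<Sum>k<n. k)" if "w permutes {1..n}" for w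
  proof -
    have "w \<in> word_perm ` normal_words n"
      using that bij_betw_imp_surj_on[OF word_perm_bij_betw[of n]] by simp
    then obtain u where "u \<in> normal_words n" "w = word_perm u"
      by (elim imageE)
    then show ?thesis using normal_words_length_le[of u n] perm_length_normal_word[of u n] by simp
  qed
  have "longest_perm n permutes {1..n} \<and>
      (\<forall>y. y permutes {1..n} \<longrightarrow> perm_length n y \<le> perm_length n (longest_perm n))"
    unfolding longest_perm_def
    by (rule arg_max_nat_lemma[where P = "\<lambda>w. w permutes {1..n}" and k = "word_perm v" and
          b = "Suc (\<Sum>k<n. k)"]) (use vp bd in \<open>auto simp: less_Suc_eq_le\<close>)
  then have "longest_perm n permutes {1..n}" "length v \<le> perm_length n (longest_perm n)"
    using vp perm_length_normal_word[OF v(1)] by auto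
  with bd[of "longest_perm n"] v(2) show ?thesis by simp
qed


section \<open>Sums over the symmetric group\<close>

text \<open>With normal words in place of permutations, the recursion along the groups S_m becomes
  one on lists. Under the braid relations this is the sum over S_m along any reduced words.\<close>

definition word_sum :: "(nat \<Rightarrow> 'a::{ring,monoid_mult}) \<Rightarrow> nat \<Rightarrow> 'a" where
  "word_sum f m = (\<Sum>v\<in>normal_words m. prod_list (map f v))"

text \<open>The index \<open>k = Suc m\<close> contributes the empty word, hence the summand
  1.\<close>

definition ladder :: "(nat \<Rightarrow> 'a::{ring,monoid_mult}) \<Rightarrow> nat \<Rightarrow> 'a" where
  "ladder f m = (\<Sum>k\<in>{1..Suc m}. prod_list (map f [k..<Suc m]))"

lemma finite_normal_words: "finite (normal_words m)"
  by (induction m) auto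

lemma word_sum_0: "word_sum f 0 = 1"
  by (simp add: word_sum_def)

lemma word_sum_Suc: "word_sum f (Suc m) = ladder f m * word_sum f m"
proof -
  have "word_sum f (Suc m) =
      (\<Sum>(k, v)\<in>{1..Suc m} \<times> normal_words m. prod_list (map f [k..<Suc m]) * prod_list (map f v))"
    unfolding word_sum_def normal_words.simps sum.reindex[OF inj_on_normal_words]
    by (intro sum.cong) auto
  also have "\<dots> = ladder f m * word_sum f m"
    by (simp only: ladder_def word_sum_def sum_product sum.cartesian_product)
  finally show ?thesis .
qed

lemma ladder_0: "ladder f 0 = 1"
  by (simp add: ladder_def)

lemma ladder_Suc: "ladder f (Suc m) = 1 + ladder f m * f (Suc m)"
proof -
  have "ladder f (Suc m) = prod_list (map f [Suc (Suc m)..<Suc (Suc m)]) +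
      (\<Sum>k\<in>{1..Suc m}. prod_list (map f [k..<Suc (Suc m)]))"
    unfolding ladder_def by (subst atLeastAtMostSuc_conv) simp_all
  also have "(\<Sum>k\<in>{1..Suc m}. prod_list (map f [k..<Suc (Suc m)])) = ladder f m * f (Suc m)"
    unfolding ladder_def sum_distrib_right
    by (intro sum.cong) (simp_all add: upt_Suc_append[of _ "Suc m"])
  finally show ?thesis by simp
qed

text \<open>Since \<open>f i\<close> squares to 1, lengthening and cancelling both turn the product
  over a normal word into the product over another one, that of s_i times the permutation. Left
  multiplication by \<open>f i\<close> thus permutes the summands.\<close>

lemma word_sum_invariant:
  fixes f :: "nat \<Rightarrow> 'a::{ring,monoid_mult}"
  assumes far: "\<And>i j. 1 \<le> i \<Longrightarrow> Suc i < j \<Longrightarrow> j < n \<Longrightarrow> f i * f j = f j * f i"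
    and braid: "\<And>i. 1 \<le> i \<Longrightarrow> Suc i < n \<Longrightarrow> f i * f (Suc i) * f i = f (Suc i) * f i * f (Suc i)"
    and square: "\<And>i. 1 \<le> i \<Longrightarrow> i < n \<Longrightarrow> f i * f i = 1"
    and i: "1 \<le> i" "i < m" and m: "m \<le> n"
  shows "f i * word_sum f m = word_sum f m"
proof -
  have P: "prod_list (map f u) = prod_list (map f v)" if "braid_equiv n u v" for u v
    using that far braid by (rule braid_equiv_prod_list)
  have "\<exists>v'. v' \<in> normal_words m \<and> word_perm v' = transpose i (Suc i) \<circ> word_perm v \<and>
      f i * prod_list (map f v) = prod_list (map f v')" if v: "v \<in> normal_words m" for v
  proof -
    obtain v' where v': "v' \<in> normal_words m" "braid_equiv n (i # v) v' \<or> braid_equiv n (i # v') v"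
      using normal_word_step[OF v i m] by (elim bexE)
    from v'(2) have "word_perm v' = transpose i (Suc i) \<circ> word_perm v \<and>
      f i * prod_list (map f v) = prod_list (map f v')"
    proof
      assume *: "braid_equiv n (i # v) v'"
      show ?thesis using P[OF *] braid_equiv_word_perm[OF *] by (simp add: word_perm_Cons)
    next
      assume *: "braid_equiv n (i # v') v"
      have "f i * prod_list (map f v) = f i * f i * prod_list (map f v')"
        using P[OF *] by (simp add: mult.assoc)
      also have "\<dots> = prod_list (map f v')" using square[of i] i m by simp
      finally show ?thesis
        using braid_equiv_word_perm[OF *, symmetric] by (simp add: word_perm_Cons fun_eq_iff)
    qed
    with v'(1) show ?thesis by (intro exI[of _ v'] conjI) simp_all
  qed
  then obtain g where g: "\<And>v. v \<in> normal_words m \<Longrightarrow> g v \<in> normal_words m"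
    "\<And>v. v \<in> normal_words m \<Longrightarrow> word_perm (g v) = transpose i (Suc i) \<circ> word_perm v"
    "\<And>v. v \<in> normal_words m \<Longrightarrow> f i * prod_list (map f v) = prod_list (map f (g v))"
    by metis
  have "inj_on g (normal_words m)"
  proof (rule inj_onI)
    fix u v assume *: "u \<in> normal_words m" "v \<in> normal_words m" "g u = g v"
    then have "transpose i (Suc i) \<circ> word_perm u = transpose i (Suc i) \<circ> word_perm v"
      using g(2)[of u] g(2)[of v] by simp
    then have "word_perm u = word_perm v"
      by (simp only: bij_transpose[THEN bij_is_inj, THEN fun.inj_map, THEN inj_eq])
    then show "u = v" by (rule inj_onD[OF inj_on_word_perm _ *(1,2)])
  qed
  moreover have "g ` normal_words m \<subseteq> normal_words m" using g(1) by blast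
  ultimately have "bij_betw g (normal_words m) (normal_words m)"
    by (simp add: bij_betw_def endo_inj_surj[OF finite_normal_words])
  then have "(\<Sum>v\<in>normal_words m. prod_list (map f (g v))) = word_sum f m"
    unfolding word_sum_def by (rule sum.reindex_bij_betw)
  then show ?thesis
    by (simp add: word_sum_def sum_distrib_left g(3))
qed

text \<open>Used with \<open>x\<close> a product of c-functions: with \<open>g = f\<close> to
  commute it past a sum, and with two differently normalized families of intertwiners for the
  antisymmetrizer.\<close>

lemma word_sum_intertwine:
  assumes "\<And>i. 1 \<le> i \<Longrightarrow> i < m \<Longrightarrow> f i * x = x * g i"
  shows "word_sum f m * x = x * word_sum g m"
proof -
  have "prod_list (map f v) * x = x * prod_list (map g v)" if "set v \<subseteq> {1..<m}" for v
    using that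
  proof (induction v)
    case (Cons i v)
    have "prod_list (map f (i # v)) * x = f i * x * prod_list (map g v)"
      using Cons by (simp add: mult.assoc)
    also have "\<dots> = x * prod_list (map g (i # v))"
      using Cons.prems assms[of i] by (simp add: mult.assoc)
    finally show ?case .
  qed simp
  from this[OF normal_words_letters] show ?thesis
    unfolding word_sum_def sum_distrib_left sum_distrib_right by (rule sum.cong[OF refl])
qed

lemma prod_list_map_mset_eq:
  fixes h :: "'b \<Rightarrow> 'a::monoid_mult"
  assumes comm: "\<And>x y. h x * h y = h y * h x" and "mset xs = mset ys"
  shows "prod_list (map h xs) = prod_list (map h ys)"
  using assms(2)
proof (induction xs arbitrary: ys)
  case (Cons x xs)
  then have "x \<in> set ys" using mset_eq_setD by fastforce
  then obtain us vs where ys: "ys = us @ x # vs" by (auto dest: split_list)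
  have "h x * prod_list (map h us) = prod_list (map h us) * h x" for us
  proof (induction us)
    case (Cons u us)
    have "h x * prod_list (map h (u # us)) = h u * (h x * prod_list (map h us))"
      using comm[of x u] by (simp flip: mult.assoc)
    then show ?case by (simp add: Cons mult.assoc)
  qed simp
  note move = this[of us]
  have "prod_list (map h xs) = prod_list (map h (us @ vs))"
    by (rule Cons.IH) (use Cons.prems ys in auto)
  then show ?case using move by (simp add: ys flip: mult.assoc)
qed simp

lemma prod_list_map_distinct_eq:
  fixes h :: "'b \<Rightarrow> 'a::monoid_mult"
  assumes "\<And>x y. h x * h y = h y * h x" "distinct xs" "distinct ys" "set xs = set ys"
  shows "prod_list (map h xs) = prod_list (map h ys)"
  using assms by (intro prod_list_map_mset_eq) (auto simp: set_eq_iff_mset_eq_distinct)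

lemma commute_prod_list:
  fixes x :: "'a::monoid_mult"
  assumes "\<And>y. y \<in> set ys \<Longrightarrow> x * y = y * x"
  shows "x * prod_list ys = prod_list ys * x"
  using assms
proof (induction ys)
  case (Cons y ys)
  have "x * prod_list (y # ys) = y * (x * prod_list ys)"
    using Cons.prems[of y] by (simp flip: mult.assoc)
  then show ?case using Cons by (simp add: mult.assoc)
qed simp

lemma intertwine_left:
  fixes x :: "'a::semigroup_mult"
  shows "x * y = z * x \<Longrightarrow> x * (y * w) = z * (x * w)"
  by (simp flip: mult.assoc)

lemma intertwine_inverse:
  fixes x :: "'a::monoid_mult"
  assumes "x * y = z * x" "y * y' = 1" "z' * z = 1"
  shows "x * y' = z' * x"
proof -
  have "x * y' = z' * (z * x) * y'" using assms(3) by (simp flip: mult.assoc)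
  also have "\<dots> = z' * x" by (simp add: assms(1)[symmetric] assms(2) mult.assoc)
  finally show ?thesis .
qed


section \<open>Intertwiners\<close>

text \<open>Here \<open>A\<close>, \<open>B\<close> are the unnormalized intertwiners of s_i,
  s_{i+1}, and \<open>x\<close>, \<open>y\<close>, \<open>z\<close> are D_{i,i+1}, D_{i+1,i+2},
  D_{i,i+2}, so that \<open>A + x\<close>, \<open>B + y\<close> are the Hecke generators. Both sides
  of their braid relation are expanded with all coefficients moved to the left; everything except
  the two cubic terms then cancels, the coefficients of \<open>A\<close> and \<open>B\<close> by
  \<open>zx\<close> and \<open>zy\<close>.\<close>

lemma intertwiner_braid:
  fixes x y z q A B :: "'a::{ring,monoid_mult}"
  assumes comm: "x * y = y * x" "x * z = z * x" "y * z = z * y"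
    and Aq: "A * x = (q - x) * A" "A * y = z * A" "A * z = y * A"
    and Bq: "B * y = (q - y) * B" "B * x = z * B" "B * z = x * B"
    and AA: "A * A = 1 + x * (q - x)" and BB: "B * B = 1 + y * (q - y)"
    and zx: "z * (q - x) + x * y = z * y" and zy: "z * (q - y) + y * x = z * x"
    and braid: "(A + x) * (B + y) * (A + x) = (B + y) * (A + x) * (B + y)"
  shows "A * B * A = B * A * B"
proof -
  note left = Aq[THEN intertwine_left] Bq[THEN intertwine_left]
  have ABx: "A * B * x = y * A * B" by (simp add: mult.assoc Aq Bq left)
  have AyA: "A * y * A = z + z * x * (q - x)" by (simp add: Aq AA mult.assoc distrib_left)
  have Ayx: "A * y * x = z * (q - x) * A" by (simp add: mult.assoc Aq Bq left)
  have xBx: "x * B * x = x * z * B" by (simp add: Bq mult.assoc)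
  have BAy: "B * A * y = x * B * A" by (simp add: mult.assoc Aq Bq left)
  have BxB: "B * x * B = z + z * y * (q - y)" by (simp add: Bq BB mult.assoc distrib_left)
  have Bxy: "B * x * y = z * (q - y) * B" by (simp add: mult.assoc Aq Bq left)
  have yAy: "y * A * y = y * z * A" by (simp add: Aq mult.assoc)
  \<comment> \<open>The degree-zero terms have the common value xyz, by \<open>zx\<close> on one
    side and by \<open>zy\<close> on the other.\<close>
  have const: "z * x * (q - x) + x * y * x = z * y * (q - y) + y * x * y"
  proof -
    note c = comm[symmetric] comm[symmetric, THEN intertwine_left]
    have "z * x * (q - x) + x * y * x = x * (z * (q - x) + x * y)"
      by (simp only: distrib_left mult.assoc c)
    also have "\<dots> = y * (z * (q - y) + y * x)" unfolding zx zy by (simp only: mult.assoc c)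
    also have "\<dots> = z * y * (q - y) + y * x * y"
      by (simp only: distrib_left mult.assoc c)
    finally show ?thesis .
  qed
  have "(A + x) * (B + y) * (A + x) = A * B * A + A * B * x + A * y * A + A * y * x
      + x * B * A + x * B * x + x * y * A + x * y * x"
    by (simp add: distrib_left distrib_right add.assoc)
  also have "\<dots> = A * B * A + y * A * B + z + x * B * A + x * z * B
      + (z * (q - x) + x * y) * A + (z * x * (q - x) + x * y * x)"
    unfolding ABx AyA Ayx xBx by (simp add: distrib_right add_ac)
  finally have l: "(A + x) * (B + y) * (A + x) = A * B * A + y * A * B + z + x * B * A + x * z * B
      + z * y * A + (z * x * (q - x) + x * y * x)" unfolding zx .
  have "(B + y) * (A + x) * (B + y) = B * A * B + B * A * y + B * x * B + B * x * y
      + y * A * B + y * A * y + y * x * B + y * x * y"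
    by (simp add: distrib_left distrib_right add.assoc)
  also have "\<dots> = B * A * B + y * A * B + z + x * B * A + (z * (q - y) + y * x) * B
      + y * z * A + (z * y * (q - y) + y * x * y)"
    unfolding BAy BxB Bxy yAy by (simp add: distrib_right add_ac)
  finally have r: "(B + y) * (A + x) * (B + y) = B * A * B + y * A * B + z + x * B * A + z * x * B
      + y * z * A + (z * x * (q - x) + x * y * x)" unfolding zy const .
  from braid show ?thesis unfolding l r comm(2,3) by simp
qed

text \<open>Here \<open>D i j\<close> stands for \<open>q / (1 - Z\<^sub>i / Z\<^sub>j)\<close> (and for \<open>0\<close> outside the range of indices), so that
  \<open>s - D i j\<close> is the \<open>c\<close>-function.\<close>

locale hecke_intertwiners =
  fixes n :: nat and s s' q :: "'a::{ring,monoid_mult}"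
    and T :: "nat \<Rightarrow> 'a" and D ci :: "nat \<Rightarrow> nat \<Rightarrow> 'a"
  assumes s_inverse: "s * s' = 1" and s_central: "\<And>x. s * x = x * s" "\<And>x. s' * x = x * s'"
    and q_def: "q = s - s'"
    and T_square: "\<And>i. 1 \<le> i \<Longrightarrow> i < n \<Longrightarrow> T i * T i = q * T i + 1"
    and T_far: "\<And>i j. 1 \<le> i \<Longrightarrow> Suc i < j \<Longrightarrow> j < n \<Longrightarrow> T i * T j = T j * T i"
    and T_braid: "\<And>i. 1 \<le> i \<Longrightarrow> Suc i < n \<Longrightarrow> T i * T (Suc i) * T i = T (Suc i) * T i * T (Suc i)"
    and D_comm: "\<And>i j k l. D i j * D k l = D k l * D i j"
    and D_sum: "\<And>i j. i \<in> {1..n} \<Longrightarrow> j \<in> {1..n} \<Longrightarrow> i \<noteq> j \<Longrightarrow> D i j + D j i = q"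
    and D_triple: "\<And>i j k. i \<in> {1..n} \<Longrightarrow> j \<in> {1..n} \<Longrightarrow> k \<in> {1..n} \<Longrightarrow>
      i \<noteq> j \<Longrightarrow> i \<noteq> k \<Longrightarrow> j \<noteq> k \<Longrightarrow> D i k * D j k = D j i * D i k + D i j * D j k"
    and T_D: "\<And>i j k. 1 \<le> i \<Longrightarrow> i < n \<Longrightarrow> (T i - D i (Suc i)) * D j k =
      D (transpose i (Suc i) j) (transpose i (Suc i) k) * (T i - D i (Suc i))"
    and c_inverse: "\<And>i j. (s - D i j) * ci i j = 1" "\<And>i j. ci i j * (s - D i j) = 1"
begin

definition c :: "nat \<Rightarrow> nat \<Rightarrow> 'a" where "c i j = s - D i j"
text \<open>This is C_{s_i} - c_{i+1,i}: the two occurrences of \<open>s'\<close> cancel because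
  \<open>c (Suc i) i = s' + D i (Suc i)\<close>.\<close>

definition tau :: "nat \<Rightarrow> 'a" where "tau i = T i - D i (Suc i)"
definition xi :: "nat \<Rightarrow> 'a" where "xi i = ci i (Suc i) * tau i"

lemma s_inverse': "s' * s = 1"
  using s_inverse s_central(1)[of s'] by simp

lemma q_central: "q * x = x * q"
  by (simp add: q_def left_diff_distrib right_diff_distrib s_central)

lemma c_ci: "c i j * ci i j = 1" "ci i j * c i j = 1"
  by (simp_all add: c_def c_inverse)

lemma c_ci_left: "c i j * (ci i j * x) = x" "ci i j * (c i j * x) = x"
  by (simp_all add: c_ci flip: mult.assoc)

lemma c_D_comm: "c i j * D k l = D k l * c i j"
  by (simp add: c_def left_diff_distrib right_diff_distrib s_central(1) D_comm[of i j])

lemma c_comm: "c i j * c k l = c k l * c i j"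
  by (simp add: c_def algebra_simps s_central(1)[of "D _ _"] D_comm[of i j])

lemma c_ci_comm: "c i j * ci k l = ci k l * c i j"
  by (rule intertwine_inverse[of _ "c k l" "c k l"]) (simp_all add: c_comm[of i j] c_ci)

lemma ci_comm: "ci i j * ci k l = ci k l * ci i j"
  by (rule intertwine_inverse[of _ "c k l" "c k l"]) (simp_all add: c_ci c_ci_comm)

text \<open>Follows from D_ij + D_ji = s - s^-1. Compared with the definition of \<open>c\<close>,
  this form shows that exchanging \<open>s\<close> with \<open>- s'\<close> turns
  \<open>c i j\<close> into \<open>- c j i\<close>.\<close>

lemma c_eq:
  assumes "i \<in> {1..n}" "j \<in> {1..n}" "i \<noteq> j"
  shows "c i j = s' + D j i"
proof -
  have "D i j = q - D j i" using D_sum[OF assms] by (simp add: algebra_simps)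
  then show ?thesis by (simp add: c_def q_def)
qed

lemma tau_D:
  "1 \<le> i \<Longrightarrow> i < n \<Longrightarrow>
    tau i * D j k = D (transpose i (Suc i) j) (transpose i (Suc i) k) * tau i"
  unfolding tau_def by (rule T_D)

lemma tau_c:
  "1 \<le> i \<Longrightarrow> i < n \<Longrightarrow>
    tau i * c j k = c (transpose i (Suc i) j) (transpose i (Suc i) k) * tau i"
  unfolding c_def by (simp add: left_diff_distrib right_diff_distrib tau_D s_central(1))

lemma tau_ci:
  "1 \<le> i \<Longrightarrow> i < n \<Longrightarrow>
    tau i * ci j k = ci (transpose i (Suc i) j) (transpose i (Suc i) k) * tau i"
  by (rule intertwine_inverse[OF tau_c[of i j k]]) (simp_all add: c_ci)

lemma ci_D_comm: "ci i j * D k l = D k l * ci i j"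
  by (rule intertwine_inverse[of "D k l" "c i j" "c i j", symmetric]) (simp_all add: c_ci c_D_comm)

lemma xi_D:
  "1 \<le> i \<Longrightarrow> i < n \<Longrightarrow>
    xi i * D j k = D (transpose i (Suc i) j) (transpose i (Suc i) k) * xi i"
  unfolding xi_def by (simp add: tau_D mult.assoc) (simp add: ci_D_comm flip: mult.assoc)

lemma xi_c:
  "1 \<le> i \<Longrightarrow> i < n \<Longrightarrow>
    xi i * c j k = c (transpose i (Suc i) j) (transpose i (Suc i) k) * xi i"
  unfolding xi_def by (simp add: tau_c mult.assoc) (simp add: c_ci_comm flip: mult.assoc)

text \<open>Moving one \<open>D\<close> across \<open>tau\<close> and applying the quadratic
  relation removes every \<open>T\<close>. By \<open>c_c_swap\<close> the result is c_{i,i+1}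
  c_{i+1,i}, which is why dividing by a single c-function makes the square of \<open>xi\<close>
  equal to 1.\<close>

lemma tau_square:
  assumes i: "1 \<le> i" "i < n"
  shows "tau i * tau i = 1 + D i (Suc i) * D (Suc i) i"
proof -
  let ?x = "D i (Suc i)" and ?y = "D (Suc i) i"
  have y: "?y = q - ?x" using D_sum[of i "Suc i"] i by (auto simp: algebra_simps)
  have "tau i * ?x = ?y * tau i" using tau_D[OF i, of i "Suc i"] by simp
  then have "tau i * tau i = T i * T i - ?y * tau i - ?x * T i"
    unfolding tau_def by (simp add: algebra_simps)
  then show ?thesis
    using T_square[OF i] unfolding tau_def y by (simp add: algebra_simps q_central[of "D _ _"])
qed

lemma c_c_swap:
  assumes i: "i \<in> {1..n}" "j \<in> {1..n}" "i \<noteq> j"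
  shows "c i j * c j i = 1 + D i j * D j i"
proof -
  have "c i j * c j i = s * (s' + D i j) - D i j * (s' + D i j)"
    using i by (subst c_eq[of j i]) (auto simp: c_def left_diff_distrib)
  also have "\<dots> = 1 + D i j * (s - s' - D i j)"
    by (simp add: distrib_left right_diff_distrib s_inverse s_central(1)[of "D _ _"])
  also have "s - s' - D i j = D j i" using D_sum[OF i] by (simp add: q_def algebra_simps)
  finally show ?thesis .
qed

lemma xi_square:
  assumes i: "1 \<le> i" "i < n"
  shows "xi i * xi i = 1"
proof -
  have "xi i * xi i = ci i (Suc i) * ci (Suc i) i * (tau i * tau i)"
    unfolding xi_def using tau_ci[OF i, of i "Suc i"] by (simp add: mult.assoc intertwine_left)
  also have "tau i * tau i = c (Suc i) i * c i (Suc i)"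
    using i by (simp add: tau_square c_c_swap D_comm[of i])
  finally show ?thesis by (simp add: mult.assoc c_ci_left c_ci)
qed

text \<open>s_i fixes \<open>j\<close> and \<open>j + 1\<close> and vice versa, so each
  \<open>tau\<close> commutes with the correction term \<open>D\<close> of the other. Commutation of
  the two \<open>T\<close> then suffices.\<close>

lemma tau_far:
  assumes "1 \<le> i" "Suc i < j" "j < n"
  shows "tau i * tau j = tau j * tau i"
proof -
  have ij: "tau i * D j (Suc j) = D j (Suc j) * tau i" "tau j * D i (Suc i) = D i (Suc i) * tau j"
    using assms by (simp_all add: tau_D transpose_def)
  from ij(2) have "T j * D i (Suc i) = D i (Suc i) * T j"
    by (simp add: tau_def algebra_simps D_comm[of i])
  moreover from ij(1) have "T i * D j (Suc j) = D j (Suc j) * T i"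
    by (simp add: tau_def algebra_simps D_comm[of i])
  ultimately show ?thesis
    using T_far[OF assms] by (simp add: tau_def algebra_simps D_comm[of i])
qed

lemma xi_far:
  assumes "1 \<le> i" "Suc i < j" "j < n"
  shows "xi i * xi j = xi j * xi i"
proof -
  have i: "tau i * ci j (Suc j) = ci j (Suc j) * tau i"
    and j: "tau j * ci i (Suc i) = ci i (Suc i) * tau j"
    using assms by (simp_all add: tau_ci transpose_def)
  have "xi i * xi j = ci i (Suc i) * ci j (Suc j) * (tau i * tau j)"
    unfolding xi_def by (simp add: mult.assoc i[THEN intertwine_left])
  also have "\<dots> = ci j (Suc j) * ci i (Suc i) * (tau j * tau i)"
    using tau_far[OF assms] ci_comm[of i "Suc i"] by simp
  also have "\<dots> = xi j * xi i"
    unfolding xi_def by (simp add: mult.assoc j[THEN intertwine_left])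
  finally show ?thesis .
qed

lemma tau_braid:
  assumes "1 \<le> i" "Suc i < n"
  shows "tau i * tau (Suc i) * tau i = tau (Suc i) * tau i * tau (Suc i)"
proof (rule intertwiner_braid[of "D i (Suc i)" "D (Suc i) (Suc (Suc i))" "D i (Suc (Suc i))" _ q])
  let ?j = "Suc i" and ?k = "Suc (Suc i)"
  have dx: "q - D i ?j = D ?j i" and dy: "q - D ?j ?k = D ?k ?j"
    using D_sum[of i ?j] D_sum[of ?j ?k] assms by (auto simp: algebra_simps)
  show "tau i * D i ?j = (q - D i ?j) * tau i" "tau ?j * D ?j ?k = (q - D ?j ?k) * tau ?j"
    "tau i * D ?j ?k = D i ?k * tau i" "tau i * D i ?k = D ?j ?k * tau i"
    "tau ?j * D i ?j = D i ?k * tau ?j" "tau ?j * D i ?k = D i ?j * tau ?j"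
    unfolding dx dy using assms by (simp_all add: tau_D transpose_def)
  show "tau i * tau i = 1 + D i ?j * (q - D i ?j)" "tau ?j * tau ?j = 1 + D ?j ?k * (q - D ?j ?k)"
    unfolding dx dy using assms by (simp_all add: tau_square)
  have tri: "D i ?k * D ?j ?k = D ?j i * D i ?k + D i ?j * D ?j ?k"
    using D_triple[of i ?j ?k] assms by auto
  then show zx: "D i ?k * (q - D i ?j) + D i ?j * D ?j ?k = D i ?k * D ?j ?k"
    unfolding dx by (simp add: D_comm[of i ?k])
  from zx have "D i ?k * q = D i ?k * D ?j ?k + D i ?k * D i ?j - D i ?j * D ?j ?k"
    by (simp add: right_diff_distrib algebra_simps)
  then show "D i ?k * (q - D ?j ?k) + D ?j ?k * D i ?j = D i ?k * D i ?j"
    by (simp add: right_diff_distrib D_comm[of ?j ?k i ?j])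
  show "(tau i + D i ?j) * (tau ?j + D ?j ?k) * (tau i + D i ?j) =
      (tau ?j + D ?j ?k) * (tau i + D i ?j) * (tau ?j + D ?j ?k)"
    using T_braid[OF assms] by (simp add: tau_def)
qed (simp_all add: D_comm)

text \<open>Moving all denominators to the left collects on both sides the same three factors, one
  for each pair among the indices i, i+1, i+2.\<close>

lemma xi_braid:
  assumes "1 \<le> i" "Suc i < n"
  shows "xi i * xi (Suc i) * xi i = xi (Suc i) * xi i * xi (Suc i)"
proof -
  let ?j = "Suc i" and ?k = "Suc (Suc i)"
  have 1: "tau i * ci ?j ?k = ci i ?k * tau i" "tau ?j * ci i ?j = ci i ?k * tau ?j"
    "tau i * ci i ?k = ci ?j ?k * tau i" "tau ?j * ci i ?k = ci i ?j * tau ?j"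
    using assms by (simp_all add: tau_ci transpose_def)
  have "xi i * xi ?j * xi i = ci i ?j * ci i ?k * ci ?j ?k * (tau i * tau ?j * tau i)"
    unfolding xi_def by (simp add: mult.assoc 1[THEN intertwine_left])
  also have "\<dots> = ci ?j ?k * ci i ?k * ci i ?j * (tau ?j * tau i * tau ?j)"
    unfolding tau_braid[OF assms]
    by (simp only: mult.assoc ci_comm intertwine_left[OF ci_comm])
  also have "\<dots> = xi ?j * xi i * xi ?j"
    unfolding xi_def by (simp add: mult.assoc 1[THEN intertwine_left])
  finally show ?thesis .
qed

lemma xi_word_sum:
  "1 \<le> i \<Longrightarrow> i < m \<Longrightarrow> m \<le> n \<Longrightarrow> xi i * word_sum xi m = word_sum xi m"
  by (rule word_sum_invariant[of n]; (rule xi_far xi_braid xi_square)?; assumption?)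

end


section \<open>Partial fractions and the factorization of the symmetrizer\<close>

fun inversion_pairs :: "nat \<Rightarrow> (nat \<times> nat) list" where
  "inversion_pairs 0 = []"
| "inversion_pairs (Suc m) = map (Pair (Suc m)) [1..<Suc m] @ inversion_pairs m"

lemma set_inversion_pairs: "set (inversion_pairs m) = {(i, j). 1 \<le> j \<and> j < i \<and> i \<le> m}"
  by (induction m) (auto simp: le_Suc_eq)

lemma distinct_inversion_pairs: "distinct (inversion_pairs m)"
  by (induction m) (auto simp: set_inversion_pairs distinct_map inj_on_def)

lemma length_inversion_pairs: "length (inversion_pairs m) = (\<Sum>k<m. k)"
  by (induction m) auto

context hecke_intertwiners
begin

lemma c_list_comm: "prod_list (map (c k) L) * D i j = D i j * prod_list (map (c k) L)"
  by (rule commute_prod_list[symmetric]) (auto simp: c_D_comm)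

lemma xi_c_list:
  assumes "1 \<le> i" "i < n"
  shows "xi i * prod_list (map (c k) L) =
    prod_list (map (c (transpose i (Suc i) k)) (map (transpose i (Suc i)) L)) * xi i"
proof (induction L)
  case (Cons a L)
  then show ?case by (simp add: mult.assoc intertwine_left[OF xi_c[OF assms]])
qed simp

lemma s'_power_comm: "s' ^ k * x = x * s' ^ k"
proof (induction k)
  case (Suc k)
  then show ?case by (simp add: mult.assoc s_central(2)[of "_ * _"]) (simp add: s_central(2) flip: mult.assoc)
qed simp

text \<open>As functions of \<open>Z\<^sub>z\<close> the factors on the left have simple poles at the \<open>Z\<^sub>k\<close>; \<open>D_triple\<close> is the
  decomposition of a product of two of them.\<close>

lemma c_list_partial_fractions:
  assumes "distinct L" "set L \<subseteq> {1..n}" "z \<in> {1..n}" "z \<notin> set L"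
  shows "prod_list (map (c z) L) =
    s' ^ length L + (\<Sum>k\<in>set L. prod_list (map (c k) (removeAll k L)) * D k z)"
  using assms
proof (induction L arbitrary: z)
  case (Cons a L)
  let ?P = "\<lambda>k. prod_list (map (c k) (removeAll k L))"
  have IHz: "prod_list (map (c z) L) = s' ^ length L + (\<Sum>k\<in>set L. ?P k * D k z)"
    by (rule Cons.IH) (use Cons.prems in auto)
  \<comment> \<open>The hypothesis with \<open>a\<close> in place of \<open>z\<close> expands the
    coefficient of the new pole \<open>D a z\<close>. The resulting products
    \<open>D k a * D a z\<close> are what \<open>D_triple\<close> combines with the old poles
    \<open>D k z\<close>.\<close>
  have IHa: "prod_list (map (c a) L) = s' ^ length L + (\<Sum>k\<in>set L. ?P k * D k a)"
    by (rule Cons.IH) (use Cons.prems in auto)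
  have cza: "c z a = s' + D a z" using Cons.prems by (intro c_eq) auto
  have "removeAll a L = L" using Cons.prems by (simp add: removeAll_id)
  then have "(\<Sum>k\<in>set (a # L). prod_list (map (c k) (removeAll k (a # L))) * D k z) =
      prod_list (map (c a) L) * D a z + (\<Sum>k\<in>set L. c k a * ?P k * D k z)"
    using Cons.prems by (auto intro!: arg_cong2[of _ _ _ _ "(+)"] sum.cong)
  also have "\<dots> = s' ^ length L * D a z + (\<Sum>k\<in>set L. ?P k * D k a * D a z + c k a * ?P k * D k z)"
    unfolding IHa by (simp add: distrib_right sum_distrib_right sum.distrib)
  also have "(\<Sum>k\<in>set L. ?P k * D k a * D a z + c k a * ?P k * D k z) =
      (\<Sum>k\<in>set L. c z a * (?P k * D k z))"
  proof (intro sum.cong refl)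
    fix k assume k: "k \<in> set L"
    have cka: "c k a = s' + D a k" using k Cons.prems by (intro c_eq) auto
    have tri: "D a z * D k z = D k a * D a z + D a k * D k z"
      using k Cons.prems by (intro D_triple) auto
    have comm: "D i j * ?P k = ?P k * D i j" for i j by (rule c_list_comm[symmetric])
    have "c z a * (?P k * D k z) = s' * ?P k * D k z + ?P k * (D a z * D k z)"
      unfolding cza by (simp add: distrib_right comm flip: mult.assoc)
    also have "\<dots> = ?P k * D k a * D a z + c k a * ?P k * D k z"
      unfolding tri cka by (simp add: distrib_right distrib_left comm flip: mult.assoc)
    finally show "?P k * D k a * D a z + c k a * ?P k * D k z = c z a * (?P k * D k z)" ..
  qed
  finally have "s' ^ length (a # L) +
      (\<Sum>k\<in>set (a # L). prod_list (map (c k) (removeAll k (a # L))) * D k z) =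
      c z a * s' ^ length L + (\<Sum>k\<in>set L. c z a * (?P k * D k z))"
    by (simp add: cza distrib_right s'_power_comm[of _ "D _ _"])
  also have "\<dots> = prod_list (map (c z) (a # L))"
    by (simp add: IHz distrib_left sum_distrib_left)
  finally show ?case ..
qed simp

text \<open>Each \<open>xi k\<close> lowers the distinguished index from \<open>Suc k\<close> to
  \<open>k\<close>, while the other indices remain its complement in 1, ..., m+1. What arrives on
  the left is the term at \<open>k\<close> of the partial fraction expansion for z = m+2.\<close>

lemma xi_upt_push:
  assumes "1 \<le> k" "k \<le> Suc m" "Suc m < n"
  shows "prod_list (map xi [k..<Suc m]) *
      (prod_list (map (c (Suc m)) [1..<Suc m]) * D (Suc m) (Suc (Suc m))) =
    prod_list (map (c k) (removeAll k [1..<Suc (Suc m)])) * D k (Suc (Suc m)) *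
      prod_list (map xi [k..<Suc m])"
  using assms(2,1)
proof (induction k rule: inc_induct)
  case base
  have "[1..<Suc (Suc m)] = [1..<Suc m] @ [Suc m]" by (simp add: upt_Suc_append)
  then show ?case by (simp add: removeAll_id)
next
  case (step k)
  let ?L = "\<lambda>k. removeAll k [1..<Suc (Suc m)]" and ?t = "transpose k (Suc k)"
  have k: "1 \<le> k" "k < n" using step assms by auto
  have upt: "[k..<Suc m] = k # [Suc k..<Suc m]" using step by (simp add: upt_conv_Cons)
  \<comment> \<open>Only the sets agree, since the transposition may reorder the list. This is
    enough because the c-functions commute.\<close>
  have "set (map ?t (?L (Suc k))) = set (?L k)"
    using step.hyps step.prems by (auto simp: transpose_def image_iff)
  then have L: "prod_list (map (c k) (map ?t (?L (Suc k)))) = prod_list (map (c k) (?L k))"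
    by (intro prod_list_map_distinct_eq c_comm) (auto simp: distinct_map distinct_removeAll)
  have D: "?t (Suc (Suc m)) = Suc (Suc m)" using step by (auto simp: transpose_def)
  have "prod_list (map xi [k..<Suc m]) *
      (prod_list (map (c (Suc m)) [1..<Suc m]) * D (Suc m) (Suc (Suc m))) =
    xi k * (prod_list (map (c (Suc k)) (?L (Suc k))) * D (Suc k) (Suc (Suc m)) *
      prod_list (map xi [Suc k..<Suc m]))"
    using step.IH unfolding upt by (simp add: mult.assoc)
  also have "\<dots> = xi k * prod_list (map (c (Suc k)) (?L (Suc k))) * D (Suc k) (Suc (Suc m)) *
      prod_list (map xi [Suc k..<Suc m])" by (simp add: mult.assoc)
  also have "\<dots> = prod_list (map (c k) (?L k)) * (xi k * D (Suc k) (Suc (Suc m))) *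
      prod_list (map xi [Suc k..<Suc m])"
    unfolding xi_c_list[OF k] using L by (simp add: mult.assoc)
  also have "\<dots> = prod_list (map (c k) (?L k)) * D k (Suc (Suc m)) *
      prod_list (map xi [k..<Suc m])"
    unfolding xi_D[OF k] upt using D by (simp add: mult.assoc)
  finally show ?case .
qed

lemma xi_words_fix:
  assumes "\<And>i. i \<in> set v \<Longrightarrow> xi i * x = x"
  shows "prod_list (map xi v) * x = x"
  using assms by (induction v) (simp_all add: mult.assoc)

lemma T_eq:
  assumes "1 \<le> i" "i < n"
  shows "T i = c i (Suc i) * xi i + D i (Suc i)"
  by (simp add: xi_def c_ci_left tau_def)

lemma xi_T_far:
  assumes "1 \<le> i" "Suc i < j" "j < n"
  shows "xi i * T j = T j * xi i"
proof -
  have ij: "1 \<le> i" "i < n" "1 \<le> j" using assms by auto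
  have "xi i * c j (Suc j) = c j (Suc j) * xi i" "xi i * D j (Suc j) = D j (Suc j) * xi i"
    using assms by (simp_all add: xi_c xi_D transpose_def)
  then show ?thesis
    using xi_far[OF assms] by (simp add: T_eq[OF ij(3) assms(3)] distrib_left distrib_right mult.assoc intertwine_left)
qed

text \<open>In the induction step, \<open>T i = c i (Suc i) * xi i + D i (Suc i)\<close>. The first summand accounts for the
  words in the \<open>xi i\<close> ending in the new letter; the words coming from the second one are absorbed by
  the invariant \<open>x\<close> and leave the partial fraction expansion of the new \<open>c\<close>-factors.\<close>

lemma ladder_T_eq_ladder_xi:
  assumes "m < n" "\<And>i. 1 \<le> i \<Longrightarrow> i < m \<Longrightarrow> xi i * x = x"
  shows "s' ^ m * ladder (\<lambda>i. s * T i) m * x =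
    ladder xi m * prod_list (map (c (Suc m)) [1..<Suc m]) * x"
  using assms
proof (induction m arbitrary: x)
  case (Suc m)
  let ?j = "Suc m" and ?z = "Suc (Suc m)"
  let ?G = "prod_list (map (c ?j) [1..<?j])" and ?H = "prod_list (map (c ?z) [1..<?z])"
  have j: "1 \<le> ?j" "?j < n" using Suc.prems by auto
  have x: "xi i * x = x" if "1 \<le> i" "i < ?j" for i using Suc.prems(2) that by blast
  \<comment> \<open>The induction hypothesis is used for T_{m+1} x instead of \<open>x\<close>. This
    element is still fixed by the \<open>xi i\<close> with \<open>i < m\<close>, which commute with
    T_{m+1}.\<close>
  have "s' ^ m * ladder (\<lambda>i. s * T i) m * (T ?j * x) = ladder xi m * ?G * (T ?j * x)"
  proof (rule Suc.IH)
    fix i assume i: "1 \<le> i" "i < m"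
    show "xi i * (T ?j * x) = T ?j * x"
      using i j x by (simp add: intertwine_left[OF xi_T_far])
  qed (use j in simp)
  also have "\<dots> = ladder xi m * (?G * c ?j ?z * xi ?j) * x + ladder xi m * (?G * D ?j ?z) * x"
    unfolding T_eq[OF j] by (simp add: distrib_left distrib_right mult.assoc)
  \<comment> \<open>The transposition of m+1 and m+2 turns \<open>c ?z i\<close> into
    \<open>c ?j i\<close> for i at most m, and \<open>c ?z ?j\<close> into
    \<open>c ?j ?z\<close>.\<close>
  also have "?G * c ?j ?z * xi ?j = xi ?j * ?H"
  proof -
    have "map (transpose ?j ?z) [1..<?j] = [1..<?j]"
      by (rule map_idI) (auto simp: transpose_def)
    then have "map (transpose ?j ?z) [1..<?z] = [1..<?j] @ [?z]"
      by (simp add: upt_Suc_append[of _ ?j])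
    then show ?thesis unfolding xi_c_list[OF j] by (simp add: mult.assoc)
  qed
  also have "ladder xi m * (?G * D ?j ?z) * x =
      (\<Sum>k\<in>{1..?j}. prod_list (map xi [k..<?j]) * (?G * D ?j ?z) * x)"
    by (simp only: ladder_def sum_distrib_right)
  also have "\<dots> = (\<Sum>k\<in>{1..?j}. prod_list (map (c k) (removeAll k [1..<?z])) * D k ?z * x)"
  proof (intro sum.cong refl)
    fix k assume k: "k \<in> {1..?j}"
    have "prod_list (map xi [k..<?j]) * x = x"
      by (rule xi_words_fix) (use k x in auto)
    then show "prod_list (map xi [k..<?j]) * (?G * D ?j ?z) * x =
        prod_list (map (c k) (removeAll k [1..<?z])) * D k ?z * x"
      using xi_upt_push[of k m] k j by (simp add: mult.assoc)
  qed
  finally have "s' ^ ?j * x + s' ^ m * ladder (\<lambda>i. s * T i) m * (T ?j * x) =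
      ladder xi m * (xi ?j * ?H) * x +
      (s' ^ ?j + (\<Sum>k\<in>{1..?j}. prod_list (map (c k) (removeAll k [1..<?z])) * D k ?z)) * x"
    by (simp add: distrib_right sum_distrib_right add_ac)
  \<comment> \<open>The constant term comes from the summand 1 of the ladder in the
    \<open>s * T i\<close>; with it the absorbed words form the complete expansion of
    \<open>?H\<close>.\<close>
  also have "s' ^ ?j + (\<Sum>k\<in>{1..?j}. prod_list (map (c k) (removeAll k [1..<?z])) * D k ?z) = ?H"
    using c_list_partial_fractions[of "[1..<?z]" ?z] j
    by (simp add: atLeastLessThanSuc_atLeastAtMost)
  also have "ladder xi m * (xi ?j * ?H) * x + ?H * x = ladder xi ?j * ?H * x"
    by (simp add: ladder_Suc distrib_left distrib_right mult.assoc add.commute)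
  \<comment> \<open>The factor \<open>s\<close> of the new letter cancels one \<open>s'\<close>,
    which leaves the power \<open>s' ^ m\<close> of the induction hypothesis.\<close>
  also have "s' ^ ?j * x + s' ^ m * ladder (\<lambda>i. s * T i) m * (T ?j * x) =
      s' ^ ?j * ladder (\<lambda>i. s * T i) ?j * x"
  proof -
    have "s' ^ ?j * (ladder (\<lambda>i. s * T i) m * (s * T ?j)) = 
        s' ^ m * s' * s * (ladder (\<lambda>i. s * T i) m * T ?j)"
      using s_central(1)[of "ladder (\<lambda>i. s * T i) m"]
      by (simp add: power_commutes mult.assoc intertwine_left)
    then show ?thesis
      by (simp add: ladder_Suc distrib_left distrib_right mult.assoc s_inverse')
  qed
  finally show ?case .
qed (simp add: ladder_0)

theorem word_sum_T:
  assumes "m \<le> n"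
  shows "word_sum (\<lambda>i. s * T i) m * s' ^ (\<Sum>k<m. k) =
    word_sum xi m * prod_list (map (case_prod c) (inversion_pairs m))"
  using assms
proof (induction m)
  case (Suc m)
  let ?N = "\<Sum>k<m. k" and ?G = "prod_list (map (c (Suc m)) [1..<Suc m])"
  let ?C = "prod_list (map (case_prod c) (inversion_pairs m))"
  define x where "x = word_sum xi m * ?C"
  have x: "word_sum (\<lambda>i. s * T i) m * s' ^ ?N = x" using Suc by (simp add: x_def)
  have "word_sum (\<lambda>i. s * T i) (Suc m) * s' ^ (\<Sum>k<Suc m. k) =
      ladder (\<lambda>i. s * T i) m * (word_sum (\<lambda>i. s * T i) m * s' ^ ?N) * s' ^ m"
    by (simp add: word_sum_Suc power_add mult.assoc)
  also have "\<dots> = s' ^ m * ladder (\<lambda>i. s * T i) m * x"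
    unfolding x s'_power_comm[of m, symmetric] by (simp add: mult.assoc)
  also have "\<dots> = ladder xi m * ?G * x"
  proof (rule ladder_T_eq_ladder_xi)
    fix i assume "1 \<le> i" "i < m"
    then show "xi i * x = x" using xi_word_sum[of i m] Suc.prems by (simp add: x_def flip: mult.assoc)
  qed (use Suc.prems in simp)
  also have "ladder xi m * ?G * x = ladder xi m * (?G * word_sum xi m) * ?C"
    by (simp add: x_def mult.assoc)
  \<comment> \<open>The new c-factors are symmetric in the indices 1, ..., m, so they commute with
    the intertwiners of S_m and can be moved behind the sum.\<close>
  also have "?G * word_sum xi m = word_sum xi m * ?G"
  proof (rule word_sum_intertwine[symmetric])
    fix i assume i: "1 \<le> i" "i < m"
    then have "set (map (transpose i (Suc i)) [1..<Suc m]) = set [1..<Suc m]"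
      by (auto simp: transpose_def image_iff)
    then have "prod_list (map (c (Suc m)) (map (transpose i (Suc i)) [1..<Suc m])) = ?G"
      by (intro prod_list_map_distinct_eq c_comm) (auto simp: distinct_map)
    then show "xi i * ?G = ?G * xi i"
      using xi_c_list[of i "Suc m" "[1..<Suc m]"] i Suc.prems by (simp add: transpose_def)
  qed
  finally show ?case by (simp add: word_sum_Suc mult.assoc comp_def)
qed (simp add: word_sum_0)

end


section \<open>The antisymmetrizer by sign duality\<close>

lemma prod_list_map_uminus:
  fixes f :: "'b \<Rightarrow> 'a::{ring,monoid_mult}"
  shows "prod_list (map (\<lambda>x. - f x) L) = prod_list (map f L) * (- 1) ^ length L"
  by (induction L) (simp_all add: mult.assoc)

context hecke_intertwiners
begin

text \<open>Exchanging \<open>s\<close> and \<open>- s'\<close> leaves the Hecke relations unchanged and exchanges the two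
  symmetrizers.\<close>

lemma sign_dual: "hecke_intertwiners n (- s') (- s) q T D
    (\<lambda>i j. if i \<in> {1..n} \<and> j \<in> {1..n} \<and> i \<noteq> j then - ci j i else x i j)"
  if x: "\<And>i j. \<not> (i \<in> {1..n} \<and> j \<in> {1..n} \<and> i \<noteq> j) \<Longrightarrow>
    (- s' - D i j) * x i j = 1 \<and> x i j * (- s' - D i j) = 1"
proof
  show "- s' * - s = 1" by (simp add: s_inverse')
  show "- s' * y = y * - s'" "- s * y = y * - s" for y by (simp_all add: s_central)
  show "q = - s' - - s" by (simp add: q_def)
  \<comment> \<open>Within the index range the dual c-function is \<open>- c j i\<close>, so
    \<open>- ci j i\<close> inverts it. Outside the range \<open>c_eq\<close> does not apply and the
    inverse has to be supplied as \<open>x\<close>.\<close>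
  have "- s' - D i j = - c j i" if "i \<in> {1..n} \<and> j \<in> {1..n} \<and> i \<noteq> j" for i j
    using c_eq[of j i] that by auto
  then show "(- s' - D i j) *
      (if i \<in> {1..n} \<and> j \<in> {1..n} \<and> i \<noteq> j then - ci j i else x i j) = 1"
    "(if i \<in> {1..n} \<and> j \<in> {1..n} \<and> i \<noteq> j then - ci j i else x i j) * (- s' - D i j) = 1" for i j
    using x[of i j] by (auto simp: c_ci)
qed (rule T_square T_far T_braid D_comm D_sum D_triple T_D; assumption)+

text \<open>The dual factorization has the c-product on the right of the sum over the dual
  intertwiners. These differ from \<open>- xi i\<close> only in their normalization, and the
  c-product conjugates one family into the other; moving it to the left yields the signed sum. The
  last factor collects the signs from c_ij becoming - c_ji.\<close>

theorem word_sum_T_sign: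
  assumes x: "\<And>i j. \<not> (i \<in> {1..n} \<and> j \<in> {1..n} \<and> i \<noteq> j) \<Longrightarrow>
    (- s' - D i j) * x i j = 1 \<and> x i j * (- s' - D i j) = 1"
  shows "word_sum (\<lambda>i. - s' * T i) n * (- s) ^ (\<Sum>k<n. k) =
    prod_list (map (\<lambda>(i, j). c j i) (inversion_pairs n)) * word_sum (\<lambda>i. - xi i) n * (- 1) ^ (\<Sum>k<n. k)"
proof -
  let ?ci = "\<lambda>i j. if i \<in> {1..n} \<and> j \<in> {1..n} \<and> i \<noteq> j then - ci j i else x i j"
  let ?C = "prod_list (map (\<lambda>(i, j). c j i) (inversion_pairs n))"
  interpret dual: hecke_intertwiners n "- s'" "- s" q T D ?ci by (rule sign_dual[OF x])
  have "word_sum (\<lambda>i. - s' * T i) n * (- s) ^ (\<Sum>k<n. k) =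
      word_sum dual.xi n * prod_list (map (case_prod dual.c) (inversion_pairs n))"
    by (rule dual.word_sum_T) simp
  also have "map (case_prod dual.c) (inversion_pairs n) =
      map (\<lambda>p. - (case p of (i, j) \<Rightarrow> c j i)) (inversion_pairs n)"
    using c_eq by (auto simp: set_inversion_pairs dual.c_def)
  also have "prod_list \<dots> = ?C * (- 1) ^ (\<Sum>k<n. k)"
    unfolding prod_list_map_uminus length_inversion_pairs ..
  also have "word_sum dual.xi n * (?C * (- 1) ^ (\<Sum>k<n. k)) =
      word_sum dual.xi n * ?C * (- 1) ^ (\<Sum>k<n. k)" by (simp add: mult.assoc)
  also have "word_sum dual.xi n * ?C = ?C * word_sum (\<lambda>i. - xi i) n"
  proof (rule word_sum_intertwine)
    fix i assume i: "1 \<le> i" "i < n"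
    let ?t = "transpose i (Suc i)"
    \<comment> \<open>s_i reverses only the pair \<open>(Suc i, i)\<close>. The remaining pairs are
      permuted by it, so their product commutes with \<open>tau i\<close>.\<close>
    define R where "R = removeAll (Suc i, i) (inversion_pairs n)"
    let ?R = "prod_list (map (\<lambda>(i, j). c j i) R)"
    have comm: "(case p of (i, j) \<Rightarrow> c j i) * (case p' of (i, j) \<Rightarrow> c j i) =
      (case p' of (i, j) \<Rightarrow> c j i) * (case p of (i, j) \<Rightarrow> c j i)" for p p' :: "nat \<times> nat"
      by (cases p; cases p') (simp add: c_comm)
    have "?C = prod_list (map (\<lambda>(i, j). c j i) ((Suc i, i) # R))"
      using i by (intro prod_list_map_distinct_eq comm)
        (auto simp: R_def distinct_removeAll distinct_inversion_pairs set_inversion_pairs)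
    then have C: "?C = c i (Suc i) * ?R" by simp
    have tau_list: "tau i * prod_list (map (\<lambda>(i, j). c j i) L) =
        prod_list (map (\<lambda>(i, j). c j i) (map (map_prod ?t ?t) L)) * tau i" for L
    proof (induction L)
      case (Cons p L)
      then show ?case
        by (cases p) (simp add: mult.assoc intertwine_left[OF tau_c[OF i]])
    qed simp
    have inj: "?t a = ?t b \<longleftrightarrow> a = b" for a b
      by (rule inj_eq) (simp add: bij_is_inj)
    \<comment> \<open>One inclusion suffices, because the transposition acts injectively on a finite
      set.\<close>
    have "set (map (map_prod ?t ?t) R) = set R"
    proof (rule card_subset_eq)
      show "set (map (map_prod ?t ?t) R) \<subseteq> set R"
        using i by (auto simp: R_def set_inversion_pairs transpose_def split: if_splits)
      show "card (set (map (map_prod ?t ?t) R)) = card (set R)"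
        unfolding set_map by (intro card_image) (auto simp: inj_on_def inj)
    qed simp
    moreover have "distinct R" by (simp add: R_def distinct_removeAll distinct_inversion_pairs)
    moreover from this have "distinct (map (map_prod ?t ?t) R)"
      by (auto simp: distinct_map inj_on_def inj)
    ultimately have "prod_list (map (\<lambda>(i, j). c j i) (map (map_prod ?t ?t) R)) = ?R"
      by (intro prod_list_map_distinct_eq comm)
    with tau_list[of R] have tR: "tau i * ?R = ?R * tau i" by simp
    have comm_ci: "ci j k * ?R = ?R * ci j k" for j k
      by (rule commute_prod_list) (auto simp: c_ci_comm)
    \<comment> \<open>The dual intertwiner carries the inverse of c_{i+1,i} instead of c_{i,i+1}. It
      cancels when the factor c_{i,i+1} of \<open>?C\<close> is moved across
      \<open>tau i\<close>.\<close>
    have "dual.xi i * ?C = - (ci (Suc i) i * (tau i * c i (Suc i)) * ?R)"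
    proof -
      have "dual.xi i = - (ci (Suc i) i * tau i)"
        using i unfolding dual.xi_def dual.tau_def tau_def by simp
      then show ?thesis unfolding C by (simp add: mult.assoc)
    qed
    also have "\<dots> = - (?R * tau i)"
      unfolding tau_c[OF i] by (simp add: mult.assoc c_ci_left tR)
    also have "\<dots> = ?C * - xi i"
      by (simp add: C xi_def mult.assoc intertwine_left[OF comm_ci, symmetric] c_ci_left)
    finally show "dual.xi i * ?C = ?C * - xi i" .
  qed
  finally show ?thesis .
qed

end


section \<open>The relations between the generators and the lattice part\<close>

lemma intertwine_inverse_local_unit:
  fixes x :: "'a::semigroup_mult"
  assumes "x * y = z * x" "y * y' = e" "z' * z = e" "e * x = x" "x * e = x"
  shows "x * y' = z' * x"
proof -
  have "x * y' = z' * (z * x) * y'" using assms(3,4) by (simp flip: mult.assoc)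
  also have "\<dots> = z' * x" by (simp add: assms(1)[symmetric] assms(2,5) mult.assoc)
  finally show ?thesis .
qed

text \<open>The unit \<open>e\<close> of the affine Hecke algebra is not assumed to be a unit of the surrounding ring.\<close>

locale affine_hecke_relations =
  fixes n :: nat and e q :: "'a::ring" and T W W' :: "nat \<Rightarrow> 'a" and E :: "nat \<Rightarrow> nat \<Rightarrow> 'a"
  assumes e_unit: "e * e = e" "e * q = q"
      "\<And>i. 1 \<le> i \<Longrightarrow> i < n \<Longrightarrow> e * T i = T i" "\<And>i. 1 \<le> i \<Longrightarrow> i < n \<Longrightarrow> T i * e = T i"
      "\<And>i. i \<in> {1..n} \<Longrightarrow> e * W i = W i" "\<And>i. i \<in> {1..n} \<Longrightarrow> W i * e = W i"
      "\<And>i. i \<in> {1..n} \<Longrightarrow> e * W' i = W' i" "\<And>i. i \<in> {1..n} \<Longrightarrow> W' i * e = W' i"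
      "\<And>i j. e * E i j = E i j" "\<And>i j. E i j * e = E i j"
    and q_central: "\<And>x. q * x = x * q"
    and W_comm: "\<And>i j. i \<in> {1..n} \<Longrightarrow> j \<in> {1..n} \<Longrightarrow> W i * W j = W j * W i"
    and W_inverse: "\<And>i. i \<in> {1..n} \<Longrightarrow> W i * W' i = e" "\<And>i. i \<in> {1..n} \<Longrightarrow> W' i * W i = e"
    and E_inverse:
      "\<And>i j. i \<in> {1..n} \<Longrightarrow> j \<in> {1..n} \<Longrightarrow> i \<noteq> j \<Longrightarrow> E i j * (e - W i * W' j) = e"
      "\<And>i j. i \<in> {1..n} \<Longrightarrow> j \<in> {1..n} \<Longrightarrow> i \<noteq> j \<Longrightarrow> (e - W i * W' j) * E i j = e"
    and T_square: "\<And>i. 1 \<le> i \<Longrightarrow> i < n \<Longrightarrow> T i * T i = q * T i + e"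
    and T_W: "\<And>i. 1 \<le> i \<Longrightarrow> i < n \<Longrightarrow> W (Suc i) = T i * W i * T i"
    and T_W_far: "\<And>i j. 1 \<le> i \<Longrightarrow> i < n \<Longrightarrow> j \<in> {1..n} \<Longrightarrow> j \<noteq> i \<Longrightarrow> j \<noteq> Suc i \<Longrightarrow>
      T i * W j = W j * T i"
begin

definition D :: "nat \<Rightarrow> nat \<Rightarrow> 'a" where
  "D i j = (if i \<in> {1..n} \<and> j \<in> {1..n} \<and> i \<noteq> j then q * E i j else 0)"

lemma e_left:
  assumes "e * x = x"
  shows "e * (x * y) = x * y"
  using assms by (simp flip: mult.assoc)

lemma W_W'_comm:
  assumes "i \<in> {1..n}" "j \<in> {1..n}"
  shows "W i * W' j = W' j * W i"
  by (rule intertwine_inverse_local_unit[of _ "W j" "W j" _ e])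
    (use assms in \<open>simp_all add: W_comm W_inverse e_unit\<close>)

lemma W'_comm:
  assumes "i \<in> {1..n}" "j \<in> {1..n}"
  shows "W' i * W' j = W' j * W' i"
  by (rule intertwine_inverse_local_unit[of _ "W j" "W j" _ e])
    (use assms W_W'_comm[of j i] in \<open>simp_all add: W_inverse e_unit\<close>)

definition u :: "nat \<Rightarrow> nat \<Rightarrow> 'a" where "u i j = W i * W' j"

lemma u_comm:
  assumes "i \<in> {1..n}" "j \<in> {1..n}" "k \<in> {1..n}" "l \<in> {1..n}"
  shows "u i j * u k l = u k l * u i j"
proof -
  have "W i * (W' j * (W k * W' l)) = W k * (W' l * (W i * W' j))"
  proof -
    have "W i * (W' j * (W k * W' l)) = W i * (W k * (W' j * W' l))"
      using W_W'_comm[of k j] assms by (simp add: intertwine_left)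
    also have "\<dots> = W k * (W i * (W' l * W' j))"
      using W_comm[of i k] W'_comm[of j l] assms by (simp add: intertwine_left)
    also have "\<dots> = W k * (W' l * (W i * W' j))"
      using W_W'_comm[of i l] assms by (simp add: intertwine_left)
    finally show ?thesis .
  qed
  then show ?thesis by (simp add: u_def mult.assoc)
qed

lemma e_u [simp]:
  assumes "i \<in> {1..n}" "j \<in> {1..n}"
  shows "e * u i j = u i j" "u i j * e = u i j"
  using assms by (simp_all add: u_def e_unit e_left mult.assoc)

lemma u_E_comm:
  assumes "i \<in> {1..n}" "j \<in> {1..n}" "k \<in> {1..n}" "l \<in> {1..n}" "k \<noteq> l"
  shows "u i j * E k l = E k l * u i j"
  by (rule intertwine_inverse_local_unit[of _ "e - u k l" "e - u k l" _ e])
    (use assms u_comm[of i j k l] E_inverse[of k l] in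
      \<open>simp_all add: left_diff_distrib right_diff_distrib flip: u_def\<close>)

lemma E_comm:
  assumes "i \<in> {1..n}" "j \<in> {1..n}" "i \<noteq> j" "k \<in> {1..n}" "l \<in> {1..n}" "k \<noteq> l"
  shows "E i j * E k l = E k l * E i j"
  by (rule intertwine_inverse_local_unit[of _ "e - u k l" "e - u k l" _ e])
    (use assms u_E_comm[of k l i j] E_inverse[of k l] in
      \<open>simp_all add: left_diff_distrib right_diff_distrib e_unit flip: u_def\<close>)

lemma u_E:
  assumes "i \<in> {1..n}" "j \<in> {1..n}" "i \<noteq> j"
  shows "u i j * E i j = E i j - e" "E i j * u i j = E i j - e"
  using E_inverse[OF assms]
  by (simp_all add: left_diff_distrib right_diff_distrib e_unit algebra_simps flip: u_def)

lemma u_mult: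
  assumes "i \<in> {1..n}" "j \<in> {1..n}" "k \<in> {1..n}"
  shows "u i j * u j k = u i k"
proof -
  have "u i j * u j k = W i * (W' j * W j) * W' k" by (simp add: u_def mult.assoc)
  then show ?thesis using assms by (simp add: W_inverse e_unit u_def)
qed

lemma u_diag: "i \<in> {1..n} \<Longrightarrow> u i i = e"
  by (simp add: u_def W_inverse)

text \<open>The identity 1/(1 - u) + 1/(1 - 1/u) = 1, obtained from u_ij E_ij = - E_ji.\<close>

lemma E_sum:
  assumes "i \<in> {1..n}" "j \<in> {1..n}" "i \<noteq> j"
  shows "E i j + E j i = e"
proof -
  have uu: "u j i * u i j = e" using u_mult[of j i j] u_diag assms by simp
  have "(e - u j i) * (u i j * E i j) = (u i j - u j i * u i j) * E i j"
    using assms by (simp add: left_diff_distrib flip: mult.assoc)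
  also have "\<dots> = - e" unfolding uu using assms by (simp add: left_diff_distrib u_E e_unit)
  finally have "E j i * ((e - u j i) * (u i j * E i j)) = - E j i" by (simp add: e_unit)
  moreover have "E j i * ((e - u j i) * (u i j * E i j)) = e * (u i j * E i j)"
    using E_inverse[of j i] assms by (simp add: u_def flip: mult.assoc)
  ultimately have "u i j * E i j = - E j i" using assms by (simp add: e_left)
  then show ?thesis using u_E(1)[OF assms] by (simp add: algebra_simps)
qed

text \<open>With E = 1/(1 - u), the difference E_jk - E_ik is E_ik E_jk (u_jk - u_ik), and u_jk -
  u_ik = (1 - u_ij) u_jk. Multiplication by E_ij cancels the factor 1 - u_ij.\<close>

lemma E_triple:
  assumes "i \<in> {1..n}" "j \<in> {1..n}" "k \<in> {1..n}" "i \<noteq> j" "i \<noteq> k" "j \<noteq> k"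
  shows "E i k * E j k = E j i * E i k + E i j * E j k"
proof -
  have "E i j * (E j k - E i k) = E i k * E j k - E i k"
  proof -
    have "E j k - E i k = E i k * E j k * (u j k - u i k)"
    proof -
      have "E i k * E j k * (u j k - u i k) = E i k * (E j k * u j k) - E j k * (E i k * u i k)"
        using intertwine_left[OF E_comm[of i k j k], of "u i k"] assms
        by (simp add: right_diff_distrib mult.assoc)
      then show ?thesis
        using assms E_comm[of i k j k] by (simp add: u_E right_diff_distrib e_unit)
    qed
    also have "u j k - u i k = (e - u i j) * u j k"
      using assms by (simp add: left_diff_distrib u_mult)
    also have "E i j * (E i k * E j k * ((e - u i j) * u j k)) =
      E i j * (e - u i j) * (E i k * (E j k * u j k))"
    proof -
      have "E i k * ((e - u i j) * x) = (e - u i j) * (E i k * x)"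
        "E j k * ((e - u i j) * x) = (e - u i j) * (E j k * x)" for x
        using u_E_comm[of i j i k] u_E_comm[of i j j k] assms
        by (simp_all add: left_diff_distrib right_diff_distrib e_unit e_left intertwine_left
            flip: mult.assoc)
      then show ?thesis by (simp add: mult.assoc)
    qed
    also have "\<dots> = E i k * E j k - E i k"
      using E_inverse(1)[of i j] assms by (simp add: u_E right_diff_distrib e_unit e_left flip: u_def)
    finally show ?thesis .
  qed
  then have "E i k * E j k = E i k - E i j * E i k + E i j * E j k"
    by (simp add: right_diff_distrib algebra_simps)
  moreover have ji: "E j i = e - E i j" using E_sum[of i j] assms by (simp add: algebra_simps)
  ultimately show ?thesis unfolding ji by (simp add: left_diff_distrib e_unit)
qed

lemma q_left: "x * (q * y) = q * (x * y)"
proof -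
  have "x * (q * y) = (x * q) * y" by (simp only: mult.assoc)
  then show ?thesis unfolding q_central[of x, symmetric] by (simp only: mult.assoc)
qed

lemma q_e: "q * e = q"
  using q_central[of e] by (simp add: e_unit)

lemma D_comm: "D i j * D k l = D k l * D i j"
proof (cases "i \<in> {1..n} \<and> j \<in> {1..n} \<and> i \<noteq> j \<and> k \<in> {1..n} \<and> l \<in> {1..n} \<and> k \<noteq> l")
  case True
  then show ?thesis using E_comm[of i j k l] by (simp add: D_def mult.assoc q_left[of "E _ _"])
qed (auto simp: D_def)

lemma D_sum:
  assumes "i \<in> {1..n}" "j \<in> {1..n}" "i \<noteq> j"
  shows "D i j + D j i = q"
proof -
  have "q * (E i j + E j i) = q" using assms by (simp add: E_sum q_e)
  then show ?thesis using assms by (simp add: D_def distrib_left)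
qed

lemma D_triple:
  assumes "i \<in> {1..n}" "j \<in> {1..n}" "k \<in> {1..n}" "i \<noteq> j" "i \<noteq> k" "j \<noteq> k"
  shows "D i k * D j k = D j i * D i k + D i j * D j k"
proof -
  have "q * (q * (E i k * E j k)) = q * (q * (E j i * E i k + E i j * E j k))"
    by (simp only: E_triple[OF assms])
  then show ?thesis using assms by (simp add: D_def mult.assoc q_left[of "E _ _"] distrib_left)
qed

text \<open>The difference quotient q (W_j - W_i) / (1 - W_i / W_j), which is the correction term of
  the Bernstein-Lusztig relation.\<close>

lemma D_W:
  assumes "i \<in> {1..n}" "j \<in> {1..n}" "i \<noteq> j"
  shows "D i j * W j - D i j * W i = q * W j"
proof -
  have "E i j * (e - u i j) * W j = W j"
    using E_inverse(1)[OF assms] assms by (simp add: u_def e_unit)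
  moreover have "u i j * W j = W i" using assms by (simp add: u_def mult.assoc W_inverse e_unit)
  ultimately have "E i j * (W j - W i) = W j"
    using assms by (simp add: left_diff_distrib mult.assoc e_unit)
  then have "q * (E i j * (W j - W i)) = q * W j" by simp
  then show ?thesis using assms by (simp add: D_def right_diff_distrib mult.assoc)
qed

lemma D_W_comm:
  assumes "k \<in> {1..n}"
  shows "D i j * W k = W k * D i j"
proof (cases "i \<in> {1..n} \<and> j \<in> {1..n} \<and> i \<noteq> j")
  case True
  have "W k * (e - u i j) = (e - u i j) * W k"
    using True assms W_W'_comm[of k j, symmetric] W_comm[of k i]
    by (simp add: left_diff_distrib right_diff_distrib e_unit u_def mult.assoc
          intertwine_left[of "W k" "W i" "W i"])
  then have "W k * E i j = E i j * W k"
    by (rule intertwine_inverse_local_unit[of _ _ _ _ e]) (use True assms E_inverse in \<open>auto simp: u_def e_unit\<close>)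
  then show ?thesis using True by (simp add: D_def mult.assoc q_left[of "W k"])
qed (auto simp: D_def)

text \<open>The crossing and quadratic relations give T_i W_{i+1} = q W_{i+1} + W_i T_i and its
  mirror image. By \<open>D_W\<close>, subtracting D_{i,i+1} from T_i removes exactly the term q
  W_{i+1}.\<close>

lemma tau_W:
  assumes i: "1 \<le> i" "i < n" and j: "j \<in> {1..n}"
  shows "(T i - D i (Suc i)) * W j = W (transpose i (Suc i) j) * (T i - D i (Suc i))"
proof -
  let ?j = "Suc i"
  have ij: "i \<in> {1..n}" "?j \<in> {1..n}" "i \<noteq> ?j" using i by auto
  have TW1: "T i * W ?j = q * W ?j + W i * T i"
  proof -
    have "T i * W ?j = T i * T i * (W i * T i)" by (simp add: T_W[OF i] mult.assoc)
    also have "\<dots> = q * (T i * W i * T i) + e * W i * T i"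
      unfolding T_square[OF i] by (simp add: distrib_right mult.assoc)
    finally show ?thesis using ij by (simp add: T_W[OF i, symmetric] e_unit)
  qed
  have "W ?j * T i = T i * W i * (T i * T i)" by (simp add: T_W[OF i] mult.assoc)
  also have "\<dots> = q * (T i * W i * T i) + T i * (W i * e)"
    unfolding T_square[OF i] by (simp add: distrib_left mult.assoc q_left[of "T i"] q_left[of "W i"])
  finally have TW2: "W ?j * T i = q * W ?j + T i * W i" using ij by (simp add: T_W[OF i, symmetric] e_unit)
  consider "j = i" | "j = ?j" | "j \<noteq> i" "j \<noteq> ?j" by blast
  then show ?thesis
  proof cases
    case 1
    then show ?thesis
      using TW2 D_W[OF ij] D_W_comm[OF ij(2), of i ?j] D_W_comm[OF ij(1), of i ?j]
      by (simp add: left_diff_distrib right_diff_distrib) (simp add: algebra_simps)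
  next
    case 2
    then show ?thesis
      using TW1 D_W[OF ij] D_W_comm[OF ij(2), of i ?j] D_W_comm[OF ij(1), of i ?j]
      by (simp add: left_diff_distrib right_diff_distrib) (simp add: algebra_simps)
  next
    case 3
    then show ?thesis
      using T_W_far[OF i j] D_W_comm[OF j, of i ?j]
      by (simp add: left_diff_distrib right_diff_distrib transpose_def)
  qed
qed

text \<open>The intertwining property passes from the \<open>W\<close> to their inverses, to the
  ratios, and to the inverses of e minus a ratio. Outside the index range, which s_i preserves, both
  sides vanish.\<close>

lemma tau_D:
  assumes i: "1 \<le> i" "i < n"
  shows "(T i - D i (Suc i)) * D j k =
    D (transpose i (Suc i) j) (transpose i (Suc i) k) * (T i - D i (Suc i))"
proof (cases "j \<in> {1..n} \<and> k \<in> {1..n} \<and> j \<noteq> k")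
  case True
  let ?t = "transpose i (Suc i)" and ?x = "T i - D i (Suc i)"
  have t: "?t l \<in> {1..n}" if "l \<in> {1..n}" for l using i that by (auto simp: transpose_def)
  have tt: "?t j \<noteq> ?t k" using True by (simp add: inj_eq bij_is_inj)
  have ex: "e * ?x = ?x" "?x * e = ?x"
    using i by (simp_all add: left_diff_distrib right_diff_distrib e_unit D_def e_left mult.assoc)
  have W': "?x * W' k = W' (?t k) * ?x"
    by (rule intertwine_inverse_local_unit[OF tau_W[OF i, of k] _ _ ex]) (use True t in \<open>auto simp: W_inverse\<close>)
  have "?x * u j k = u (?t j) (?t k) * ?x"
    using tau_W[OF i, of j] W' True unfolding u_def by (simp add: mult.assoc intertwine_left)
  then have "?x * (e - u j k) = (e - u (?t j) (?t k)) * ?x"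
    using ex by (simp only: left_diff_distrib[of e] right_diff_distrib[of ?x])
  then have "?x * E j k = E (?t j) (?t k) * ?x"
    by (rule intertwine_inverse_local_unit[OF _ _ _ ex])
      (use True t tt E_inverse in \<open>auto simp: u_def\<close>)
  moreover have "D j k = q * E j k" "D (?t j) (?t k) = q * E (?t j) (?t k)"
    using True t tt by (simp_all add: D_def)
  ultimately show ?thesis by (simp only: mult.assoc q_left[of ?x])
next
  case False
  have "transpose i (Suc i) l \<in> {1..n} \<longleftrightarrow> l \<in> {1..n}" for l using i by (auto simp: transpose_def)
  then show ?thesis using False by (auto simp: D_def inj_eq bij_is_inj)
qed

end


section \<open>Rings given by a carrier set\<close>

text \<open>Elements of this type are families indexed by all rings with elements in \<open>'a\<close>. Computations
  in an arbitrary ring record thereby take place in a type of class \<^class>\<open>ring\<close>: an element of the record is extended by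
  \<open>0\<close> or by \<open>1\<close> in all other components.\<close>

typedef 'a ring_family = "PiE {R :: 'a ring. Ring.ring R} carrier"
  by (intro exI[of _ "\<lambda>R\<in>{R. Ring.ring R}. \<zero>\<^bsub>R\<^esub>"]) (auto intro: ring.ring_simprules(2))

definition family_of :: "('a ring \<Rightarrow> 'a) \<Rightarrow> 'a ring_family" where
  "family_of f = Abs_ring_family (restrict f {R. Ring.ring R})"

definition component :: "'a ring \<Rightarrow> 'a ring_family \<Rightarrow> 'a" where
  "component R x = Rep_ring_family x R"

lemma component_closed: "Ring.ring R \<Longrightarrow> component R x \<in> carrier R"
  using Rep_ring_family[of x] by (auto simp: component_def)

lemma ring_family_eqI:
  assumes "\<And>R. Ring.ring R \<Longrightarrow> component R x = component R y"
  shows "x = y"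
proof -
  have "Rep_ring_family x = Rep_ring_family y"
    using assms Rep_ring_family[of x] Rep_ring_family[of y] unfolding component_def
    by (intro PiE_ext) auto
  then show ?thesis by (simp add: Rep_ring_family_inject)
qed

lemma component_family_of:
  assumes "\<And>R. Ring.ring R \<Longrightarrow> f R \<in> carrier R" "Ring.ring R"
  shows "component R (family_of f) = f R"
  using assms unfolding component_def family_of_def
  by (subst Abs_ring_family_inverse) (auto simp: restrict_def PiE_def extensional_def)

instantiation ring_family :: (type) "{Rings.ring, monoid_mult}"
begin

definition "0 = family_of (\<lambda>R. \<zero>\<^bsub>R\<^esub>)"
definition "1 = family_of (\<lambda>R. \<one>\<^bsub>R\<^esub>)"
definition "x + y = family_of (\<lambda>R. component R x \<oplus>\<^bsub>R\<^esub> component R y)"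
definition "x * y = family_of (\<lambda>R. component R x \<otimes>\<^bsub>R\<^esub> component R y)"
definition "- x = family_of (\<lambda>R. \<ominus>\<^bsub>R\<^esub> component R x)"
definition "x - y = family_of (\<lambda>R. component R x \<ominus>\<^bsub>R\<^esub> component R y)"

lemma component_simps:
  assumes "Ring.ring R"
  shows "component R 0 = \<zero>\<^bsub>R\<^esub>" "component R 1 = \<one>\<^bsub>R\<^esub>"
    "component R (x + y) = component R x \<oplus>\<^bsub>R\<^esub> component R y"
    "component R (x * y) = component R x \<otimes>\<^bsub>R\<^esub> component R y"
    "component R (- x) = \<ominus>\<^bsub>R\<^esub> component R x"
    "component R (x - y) = component R x \<ominus>\<^bsub>R\<^esub> component R y"
  using assms
  by (auto simp: zero_ring_family_def one_ring_family_def plus_ring_family_def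
      times_ring_family_def uminus_ring_family_def minus_ring_family_def component_closed
      ring.ring_simprules(1-6) abelian_group.minus_closed ring.is_abelian_group
      intro!: component_family_of)

instance
proof
  fix a b c :: "'a ring_family"
  note simps = component_simps component_closed ring.ring_simprules
  show "a + b + c = a + (b + c)" by (rule ring_family_eqI) (simp add: simps)
  show "a + b = b + a"
    by (rule ring_family_eqI) (simp add: component_simps component_closed ring.ring_simprules(10))
  show "0 + a = a" by (rule ring_family_eqI) (simp add: simps)
  show "- a + a = 0" by (rule ring_family_eqI) (simp add: simps)
  show "a - b = a + - b" by (rule ring_family_eqI) (simp add: simps)
  show "a * b * c = a * (b * c)" by (rule ring_family_eqI) (simp add: simps)
  show "(a + b) * c = a * c + b * c" by (rule ring_family_eqI) (simp add: simps)
  show "a * (b + c) = a * b + a * c" by (rule ring_family_eqI) (simp add: simps)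
  show "1 * a = a" by (rule ring_family_eqI) (simp add: simps)
  show "a * 1 = a"
    by (rule ring_family_eqI) (simp add: simps monoid.r_one ring.is_monoid)
qed

end

lemma component_sum:
  assumes "Ring.ring R"
  shows "component R (sum f A) = finsum R (\<lambda>x. component R (f x)) A"
proof -
  interpret ring R by (rule assms)
  show ?thesis
    by (induction A rule: infinite_finite_induct)
      (auto simp: component_simps assms component_closed finsum_infinite)
qed

lemma component_prod_list:
  assumes "Ring.ring R"
  shows "component R (prod_list xs) = foldr (\<otimes>\<^bsub>R\<^esub>) (map (component R) xs) \<one>\<^bsub>R\<^esub>"
  by (induction xs) (simp_all add: component_simps assms)

definition extend :: "'a ring \<Rightarrow> 'a ring_family \<Rightarrow> 'a \<Rightarrow> 'a ring_family" where
  "extend R y a = family_of (\<lambda>S. if S = R then a else component S y)"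

lemma component_extend:
  assumes "Ring.ring S" "a \<in> carrier R"
  shows "component S (extend R y a) = (if S = R then a else component S y)"
  unfolding extend_def using assms by (subst component_family_of) (auto simp: component_closed)

lemma extend_simps:
  assumes "a \<in> carrier R" "b \<in> carrier R" "Ring.ring R"
  shows "extend R x a + extend R y b = extend R (x + y) (a \<oplus>\<^bsub>R\<^esub> b)"
    "extend R x a - extend R y b = extend R (x - y) (a \<ominus>\<^bsub>R\<^esub> b)"
    "extend R x a * extend R y b = extend R (x * y) (a \<otimes>\<^bsub>R\<^esub> b)"
  using assms by (auto intro!: ring_family_eqI simp: component_extend component_simps ring.ring_simprules)

lemma component_extend_same: "Ring.ring R \<Longrightarrow> a \<in> carrier R \<Longrightarrow> component R (extend R y a) = a"
  by (simp add: component_extend)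


section \<open>Transfer of the factorizations to an arbitrary ring record\<close>

lemma index_pairs_props:
  "set (index_pairs n) = {(i, j). 1 \<le> i \<and> i < j \<and> j \<le> n}" "distinct (index_pairs n)"
proof -
  show "set (index_pairs n) = {(i, j). 1 \<le> i \<and> i < j \<and> j \<le> n}"
    by (auto simp: index_pairs_def image_iff)
  show "distinct (index_pairs n)"
    unfolding index_pairs_def
  proof (rule distinct_concat)
    have "inj_on (\<lambda>i. length (map (Pair i) [Suc i..<Suc n])) {1..<Suc n}"
      by (auto simp: inj_on_def)
    then have "inj_on (length \<circ> (\<lambda>i. map (Pair i) [Suc i..<Suc n])) {1..<Suc n}"
      by (simp only: comp_def)
    then show "distinct (map (\<lambda>i. map (Pair i) [Suc i..<Suc n]) [1..<Suc n])"
      unfolding distinct_map by (simp only: distinct_upt set_upt inj_on_imageI2 simp_thms)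
  qed (auto simp: distinct_map inj_on_def)
qed

lemma permutes_reduced_word:
  assumes "w permutes {1..n}"
  shows "reduced_word n w (SOME js. reduced_word n w js)"
proof -
  have "w \<in> word_perm ` normal_words n"
    using assms bij_betw_imp_surj_on[OF word_perm_bij_betw[of n]] by simp
  then obtain v where "v \<in> normal_words n" "w = word_perm v" by (elim imageE)
  then show ?thesis using someI[of "reduced_word n w" v] by (simp only: reduced_word_normal_word)
qed

lemma word_sum_scale:
  assumes "\<And>x. z * x = x * z"
  shows "word_sum (\<lambda>i. z * f i) n = (\<Sum>v\<in>normal_words n. z ^ length v * prod_list (map f v))"
proof -
  have "prod_list (map (\<lambda>i. z * f i) v) = z ^ length v * prod_list (map f v)" for v
  proof (induction v)
    case (Cons i v)
    have "f i * z ^ length v = z ^ length v * f i"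
      by (rule power_commuting_commutes[symmetric]) (rule assms)
    then show ?case by (simp add: Cons mult.assoc intertwine_left)
  qed simp
  then show ?thesis by (simp add: word_sum_def)
qed

lemma extend_component: "extend R y (component R y) = y" if "Ring.ring R"
  by (rule ring_family_eqI) (simp add: component_extend component_closed that)

lemma extend_one: "Ring.ring R \<Longrightarrow> extend R 1 \<one>\<^bsub>R\<^esub> = 1"
  using extend_component[of R 1] by (simp add: component_simps)

text \<open>Common ground of the two algebras, with \<open>W i\<close> standing for X_i or for the
  inverse of Y_i. Of the localization only the inverses of the numerators and denominators of the
  c-functions enter.\<close>

locale affine_hecke_in_ring = Ring.ring R for R :: "'a ring" (structure) +
  fixes n :: nat and K :: "complex \<Rightarrow> 'a" and s :: complex and T W W' :: "nat \<Rightarrow> 'a"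
  assumes s: "s \<noteq> 0"
    and K_closed [simp]: "\<And>x. K x \<in> carrier R"
    and K_hom: "K 1 = \<one>" "\<And>x y. K (x * y) = K x \<otimes> K y" "\<And>x. K (- x) = \<ominus> K x"
    and K_central: "\<And>x y. y \<in> carrier R \<Longrightarrow> K x \<otimes> y = y \<otimes> K x"
    and T_closed: "\<And>i. 1 \<le> i \<Longrightarrow> i < n \<Longrightarrow> T i \<in> carrier R"
    and W_closed: "\<And>i. i \<in> {1..n} \<Longrightarrow> W i \<in> carrier R" "\<And>i. i \<in> {1..n} \<Longrightarrow> W' i \<in> carrier R"
    and T_square: "\<And>i. 1 \<le> i \<Longrightarrow> i < n \<Longrightarrow> T i \<otimes> T i = (K s \<ominus> K (inverse s)) \<otimes> T i \<oplus> \<one>"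
    and T_far: "\<And>i j. 1 \<le> i \<Longrightarrow> Suc i < j \<Longrightarrow> j < n \<Longrightarrow> T i \<otimes> T j = T j \<otimes> T i"
    and T_braid: "\<And>i. 1 \<le> i \<Longrightarrow> Suc i < n \<Longrightarrow> T i \<otimes> T (Suc i) \<otimes> T i = T (Suc i) \<otimes> T i \<otimes> T (Suc i)"
    and W_comm: "\<And>i j. i \<in> {1..n} \<Longrightarrow> j \<in> {1..n} \<Longrightarrow> W i \<otimes> W j = W j \<otimes> W i"
    and W_inverse: "\<And>i. i \<in> {1..n} \<Longrightarrow> W i \<otimes> W' i = \<one>" "\<And>i. i \<in> {1..n} \<Longrightarrow> W' i \<otimes> W i = \<one>"
    and T_W: "\<And>i. 1 \<le> i \<Longrightarrow> i < n \<Longrightarrow> W (Suc i) = T i \<otimes> W i \<otimes> T i"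
    and T_W_far: "\<And>i j. 1 \<le> i \<Longrightarrow> i < n \<Longrightarrow> j \<in> {1..n} \<Longrightarrow> j \<noteq> i \<Longrightarrow> j \<noteq> Suc i \<Longrightarrow>
      T i \<otimes> W j = W j \<otimes> T i"
    and denominator_unit: "\<And>i j. i \<in> {1..n} \<Longrightarrow> j \<in> {1..n} \<Longrightarrow> i \<noteq> j \<Longrightarrow>
      \<one> \<ominus> W i \<otimes> W' j \<in> Units R"
    and numerator_unit: "\<And>i j. i \<in> {1..n} \<Longrightarrow> j \<in> {1..n} \<Longrightarrow> i \<noteq> j \<Longrightarrow>
      K (inverse s) \<ominus> K s \<otimes> (W i \<otimes> W' j) \<in> Units R"
begin

lemma R: "Ring.ring R" by (rule ring_axioms)

definition valid :: "nat \<Rightarrow> nat \<Rightarrow> bool" where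
  "valid i j \<longleftrightarrow> i \<in> {1..n} \<and> j \<in> {1..n} \<and> i \<noteq> j"

definition E :: "nat \<Rightarrow> nat \<Rightarrow> 'a" where "E i j = inv (\<one> \<ominus> W i \<otimes> W' j)"
definition C :: "nat \<Rightarrow> nat \<Rightarrow> 'a" where
  "C i j = (K (inverse s) \<ominus> K s \<otimes> (W i \<otimes> W' j)) \<otimes> inv (\<one> \<ominus> W i \<otimes> W' j)"
text \<open>This is the normalized intertwiner, not a lattice generator.\<close>

definition X :: "nat \<Rightarrow> 'a" where
  "X i = inv (C i (Suc i)) \<otimes> ((T i \<oplus> K (inverse s)) \<ominus> C (Suc i) i)"

text \<open>Two extensions are needed. The lattice part is extended by 0, since 1 - W_i / W_j cannot
  be made invertible in every other ring by extending W by 1; its unit is then only the idempotent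
  \<open>unitF\<close>. The elements \<open>s\<close>, \<open>s'\<close>, \<open>T\<close> are
  extended by 1, so that in the other components \<open>q\<close> and \<open>D\<close> are 0, all
  \<open>T\<close> are 1, and the relations of \<open>hecke_intertwiners\<close> become trivial
  there.\<close>

definition "unitF = extend R 0 \<one>"
definition "qF = extend R 0 (K s \<ominus> K (inverse s))"
definition "sF = extend R 1 (K s)"
definition "s'F = extend R 1 (K (inverse s))"
definition "TF i = extend R 1 (T i)"
text \<open>Outside the index range \<open>D\<close> is 0, so the c-function is \<open>sF\<close>
  and its inverse \<open>s'F\<close>.\<close>

definition "ciF i j = (if valid i j then extend R 1 (inv (C i j)) else s'F)"

lemma K_mult_inverse: "K s \<otimes> K (inverse s) = \<one>"
  using K_hom(2)[of s "inverse s"] s by (simp add: K_hom)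

lemma E_closed: "valid i j \<Longrightarrow> E i j \<in> carrier R"
  using denominator_unit by (auto simp: E_def valid_def)

lemma C_Units: "valid i j \<Longrightarrow> C i j \<in> Units R"
  using denominator_unit numerator_unit by (auto simp: C_def valid_def)

lemma C_closed: "valid i j \<Longrightarrow> C i j \<in> carrier R"
  by (rule Units_closed[OF C_Units])

sublocale F: affine_hecke_relations n unitF qF "\<lambda>i. extend R 0 (T i)" "\<lambda>i. extend R 0 (W i)"
  "\<lambda>i. extend R 0 (W' i)" "\<lambda>i j. if valid i j then extend R 0 (E i j) else 0"
proof
  note closed = T_closed W_closed E_closed R
  fix i j
  show "unitF * unitF = unitF" "unitF * qF = qF"
    by (simp_all add: unitF_def qF_def extend_simps R)
  show "1 \<le> i \<Longrightarrow> i < n \<Longrightarrow> unitF * extend R 0 (T i) = extend R 0 (T i)"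
    "1 \<le> i \<Longrightarrow> i < n \<Longrightarrow> extend R 0 (T i) * unitF = extend R 0 (T i)"
    "i \<in> {1..n} \<Longrightarrow> unitF * extend R 0 (W i) = extend R 0 (W i)"
    "i \<in> {1..n} \<Longrightarrow> extend R 0 (W i) * unitF = extend R 0 (W i)"
    "i \<in> {1..n} \<Longrightarrow> unitF * extend R 0 (W' i) = extend R 0 (W' i)"
    "i \<in> {1..n} \<Longrightarrow> extend R 0 (W' i) * unitF = extend R 0 (W' i)"
    "unitF * (if valid i j then extend R 0 (E i j) else 0) = (if valid i j then extend R 0 (E i j) else 0)"
    "(if valid i j then extend R 0 (E i j) else 0) * unitF = (if valid i j then extend R 0 (E i j) else 0)"
    by (simp_all add: unitF_def extend_simps closed)
  show "qF * x = x * qF" for x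
    by (rule ring_family_eqI)
      (auto simp: qF_def component_simps component_extend component_closed minus_eq K_central
        l_distr r_distr l_minus r_minus ring.ring_simprules(24,25))
  show "1 \<le> i \<Longrightarrow> i < n \<Longrightarrow> extend R 0 (T i) * extend R 0 (T i) = qF * extend R 0 (T i) + unitF"
    by (simp add: qF_def unitF_def extend_simps closed T_square)
  show "1 \<le> i \<Longrightarrow> i < n \<Longrightarrow>
      extend R 0 (W (Suc i)) = extend R 0 (T i) * extend R 0 (W i) * extend R 0 (T i)"
    by (simp add: extend_simps closed T_W)
  show "1 \<le> i \<Longrightarrow> i < n \<Longrightarrow> j \<in> {1..n} \<Longrightarrow> j \<noteq> i \<Longrightarrow> j \<noteq> Suc i \<Longrightarrow>
      extend R 0 (T i) * extend R 0 (W j) = extend R 0 (W j) * extend R 0 (T i)"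
    using T_W_far[of i j] by (simp add: extend_simps closed)
  show "i \<in> {1..n} \<Longrightarrow> j \<in> {1..n} \<Longrightarrow>
      extend R 0 (W i) * extend R 0 (W j) = extend R 0 (W j) * extend R 0 (W i)"
    using W_comm[of i j] by (simp add: extend_simps closed)
  show "i \<in> {1..n} \<Longrightarrow> extend R 0 (W i) * extend R 0 (W' i) = unitF"
    "i \<in> {1..n} \<Longrightarrow> extend R 0 (W' i) * extend R 0 (W i) = unitF"
    using W_inverse[of i] by (simp_all add: extend_simps closed unitF_def)
  assume ij: "i \<in> {1..n}" "j \<in> {1..n}" "i \<noteq> j"
  have v: "valid i j" using ij by (simp add: valid_def)
  show "(if valid i j then extend R 0 (E i j) else 0) *
      (unitF - extend R 0 (W i) * extend R 0 (W' j)) = unitF"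
    "(unitF - extend R 0 (W i) * extend R 0 (W' j)) *
      (if valid i j then extend R 0 (E i j) else 0) = unitF"
    using denominator_unit[OF ij] closed(2,3)[OF ij(1)] closed(2,3)[OF ij(2)] v
      E_closed[OF v] Units_closed[OF denominator_unit[OF ij]]
    by (simp_all add: extend_simps R unitF_def E_def)
qed

lemma D_zero: "\<not> valid i j \<Longrightarrow> F.D i j = 0"
  by (subst F.D_def, rule if_not_P) (simp only: valid_def not_False_eq_True)

text \<open>The complementary idempotent \<open>1 - unitF\<close> is 1 in all components other than
  \<open>R\<close> and 0 in \<open>R\<close>.\<close>

lemma extend_one_eq:
  assumes "x \<in> carrier R"
  shows "extend R 0 x + (1 - unitF) = extend R 1 x"
proof (rule ring_family_eqI)
  fix S :: "'a ring" assume S: "Ring.ring S"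
  show "component S (extend R 0 x + (1 - unitF)) = component S (extend R 1 x)"
  proof (cases "S = R")
    case True
    then show ?thesis
      using assms by (simp add: unitF_def component_simps component_extend R minus_eq r_neg)
  next
    case False
    then show ?thesis
      using S assms
      by (simp add: unitF_def component_simps component_extend ring.ring_simprules(1-6,8,14,15,21))
  qed
qed

text \<open>With u E = E - 1 the fraction (s^-1 - s u) E becomes s^-1 E - s (E - 1) = s - (s - s^-1)
  E.\<close>

lemma extend_C: "valid i j \<Longrightarrow> extend R 1 (C i j) = sF - F.D i j"
proof -
  assume v: "valid i j"
  then have ij: "i \<in> {1..n}" "j \<in> {1..n}" "i \<noteq> j" by (auto simp: valid_def)
  note closed = W_closed(1)[OF ij(1)] W_closed(2)[OF ij(2)] E_closed[OF v] R
  let ?E = "extend R 0 (E i j)" and ?s = "extend R 0 (K s)" and ?s' = "extend R 0 (K (inverse s))"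
  have uE: "F.u i j * ?E = ?E - unitF" using F.u_E(1)[OF ij] v by simp
  have "extend R 0 (C i j) = (?s' - ?s * F.u i j) * ?E"
    unfolding C_def F.u_def E_def[symmetric] using closed by (simp add: extend_simps)
  also have "\<dots> = ?s' * ?E - ?s * (?E - unitF)"
    by (simp add: left_diff_distrib mult.assoc uE)
  also have "\<dots> = ?s - (?s - ?s') * ?E"
  proof -
    have "?s * unitF = ?s" by (simp add: unitF_def extend_simps R)
    then show ?thesis by (simp add: right_diff_distrib left_diff_distrib)
  qed
  also have "?s - ?s' = qF" by (simp add: qF_def extend_simps R)
  also have "qF * ?E = F.D i j" using v ij by (simp add: F.D_def)
  finally have "extend R 0 (C i j) = ?s - F.D i j" .
  then have "extend R 0 (C i j) + (1 - unitF) = ?s + (1 - unitF) - F.D i j" by simp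
  then show ?thesis using C_closed[OF v] by (simp only: extend_one_eq K_closed sF_def)
qed

lemma TF_eq: "1 \<le> i \<Longrightarrow> i < n \<Longrightarrow> TF i = extend R 0 (T i) + (1 - unitF)"
  by (simp only: TF_def extend_one_eq T_closed)

lemma unitF_D: "unitF * F.D i j = F.D i j" "F.D i j * unitF = F.D i j"
  using F.e_unit by (simp_all add: F.D_def F.q_left mult.assoc)

sublocale hecke_intertwiners n sF s'F qF TF F.D ciF
proof
  note closed = T_closed R
  show sF_s'F: "sF * s'F = 1"
    by (simp add: sF_def s'F_def extend_simps R K_mult_inverse extend_one)
  show "sF * x = x * sF" "s'F * x = x * s'F" for x
    by (rule ring_family_eqI; auto simp: sF_def s'F_def component_simps component_extend
        component_closed K_central ring.ring_simprules monoid.r_one ring.is_monoid)+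
  show "qF = sF - s'F" by (simp add: qF_def sF_def s'F_def extend_simps R)
  show "TF i * TF i = qF * TF i + 1" if "1 \<le> i" "i < n" for i
  proof -
    have "qF * TF i + extend R 1 \<one> = extend R 1 (T i \<otimes> T i)"
      using that by (simp add: TF_def qF_def extend_simps closed T_square)
    then show ?thesis using that by (simp add: TF_def extend_simps closed extend_one)
  qed
  show "TF i * TF j = TF j * TF i" if "1 \<le> i" "Suc i < j" "j < n" for i j
    using that T_far[OF that] by (simp add: TF_def extend_simps closed)
  show "TF i * TF (Suc i) * TF i = TF (Suc i) * TF i * TF (Suc i)" if "1 \<le> i" "Suc i < n" for i
    using that T_braid[OF that] by (simp add: TF_def extend_simps closed)
  show "(TF i - F.D i (Suc i)) * F.D j k =
      F.D (transpose i (Suc i) j) (transpose i (Suc i) k) * (TF i - F.D i (Suc i))"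
    if i: "1 \<le> i" "i < n" for i j k
    using F.tau_D[OF i, of j k]
    by (simp add: TF_eq[OF i] left_diff_distrib right_diff_distrib distrib_left distrib_right unitF_D)
  show "(sF - F.D i j) * ciF i j = 1" "ciF i j * (sF - F.D i j) = 1" for i j
  proof -
    have "valid i j \<Longrightarrow> (sF - F.D i j) * ciF i j = 1 \<and> ciF i j * (sF - F.D i j) = 1"
      using C_Units C_closed
      by (simp add: ciF_def extend_C[symmetric] extend_simps R extend_one)
    moreover have "s'F * sF = 1"
    proof -
      have "s'F * sF = sF * s'F"
        by (simp add: sF_def s'F_def extend_simps R K_central[of "K s" "inverse s"])
      then show ?thesis using sF_s'F by simp
    qed
    moreover have "\<not> valid i j \<Longrightarrow> F.D i j = 0" by (rule D_zero)
    ultimately show "(sF - F.D i j) * ciF i j = 1" "ciF i j * (sF - F.D i j) = 1"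
      using sF_s'F by (cases "valid i j"; simp add: ciF_def)+
  qed
qed (rule F.D_comm F.D_sum F.D_triple; assumption)+

lemma component_T: "1 \<le> i \<Longrightarrow> i < n \<Longrightarrow> component R (TF i) = T i"
  by (simp add: TF_def component_extend R T_closed)

lemma component_c: "valid i j \<Longrightarrow> component R (c i j) = C i j"
  using extend_C[of i j] C_closed[of i j] component_extend_same[OF R, of "C i j" 1] by (simp add: c_def)

lemma component_xi:
  assumes i: "1 \<le> i" "i < n"
  shows "component R (xi i) = X i"
proof -
  have v: "valid i (Suc i)" "valid (Suc i) i" using i by (auto simp: valid_def)
  have "c (Suc i) i = s'F + F.D i (Suc i)" using v by (intro c_eq) (auto simp: valid_def)
  then have "tau i = TF i + s'F - c (Suc i) i" by (simp add: tau_def)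
  then have "component R (tau i) = (T i \<oplus> K (inverse s)) \<ominus> C (Suc i) i"
    using v i by (simp add: component_simps R component_T component_c s'F_def component_extend)
  moreover have "component R (ciF i (Suc i)) = inv (C i (Suc i))"
    using v C_Units by (simp add: ciF_def component_extend R)
  ultimately show ?thesis by (simp add: xi_def X_def component_simps R)
qed

lemma component_power:
  assumes "component R z = K x"
  shows "component R (z ^ k) = K (x ^ k)"
  by (induction k) (simp_all add: component_simps R K_hom assms)

text \<open>Matsumoto's theorem replaces the words chosen by \<open>SOME\<close> with normal words.
  The statement serves four sums: \<open>f\<close> is \<open>TF\<close> with scalar s or - s^-1, and
  \<open>xi\<close> with scalar 1 or -1.\<close>

lemma sum_over_permutations:
  assumes far: "\<And>i j. 1 \<le> i \<Longrightarrow> Suc i < j \<Longrightarrow> j < n \<Longrightarrow> f i * f j = f j * f i"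
    and braid: "\<And>i. 1 \<le> i \<Longrightarrow> Suc i < n \<Longrightarrow> f i * f (Suc i) * f i = f (Suc i) * f i * f (Suc i)"
    and z: "component R z = K x" "component R z' = K (inverse x)" "x \<noteq> 0"
      "\<And>y. z * y = y * z" "\<And>y. z' * y = y * z'"
    and g: "\<And>i. 1 \<le> i \<Longrightarrow> i < n \<Longrightarrow> component R (f i) = g i"
  shows "(\<Oplus>w\<in>{w. w permutes {1..n}}. K (x powi colength n w) \<otimes>
      foldr (\<otimes>) (map g (SOME js. reduced_word n w js)) \<one>) =
    component R (word_sum (\<lambda>i. z * f i) n * z' ^ (\<Sum>k<n. k))"
proof -
  let ?N = "\<Sum>k<n. k"
  let ?G = "\<lambda>w. K (x powi colength n w) \<otimes> foldr (\<otimes>) (map g (SOME js. reduced_word n w js)) \<one>"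
  have term_eq: "?G (word_perm v) = component R (z ^ length v * prod_list (map f v) * z' ^ ?N)"
    if v: "v \<in> normal_words n" for v
  proof -
    define js where "js = (SOME js. reduced_word n (word_perm v) js)"
    have js: "reduced_word n (word_perm v) js"
      unfolding js_def
      by (rule permutes_reduced_word) (rule word_perm_permutes[OF normal_words_letters[OF v]])
    have "map g js = map (component R) (map f js)"
      using js g by (auto simp: reduced_word_def)
    then have "foldr (\<otimes>) (map g js) \<one> = component R (prod_list (map f js))"
      by (simp only: component_prod_list[OF R])
    also have "prod_list (map f js) = prod_list (map f v)"
      using reduced_word_braid_equiv_normal_word[OF v js] far braid by (rule braid_equiv_prod_list)
    finally have g': "foldr (\<otimes>) (map g js) \<one> = component R (prod_list (map f v))" .
    \<comment> \<open>The exponent is never positive, so the integer power is split into natural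
      powers of the scalar and of its inverse.\<close>
    have "colength n (word_perm v) = int (length v) - int ?N"
      by (simp only: colength_def perm_length_normal_word[OF v] perm_length_longest_perm)
    moreover have "x powi (int k - int l) = x ^ k * inverse x ^ l" for k l
      using z(3) by (simp add: power_int_diff power_inverse divide_inverse)
    ultimately have "x powi colength n (word_perm v) = x ^ length v * inverse x ^ ?N"
      by (simp only:)
    then have K: "K (x powi colength n (word_perm v)) = component R (z ^ length v * z' ^ ?N)"
      by (simp add: K_hom component_simps R component_power[OF z(1)] component_power[OF z(2)])
    have "y * z' ^ k = z' ^ k * y" for y k
      by (rule power_commuting_commutes[symmetric]) (rule z(5))
    then have "z ^ length v * prod_list (map f v) * z' ^ ?N = z ^ length v * z' ^ ?N * prod_list (map f v)"
      by (simp add: mult.assoc)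
    then show ?thesis
      unfolding js_def[symmetric] g' K by (simp add: component_simps R)
  qed
  have G_closed: "?G w \<in> carrier R" if "w permutes {1..n}" for w
  proof -
    have "w \<in> word_perm ` normal_words n"
      using that bij_betw_imp_surj_on[OF word_perm_bij_betw[of n]] by simp
    then obtain v where "v \<in> normal_words n" "w = word_perm v" by (elim imageE)
    then show ?thesis using term_eq[of v] component_closed[OF R] by simp
  qed
  have "finsum R ?G {w. w permutes {1..n}} = finsum R ?G (word_perm ` normal_words n)"
    by (simp add: bij_betw_imp_surj_on[OF word_perm_bij_betw])
  also have "\<dots> = finsum R (\<lambda>v. ?G (word_perm v)) (normal_words n)"
    by (rule finsum_reindex[OF _ inj_on_word_perm])
      (use G_closed word_perm_permutes[OF normal_words_letters] in blast)
  also have "\<dots> = finsum R (\<lambda>v. component R (z ^ length v * prod_list (map f v) * z' ^ ?N)) (normal_words n)"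
    by (rule finsum_cong') (auto simp: term_eq component_closed R)
  also have "\<dots> = component R (\<Sum>v\<in>normal_words n. z ^ length v * prod_list (map f v) * z' ^ ?N)"
    by (simp add: component_sum R)
  also have "(\<Sum>v\<in>normal_words n. z ^ length v * prod_list (map f v) * z' ^ ?N) =
      word_sum (\<lambda>i. z * f i) n * z' ^ ?N"
    by (simp add: word_sum_scale[OF z(4)] sum_distrib_right)
  finally show ?thesis .
qed

lemma component_c_prod:
  assumes "set L \<subseteq> {(i, j). valid i j}"
  shows "component R (prod_list (map (case_prod c) L)) = foldr (\<otimes>) (map (case_prod C) L) \<one>"
proof -
  have "map (component R) (map (case_prod c) L) = map (case_prod C) L"
    using assms by (auto simp: component_c)
  then show ?thesis by (simp only: component_prod_list[OF R])
qed

lemma X_word_closed: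
  assumes "w permutes {1..n}"
  shows "foldr (\<otimes>) (map X (SOME js. reduced_word n w js)) \<one> \<in> carrier R"
proof -
  define js where "js = (SOME js. reduced_word n w js)"
  have "set js \<subseteq> {1..<n}"
    using permutes_reduced_word[OF assms] by (simp add: js_def reduced_word_def)
  then have "map X js = map (component R) (map xi js)"
    by (auto simp: component_xi)
  then show ?thesis
    unfolding js_def[symmetric] by (simp only: component_prod_list[OF R, symmetric] component_closed[OF R])
qed

theorem symmetrizer_factorization:
  "(\<Oplus>w\<in>{w. w permutes {1..n}}. K (s powi colength n w) \<otimes>
      foldr (\<otimes>) (map T (SOME js. reduced_word n w js)) \<one>) =
    (\<Oplus>w\<in>{w. w permutes {1..n}}. foldr (\<otimes>) (map X (SOME js. reduced_word n w js)) \<one>) \<otimes>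
      foldr (\<otimes>) (map (\<lambda>(i, j). C j i) (index_pairs n)) \<one>"
proof -
  let ?N = "\<Sum>k<n. k"
  have "(\<Oplus>w\<in>{w. w permutes {1..n}}. K (s powi colength n w) \<otimes>
      foldr (\<otimes>) (map T (SOME js. reduced_word n w js)) \<one>) =
      component R (word_sum (\<lambda>i. sF * TF i) n * s'F ^ ?N)"
    by (rule sum_over_permutations[where f = TF and g = T]; (rule T_far T_braid; assumption)?)
      (simp_all add: component_T s s_central, simp_all add: sF_def s'F_def component_extend R)
  also have "word_sum (\<lambda>i. sF * TF i) n * s'F ^ ?N =
      word_sum xi n * prod_list (map (case_prod c) (inversion_pairs n))"
    by (rule word_sum_T) simp
  \<comment> \<open>The induction produces the factors c_ij with i > j; in terms of pairs i < j
    these are the c_ji, the factors of the c-function in the inverse variables.\<close>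
  also have "prod_list (map (case_prod c) (inversion_pairs n)) =
      prod_list (map (case_prod c) (map prod.swap (index_pairs n)))"
  proof (rule prod_list_map_distinct_eq)
    show "case_prod c p * case_prod c p' = case_prod c p' * case_prod c p" for p p'
      by (cases p; cases p') (simp add: c_comm)
    show "set (inversion_pairs n) = set (map prod.swap (index_pairs n))"
      by (auto simp: set_inversion_pairs index_pairs_props)
  qed (auto simp: distinct_inversion_pairs index_pairs_props distinct_map)
  also have "component R (word_sum xi n * \<dots>) = component R (word_sum xi n) \<otimes>
      foldr (\<otimes>) (map (case_prod C) (map prod.swap (index_pairs n))) \<one>"
    by (subst component_c_prod[symmetric])
      (auto simp: component_simps R index_pairs_props valid_def)
  also have "map (case_prod C) (map prod.swap (index_pairs n)) = map (\<lambda>(i, j). C j i) (index_pairs n)"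
    by auto
  also have "component R (word_sum xi n) = component R (word_sum (\<lambda>i. 1 * xi i) n * 1 ^ ?N)"
    by simp
  also have "\<dots> = (\<Oplus>w\<in>{w. w permutes {1..n}}. K (1 powi colength n w) \<otimes>
      foldr (\<otimes>) (map X (SOME js. reduced_word n w js)) \<one>)"
    by (rule sum_over_permutations[where f = xi and g = X, symmetric];
        (rule xi_far xi_braid; assumption)?)
      (simp_all add: component_xi component_simps R K_hom)
  also have "\<dots> = (\<Oplus>w\<in>{w. w permutes {1..n}}. foldr (\<otimes>) (map X (SOME js. reduced_word n w js)) \<one>)"
    by (rule finsum_cong') (simp_all add: K_hom X_word_closed)
  finally show ?thesis .
qed

theorem antisymmetrizer_factorization:
  "(\<Oplus>w\<in>{w. w permutes {1..n}}. K ((- inverse s) powi colength n w) \<otimes>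
      foldr (\<otimes>) (map T (SOME js. reduced_word n w js)) \<one>) =
    foldr (\<otimes>) (map (\<lambda>(i, j). C i j) (index_pairs n)) \<one> \<otimes>
    (\<Oplus>w\<in>{w. w permutes {1..n}}. K ((- 1) powi colength n w) \<otimes>
      foldr (\<otimes>) (map X (SOME js. reduced_word n w js)) \<one>)"
proof -
  let ?N = "\<Sum>k<n. k"
  have "(\<Oplus>w\<in>{w. w permutes {1..n}}. K ((- inverse s) powi colength n w) \<otimes>
      foldr (\<otimes>) (map T (SOME js. reduced_word n w js)) \<one>) =
      component R (word_sum (\<lambda>i. - s'F * TF i) n * (- sF) ^ ?N)"
    by (rule sum_over_permutations[where f = TF and g = T]; (rule T_far T_braid; assumption)?)
      (simp_all add: component_T s s_central,
       simp_all add: sF_def s'F_def component_extend component_simps R K_hom)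
  also have "word_sum (\<lambda>i. - s'F * TF i) n * (- sF) ^ ?N =
      prod_list (map (\<lambda>(i, j). c j i) (inversion_pairs n)) * word_sum (\<lambda>i. - xi i) n * (- 1) ^ ?N"
  proof (rule word_sum_T_sign)
    \<comment> \<open>Outside the index range the dual c-function is the constant
      \<open>- s'F\<close>, whose inverse is \<open>- sF\<close>.\<close>
    fix i j assume "\<not> (i \<in> {1..n} \<and> j \<in> {1..n} \<and> i \<noteq> j)"
    then have "F.D i j = 0" by (auto simp: F.D_def)
    then show "(- s'F - F.D i j) * - sF = 1 \<and> - sF * (- s'F - F.D i j) = 1"
      by (simp add: s_inverse s_inverse')
  qed
  also have "prod_list (map (\<lambda>(i, j). c j i) (inversion_pairs n)) =
      prod_list (map (\<lambda>(i, j). c j i) (map prod.swap (index_pairs n)))"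
  proof (rule prod_list_map_distinct_eq)
    show "(case p of (i, j) \<Rightarrow> c j i) * (case p' of (i, j) \<Rightarrow> c j i) =
      (case p' of (i, j) \<Rightarrow> c j i) * (case p of (i, j) \<Rightarrow> c j i)" for p p'
      by (cases p; cases p') (simp add: c_comm)
    show "set (inversion_pairs n) = set (map prod.swap (index_pairs n))"
      by (auto simp: set_inversion_pairs index_pairs_props)
  qed (auto simp: distinct_inversion_pairs index_pairs_props distinct_map)
  also have "map (\<lambda>(i, j). c j i) (map prod.swap (index_pairs n)) = map (case_prod c) (index_pairs n)"
    by auto
  also have "component R (prod_list (map (case_prod c) (index_pairs n)) *
        word_sum (\<lambda>i. - xi i) n * (- 1) ^ ?N) =
      foldr (\<otimes>) (map (case_prod C) (index_pairs n)) \<one> \<otimes>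
        component R (word_sum (\<lambda>i. - 1 * xi i) n * (- 1) ^ ?N)"
    by (subst component_c_prod[symmetric])
      (auto simp: component_simps R index_pairs_props valid_def component_closed m_assoc)
  \<comment> \<open>As -1 is its own inverse, the leftover sign supplies the shift by the length of
    w_0 in the exponent of -1.\<close>
  also have "component R (word_sum (\<lambda>i. - 1 * xi i) n * (- 1) ^ ?N) =
    (\<Oplus>w\<in>{w. w permutes {1..n}}. K ((- 1) powi colength n w) \<otimes>
      foldr (\<otimes>) (map X (SOME js. reduced_word n w js)) \<one>)"
    by (rule sum_over_permutations[where f = xi and g = X, symmetric];
        (rule xi_far xi_braid; assumption)?)
      (simp_all add: component_xi component_simps R K_hom)
  finally show ?thesis by simp
qed

end


section \<open>The localized affine Hecke algebras satisfy the relations\<close>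

lemma (in Group.monoid) inverse_commutes:
  assumes "x \<in> carrier G" "y \<in> carrier G" "y' \<in> carrier G"
    and "x \<otimes> y = y \<otimes> x" "y \<otimes> y' = \<one>" "y' \<otimes> y = \<one>"
  shows "x \<otimes> y' = y' \<otimes> x"
proof -
  have "x \<otimes> y' = \<one> \<otimes> x \<otimes> y'" using assms(1,3) by simp
  also have "\<dots> = (y' \<otimes> y) \<otimes> x \<otimes> y'" by (simp only: assms(6))
  also have "\<dots> = y' \<otimes> (y \<otimes> x) \<otimes> y'" using assms(1-3) by (simp add: m_assoc)
  also have "\<dots> = y' \<otimes> x \<otimes> (y \<otimes> y')" unfolding assms(4)[symmetric] using assms(1-3) by (simp add: m_assoc)
  finally show ?thesis using assms by simp
qed

lemma nc_const_commutes: "nc_const a * p = p * nc_const a"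
proof (induction p rule: update_induct)
  case (update f v b)
  have "Poly_Mapping.update v b f = f + Poly_Mapping.single v b"
    using update.hyps(1)
    by (intro poly_mapping_eqI) (auto simp: lookup_update lookup_add lookup_single when_def in_keys_iff)
  moreover have "nc_const a * Poly_Mapping.single v b = Poly_Mapping.single v b * nc_const a"
    by (simp add: nc_const_def mult_single mult.commute)
  ultimately show ?case by (simp add: distrib_left distrib_right update.IH)
qed simp

lemma nc_const_hom: "nc_const (a * b) = nc_const a * nc_const b" "nc_const 1 = 1"
  "nc_const (a - b) = nc_const a - nc_const b" "nc_const (- a) = 0 - nc_const a"
  by (simp_all add: nc_const_def mult_single single_diff single_uminus)

lemma nc_const_times_word:
  "nc_const a * (nc_gen g * nc_gen h) = Poly_Mapping.single (Word [g, h]) a"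
  by (simp add: nc_const_def nc_gen_def mult_single plus_word_def zero_word_def)

context
  fixes k :: side and n :: nat and s :: complex
begin

abbreviation (input) "loc_free \<equiv> free_algebra (loc_gens n)"
abbreviation (input) "loc_alg \<equiv> hecke_loc k n s"
abbreviation (input) "cls \<equiv> hecke_class k n s"

lemma relation_ideal_ideal: "ideal (relation_ideal (loc_gens n) (loc_rels k n s)) loc_free"
  unfolding relation_ideal_def by (intro ring.genideal_ideal ring_free_algebra loc_rels_carrier)

lemma hecke_class_ring_hom: "cls \<in> ring_hom loc_free loc_alg"
  using ideal.rcos_ring_hom[OF relation_ideal_ideal]
  by (simp add: hecke_class_def[abs_def] hecke_loc_def presented_algebra_def)

lemma free_algebra_ops:
  "x \<oplus>\<^bsub>loc_free\<^esub> y = x + y" "x \<otimes>\<^bsub>loc_free\<^esub> y = x * y" "\<one>\<^bsub>loc_free\<^esub> = 1" "\<zero>\<^bsub>loc_free\<^esub> = 0"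
  by (simp_all add: free_algebra_def)

lemma zero_closed: "0 \<in> carrier loc_free"
  using ring.ring_simprules(2)[OF ring_free_algebra, of "loc_gens n"] by (simp add: free_algebra_ops)

lemma free_algebra_minus:
  assumes "x \<in> carrier loc_free" "y \<in> carrier loc_free"
  shows "x \<ominus>\<^bsub>loc_free\<^esub> y = x - y"
proof -
  interpret A: Ring.ring loc_free by (rule ring_free_algebra)
  have "\<ominus>\<^bsub>loc_free\<^esub> y = 0 - y"
    by (rule A.minus_equality) (use free_algebra_closed(3)[OF zero_closed assms(2)] assms in
      \<open>simp_all add: free_algebra_ops\<close>)
  then show ?thesis by (simp add: A.minus_eq free_algebra_ops)
qed

lemma hecke_class_closed: "x \<in> carrier loc_free \<Longrightarrow> cls x \<in> carrier loc_alg"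
  by (rule ring_hom_closed[OF hecke_class_ring_hom])

lemma hecke_class_hom:
  "x \<in> carrier loc_free \<Longrightarrow> y \<in> carrier loc_free \<Longrightarrow> cls (x + y) = cls x \<oplus>\<^bsub>loc_alg\<^esub> cls y"
  "x \<in> carrier loc_free \<Longrightarrow> y \<in> carrier loc_free \<Longrightarrow> cls (x * y) = cls x \<otimes>\<^bsub>loc_alg\<^esub> cls y"
  "cls 1 = \<one>\<^bsub>loc_alg\<^esub>"
  using ring_hom_add[OF hecke_class_ring_hom] ring_hom_mult[OF hecke_class_ring_hom]
    ring_hom_one[OF hecke_class_ring_hom]
  by (simp_all add: free_algebra_ops)

lemma hecke_class_diff:
  assumes "x \<in> carrier loc_free" "y \<in> carrier loc_free"
  shows "cls (x - y) = cls x \<ominus>\<^bsub>loc_alg\<^esub> cls y"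
proof -
  interpret H: Ring.ring loc_alg by (rule ring_hecke_loc)
  have "cls x = cls (x - y) \<oplus>\<^bsub>loc_alg\<^esub> cls y"
    using hecke_class_hom(1)[of "x - y" y] assms free_algebra_closed(3)[OF assms] by simp
  then show ?thesis
    using hecke_class_closed free_algebra_closed(3)[OF assms] assms
    by (simp add: H.minus_eq H.a_assoc H.r_neg)
qed

lemma hecke_class_eq:
  assumes "(l, r) \<in> loc_rels k n s" "l \<in> carrier loc_free" "r \<in> carrier loc_free"
  shows "cls l = cls r"
proof -
  interpret A: Ring.ring loc_free by (rule ring_free_algebra)
  have "l - r \<in> relation_ideal (loc_gens n) (loc_rels k n s)"
    unfolding relation_ideal_def
    using A.genideal_self[OF loc_rels_carrier] assms(1) by blast
  then show ?thesis
    using A.quotient_eq_iff_same_a_r_cos[OF relation_ideal_ideal assms(2,3)]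
    by (simp add: hecke_class_def free_algebra_minus[OF assms(2,3)])
qed

lemma hecke_loc_carrierE:
  assumes "y \<in> carrier loc_alg"
  obtains x where "x \<in> carrier loc_free" "y = cls x"
  using assms
  by (auto simp: hecke_loc_def presented_algebra_def FactRing_def A_RCOSETS_def' hecke_class_def)

lemma hconst_closed: "hconst k n s a \<in> carrier loc_alg"
  by (simp add: hconst_def hecke_class_closed nc_const_carrier)

lemma hconst_central: "y \<in> carrier loc_alg \<Longrightarrow> hconst k n s a \<otimes>\<^bsub>loc_alg\<^esub> y = y \<otimes>\<^bsub>loc_alg\<^esub> hconst k n s a"
  by (elim hecke_loc_carrierE)
    (simp add: hconst_def nc_const_carrier nc_const_commutes flip: hecke_class_hom(2))

lemma hconst_hom:
  "hconst k n s 1 = \<one>\<^bsub>loc_alg\<^esub>"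
  "hconst k n s (a * b) = hconst k n s a \<otimes>\<^bsub>loc_alg\<^esub> hconst k n s b"
  "hconst k n s (a - b) = hconst k n s a \<ominus>\<^bsub>loc_alg\<^esub> hconst k n s b"
  "hconst k n s (- a) = \<ominus>\<^bsub>loc_alg\<^esub> hconst k n s a"
proof -
  interpret H: Ring.ring loc_alg by (rule ring_hecke_loc)
  show diff: "hconst k n s (a - b) = hconst k n s a \<ominus>\<^bsub>loc_alg\<^esub> hconst k n s b" for a b
    by (simp add: hconst_def nc_const_hom nc_const_carrier hecke_class_diff)
  show "hconst k n s 1 = \<one>\<^bsub>loc_alg\<^esub>"
    "hconst k n s (a * b) = hconst k n s a \<otimes>\<^bsub>loc_alg\<^esub> hconst k n s b"
    by (simp_all add: hconst_def nc_const_hom nc_const_carrier hecke_class_hom)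
  have "hconst k n s 0 = \<zero>\<^bsub>loc_alg\<^esub>"
    using diff[of 0 0] hconst_closed[of 0] by (simp add: H.minus_eq H.r_neg)
  then show "hconst k n s (- a) = \<ominus>\<^bsub>loc_alg\<^esub> hconst k n s a"
    using diff[of 0 a] hconst_closed[of a] by (simp add: H.minus_eq)
qed

definition hZinv :: "nat \<Rightarrow> gen ncpoly set" where "hZinv i = cls (nc_gen (GZinv i))"

lemma gen_carrier:
  "1 \<le> i \<Longrightarrow> i < n \<Longrightarrow> nc_gen (GT i) \<in> carrier loc_free"
  "j \<in> {1..n} \<Longrightarrow> nc_gen (GZ j) \<in> carrier loc_free"
  "j \<in> {1..n} \<Longrightarrow> nc_gen (GZinv j) \<in> carrier loc_free"
  by (auto intro!: nc_gen_carrier simp: loc_gens_def hecke_gens_def)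

lemma hecke_gen_closed:
  "1 \<le> i \<Longrightarrow> i < n \<Longrightarrow> hT k n s i \<in> carrier loc_alg"
  "j \<in> {1..n} \<Longrightarrow> hZ k n s j \<in> carrier loc_alg"
  "j \<in> {1..n} \<Longrightarrow> hZinv j \<in> carrier loc_alg"
  by (simp_all add: hT_def hZ_def hZinv_def hecke_class_closed gen_carrier)

lemmas class_closed = free_algebra_closed gen_carrier nc_const_carrier
lemmas class_simps = hecke_class_hom class_closed

lemma hecke_rels_loc: "x \<in> hecke_rels k n s \<Longrightarrow> x \<in> loc_rels k n s"
  by (simp add: loc_rels_def)

lemma hT_square:
  assumes "1 \<le> i" "i < n"
  shows "hT k n s i \<otimes>\<^bsub>loc_alg\<^esub> hT k n s i =
    (hconst k n s s \<ominus>\<^bsub>loc_alg\<^esub> hconst k n s (inverse s)) \<otimes>\<^bsub>loc_alg\<^esub> hT k n s i \<oplus>\<^bsub>loc_alg\<^esub> \<one>\<^bsub>loc_alg\<^esub>"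
proof -
  have dom: "i \<in> {1..<n}"
    using assms by auto
  have "cls (nc_gen (GT i) * nc_gen (GT i)) = cls (nc_const (s - inverse s) * nc_gen (GT i) + 1)"
    by (rule hecke_class_eq[OF hecke_rels_loc])
      (unfold hecke_rels_def, use assms dom in blast, use assms in \<open>simp_all add: class_closed\<close>)
  then show ?thesis
    using assms by (simp add: class_simps hT_def hconst_def[symmetric] hconst_hom)
qed

lemma hT_far:
  assumes "1 \<le> i" "Suc i < j" "j < n"
  shows "hT k n s i \<otimes>\<^bsub>loc_alg\<^esub> hT k n s j = hT k n s j \<otimes>\<^bsub>loc_alg\<^esub> hT k n s i"
proof -
  have dom: "i \<in> {1..<n}" "j \<in> {1..<n}" "\<bar>int i - int j\<bar> > 1"
    using assms by auto
  have "cls (nc_gen (GT i) * nc_gen (GT j)) = cls (nc_gen (GT j) * nc_gen (GT i))"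
    by (rule hecke_class_eq[OF hecke_rels_loc])
      (unfold hecke_rels_def, use assms dom in blast, use assms in \<open>simp_all add: class_closed\<close>)
  then show ?thesis using assms by (simp add: class_simps hT_def)
qed

lemma hT_braid:
  assumes "1 \<le> i" "Suc i < n"
  shows "hT k n s i \<otimes>\<^bsub>loc_alg\<^esub> hT k n s (Suc i) \<otimes>\<^bsub>loc_alg\<^esub> hT k n s i =
    hT k n s (Suc i) \<otimes>\<^bsub>loc_alg\<^esub> hT k n s i \<otimes>\<^bsub>loc_alg\<^esub> hT k n s (Suc i)"
proof -
  have "cls (nc_gen (GT i) * nc_gen (GT (Suc i)) * nc_gen (GT i)) =
      cls (nc_gen (GT (Suc i)) * nc_gen (GT i) * nc_gen (GT (Suc i)))"
    by (rule hecke_class_eq[OF hecke_rels_loc])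
      (unfold hecke_rels_def, use assms in blast, use assms in \<open>simp_all add: class_closed\<close>)
  then show ?thesis using assms by (simp add: class_simps hT_def)
qed

lemma hZ_comm:
  assumes "i \<in> {1..n}" "j \<in> {1..n}"
  shows "hZ k n s i \<otimes>\<^bsub>loc_alg\<^esub> hZ k n s j = hZ k n s j \<otimes>\<^bsub>loc_alg\<^esub> hZ k n s i"
proof -
  have "cls (nc_gen (GZ i) * nc_gen (GZ j)) = cls (nc_gen (GZ j) * nc_gen (GZ i))"
    by (rule hecke_class_eq[OF hecke_rels_loc])
      (unfold hecke_rels_def, use assms in blast, use assms in \<open>simp_all add: class_closed\<close>)
  then show ?thesis using assms by (simp add: class_simps hZ_def)
qed

lemma hZ_inverse:
  assumes "i \<in> {1..n}"
  shows "hZ k n s i \<otimes>\<^bsub>loc_alg\<^esub> hZinv i = \<one>\<^bsub>loc_alg\<^esub>" "hZinv i \<otimes>\<^bsub>loc_alg\<^esub> hZ k n s i = \<one>\<^bsub>loc_alg\<^esub>"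
proof -
  have "cls (nc_gen (GZ i) * nc_gen (GZinv i)) = cls 1" "cls (nc_gen (GZinv i) * nc_gen (GZ i)) = cls 1"
    by (rule hecke_class_eq[OF hecke_rels_loc];
      (unfold hecke_rels_def, use assms in blast | use assms in \<open>simp add: class_closed\<close>))+
  then show "hZ k n s i \<otimes>\<^bsub>loc_alg\<^esub> hZinv i = \<one>\<^bsub>loc_alg\<^esub>" "hZinv i \<otimes>\<^bsub>loc_alg\<^esub> hZ k n s i = \<one>\<^bsub>loc_alg\<^esub>"
    using assms by (simp_all add: class_simps hZ_def hZinv_def)
qed

lemma hT_hZ_far:
  assumes "1 \<le> i" "i < n" "j \<in> {1..n}" "j \<noteq> i" "j \<noteq> Suc i"
  shows "hT k n s i \<otimes>\<^bsub>loc_alg\<^esub> hZ k n s j = hZ k n s j \<otimes>\<^bsub>loc_alg\<^esub> hT k n s i"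
proof -
  have dom: "i \<in> {1..<n}"
    using assms by auto
  have "cls (nc_gen (GT i) * nc_gen (GZ j)) = cls (nc_gen (GZ j) * nc_gen (GT i))"
    by (rule hecke_class_eq[OF hecke_rels_loc])
      (unfold hecke_rels_def, use assms dom in blast, use assms in \<open>simp_all add: class_closed\<close>)
  then show ?thesis using assms by (simp add: class_simps hZ_def hT_def)
qed

lemma inv_hZ: "i \<in> {1..n} \<Longrightarrow> inv\<^bsub>loc_alg\<^esub> (hZ k n s i) = hZinv i"
proof -
  assume i: "i \<in> {1..n}"
  interpret H: Ring.ring loc_alg by (rule ring_hecke_loc)
  show ?thesis
    using H.inv_unique'[of "hZ k n s i" "hZinv i"] i by (simp add: hecke_gen_closed hZ_inverse)
qed

lemma hZ_hZinv_comm: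
  assumes "i \<in> {1..n}" "j \<in> {1..n}"
  shows "hZ k n s i \<otimes>\<^bsub>loc_alg\<^esub> hZinv j = hZinv j \<otimes>\<^bsub>loc_alg\<^esub> hZ k n s i"
proof -
  interpret H: Ring.ring loc_alg by (rule ring_hecke_loc)
  show ?thesis
    by (rule H.inverse_commutes[of _ "hZ k n s j"])
      (use assms in \<open>simp_all add: hecke_gen_closed hZ_inverse hZ_comm\<close>)
qed

lemma hZinv_comm:
  assumes "i \<in> {1..n}" "j \<in> {1..n}"
  shows "hZinv i \<otimes>\<^bsub>loc_alg\<^esub> hZinv j = hZinv j \<otimes>\<^bsub>loc_alg\<^esub> hZinv i"
proof -
  interpret H: Ring.ring loc_alg by (rule ring_hecke_loc)
  show ?thesis
    by (rule H.inverse_commutes[of _ "hZ k n s j"])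
      (use assms in \<open>simp_all add: hecke_gen_closed hZ_inverse hZ_hZinv_comm\<close>)
qed

lemma hT_hZinv_far:
  assumes "1 \<le> i" "i < n" "j \<in> {1..n}" "j \<noteq> i" "j \<noteq> Suc i"
  shows "hT k n s i \<otimes>\<^bsub>loc_alg\<^esub> hZinv j = hZinv j \<otimes>\<^bsub>loc_alg\<^esub> hT k n s i"
proof -
  interpret H: Ring.ring loc_alg by (rule ring_hecke_loc)
  show ?thesis
    by (rule H.inverse_commutes[of _ "hZ k n s j"])
      (use assms in \<open>simp_all add: hecke_gen_closed hZ_inverse hT_hZ_far\<close>)
qed

text \<open>\<open>laurent_word\<close> lists its letters by increasing index, so the order of the
  two letters depends on whether \<open>i < j\<close>.\<close>

lemma laurent_word_ratio:
  assumes "i \<in> {1..n}" "j \<in> {1..n}" "i \<noteq> j"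
  shows "laurent_word n (Poly_Mapping.single i 1 - Poly_Mapping.single j 1) =
    Word (if i < j then [GZ i, GZinv j] else [GZinv j, GZ i])"
proof -
  let ?f = "\<lambda>l. replicate (nat (Poly_Mapping.lookup (Poly_Mapping.single i 1 - Poly_Mapping.single j (1::int)) l)) (GZ l) @
      replicate (nat (- Poly_Mapping.lookup (Poly_Mapping.single i 1 - Poly_Mapping.single j (1::int)) l)) (GZinv l)"
  define g where "g l = (if l = i then [GZ i] else if l = j then [GZinv j] else [])" for l
  have f: "?f = g"
    using assms(3) by (auto simp: g_def lookup_minus lookup_single when_def)
  have g: "g i = [GZ i]" "g j = [GZinv j]" using assms(3) by (simp_all add: g_def)
  have empty: "concat (map g xs) = []" if "i \<notin> set xs" "j \<notin> set xs" for xs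
    using that by (induction xs) (auto simp: g_def)
  have split: "[1..<Suc n] = [1..<a] @ a # [Suc a..<b] @ b # [Suc b..<Suc n]"
    if "1 \<le> a" "a < b" "b \<le> n" for a b
  proof -
    have "[1..<Suc n] = [1..<a] @ [a..<Suc n]"
      using that upt_add_eq_append[of 1 a "Suc n - a"] by simp
    also have "[a..<Suc n] = a # [Suc a..<Suc n]" using that by (simp add: upt_conv_Cons)
    also have "[Suc a..<Suc n] = [Suc a..<b] @ [b..<Suc n]"
      using that upt_add_eq_append[of "Suc a" b "Suc n - b"] by simp
    also have "[b..<Suc n] = b # [Suc b..<Suc n]" using that by (simp add: upt_conv_Cons)
    finally show ?thesis .
  qed
  have "concat (map g [1..<Suc n]) = (if i < j then [GZ i, GZinv j] else [GZinv j, GZ i])"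
  proof (cases "i < j")
    case True
    then have eq: "[1..<Suc n] = [1..<i] @ i # [Suc i..<j] @ j # [Suc j..<Suc n]"
      using assms by (intro split) auto
    show ?thesis unfolding eq using True by (simp add: empty g)
  next
    case False
    then have eq: "[1..<Suc n] = [1..<j] @ j # [Suc j..<i] @ i # [Suc i..<Suc n]"
      using assms by (intro split) auto
    show ?thesis unfolding eq using False by (simp add: empty g)
  qed
  then show ?thesis unfolding laurent_word_def f by simp
qed

text \<open>A binomial in the ratio is a nonzero Laurent polynomial, since the monomials 1 and Z_i /
  Z_j are distinct, and so it has an adjoined inverse. The coefficients (1, 1) and (s^-1, s) give
  the denominators and numerators of the c-functions.\<close>

lemma linear_in_ratio_unit:
  assumes ij: "i \<in> {1..n}" "j \<in> {1..n}" "i \<noteq> j" and ab: "a \<noteq> 0" "b \<noteq> 0"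
  shows "hconst k n s a \<ominus>\<^bsub>loc_alg\<^esub> hconst k n s b \<otimes>\<^bsub>loc_alg\<^esub> (hZ k n s i \<otimes>\<^bsub>loc_alg\<^esub> hZinv j) \<in> Units loc_alg"
proof -
  interpret H: Ring.ring loc_alg by (rule ring_hecke_loc)
  define m :: "nat \<Rightarrow>\<^sub>0 int" where "m = Poly_Mapping.single i 1 - Poly_Mapping.single j 1"
  define p :: laurent where "p = Poly_Mapping.single 0 a - Poly_Mapping.single m b"
  have m_i: "Poly_Mapping.lookup m i = 1" using ij by (simp add: m_def lookup_minus lookup_single)
  then have m: "m \<noteq> 0" by auto
  have keys_m: "Poly_Mapping.keys m \<subseteq> {1..n}"
    using ij by (auto simp: m_def in_keys_iff lookup_minus lookup_single when_def split: if_splits)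
  have lookup_p: "Poly_Mapping.lookup p 0 = a" "Poly_Mapping.lookup p m = - b"
    using m by (simp_all add: p_def lookup_minus lookup_single when_def)
  have keys_p: "Poly_Mapping.keys p = {0, m}"
    using ab m by (auto simp: p_def in_keys_iff lookup_minus lookup_single when_def split: if_splits)
  have p: "p \<in> laurent_polys n - {0}"
    using keys_m keys_p by (auto simp: laurent_polys_def)
  define g where "g = (if i < j then nc_gen (GZ i) * nc_gen (GZinv j) else nc_gen (GZinv j) * nc_gen (GZ i))"
  have g: "g \<in> carrier loc_free" using ij by (simp add: g_def class_simps)
  have "laurent_word n 0 = 0" by (simp add: laurent_word_def zero_word_def)
  moreover have "Poly_Mapping.single (laurent_word n m) c = nc_const c * g" for c
    using laurent_word_ratio[OF ij] by (simp add: m_def g_def nc_const_times_word)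
  ultimately have eval: "laurent_eval n p = nc_const a - nc_const b * g"
    using m by (simp add: laurent_eval_def keys_p lookup_p nc_const_def single_uminus)
  have "cls g = hZ k n s i \<otimes>\<^bsub>loc_alg\<^esub> hZinv j"
    using ij hZ_hZinv_comm[OF ij(1,2)] by (simp add: g_def class_simps hZ_def hZinv_def)
  then have cls_p: "cls (laurent_eval n p) =
      hconst k n s a \<ominus>\<^bsub>loc_alg\<^esub> hconst k n s b \<otimes>\<^bsub>loc_alg\<^esub> (hZ k n s i \<otimes>\<^bsub>loc_alg\<^esub> hZinv j)"
    using g by (simp add: eval hecke_class_diff class_simps hconst_def)
  have inv_p: "nc_gen (GInv p) \<in> carrier loc_free"
    using p by (auto intro!: nc_gen_carrier simp: loc_gens_def)
  have "cls (laurent_eval n p * nc_gen (GInv p)) = cls 1" "cls (nc_gen (GInv p) * laurent_eval n p) = cls 1"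
    by (rule hecke_class_eq;
      use p inv_p in \<open>auto simp: loc_rels_def class_simps laurent_eval_carrier\<close>)+
  then show ?thesis
    unfolding cls_p[symmetric] Units_def
    using hecke_class_closed[OF laurent_eval_carrier[of n p]] hecke_class_closed[OF inv_p]
    by (auto simp: class_simps laurent_eval_carrier inv_p)
qed

end


section \<open>The two cases: X_i, and the inverses of the Y_i\<close>

lemma crossing_X:
  assumes "1 \<le> i" "i < n"
  shows "hZ LX n s (Suc i) =
    hT LX n s i \<otimes>\<^bsub>hecke_loc LX n s\<^esub> hZ LX n s i \<otimes>\<^bsub>hecke_loc LX n s\<^esub> hT LX n s i"
proof -
  have dom: "i \<in> {1..<n}" using assms by simp
  have "hecke_class LX n s (nc_gen (GZ (Suc i))) = hecke_class LX n s (crossing LX s i)"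
    by (rule hecke_class_eq[OF hecke_rels_loc])
      (unfold hecke_rels_def, use dom in blast, use assms in \<open>simp_all add: class_closed\<close>)
  then show ?thesis using assms by (simp add: class_simps hZ_def hT_def)
qed

lemma nc_Tinv_inverse:
  fixes k :: side and s :: complex
  assumes "1 \<le> i" "i < n"
  defines "t \<equiv> hecke_class k n s (nc_Tinv s i)"
  shows "t \<in> carrier (hecke_loc k n s)"
    "hT k n s i \<otimes>\<^bsub>hecke_loc k n s\<^esub> t = \<one>\<^bsub>hecke_loc k n s\<^esub>"
    "t \<otimes>\<^bsub>hecke_loc k n s\<^esub> hT k n s i = \<one>\<^bsub>hecke_loc k n s\<^esub>"
proof -
  let ?c = "nc_const (s - inverse s)" and ?T = "nc_gen (GT i)" and ?A = "free_algebra (loc_gens n)"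
  have dom: "i \<in> {1..<n}" using assms by simp
  have T: "?T \<in> carrier ?A" using assms by (simp add: class_closed)
  have Ti: "nc_Tinv s i \<in> carrier ?A" using T by (simp add: nc_Tinv_def class_closed)
  then show "t \<in> carrier (hecke_loc k n s)" by (simp add: t_def hecke_class_closed)
  have sq: "hecke_class k n s (?T * ?T) = hecke_class k n s (?c * ?T + 1)"
    by (rule hecke_class_eq[OF hecke_rels_loc])
      (unfold hecke_rels_def, use dom in blast, use T in \<open>simp_all add: class_closed\<close>)
  have "hecke_class k n s (?T * ?T - ?c * ?T) =
      hecke_class k n s (?T * ?T) \<ominus>\<^bsub>hecke_loc k n s\<^esub> hecke_class k n s (?c * ?T)"
    using T by (simp add: hecke_class_diff class_closed)
  also have "\<dots> = hecke_class k n s (?c * ?T + 1 - ?c * ?T)"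
    unfolding sq using T by (simp only: hecke_class_diff class_closed)
  also have "?c * ?T + 1 - ?c * ?T = 1" by simp
  finally have "hecke_class k n s (?T * ?T - ?c * ?T) = \<one>\<^bsub>hecke_loc k n s\<^esub>"
    by (simp only: hecke_class_hom)
  moreover have "?T * nc_Tinv s i = ?T * ?T - ?c * ?T" "nc_Tinv s i * ?T = ?T * ?T - ?c * ?T"
    by (simp_all add: nc_Tinv_def right_diff_distrib left_diff_distrib nc_const_commutes[of "s - inverse s" ?T])
  ultimately show "hT k n s i \<otimes>\<^bsub>hecke_loc k n s\<^esub> t = \<one>\<^bsub>hecke_loc k n s\<^esub>"
    "t \<otimes>\<^bsub>hecke_loc k n s\<^esub> hT k n s i = \<one>\<^bsub>hecke_loc k n s\<^esub>"
    using hecke_class_hom(2)[OF T Ti, of k s] hecke_class_hom(2)[OF Ti T, of k s]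
    by (simp_all add: t_def hT_def)
qed

text \<open>Inverting Y_{i+1} = T_i^-1 Y_i T_i^-1 gives the crossing relation of the X_i for the
  inverses of the Y_i. The proof checks that the right-hand side is a right inverse of Y_{i+1} and
  uses uniqueness of inverses.\<close>

lemma crossing_Y:
  assumes "1 \<le> i" "i < n"
  shows "hZinv LY n s (Suc i) =
    hT LY n s i \<otimes>\<^bsub>hecke_loc LY n s\<^esub> hZinv LY n s i \<otimes>\<^bsub>hecke_loc LY n s\<^esub> hT LY n s i"
proof -
  interpret H: Ring.ring "hecke_loc LY n s" by (rule ring_hecke_loc)
  let ?t = "hecke_class LY n s (nc_Tinv s i)" and ?T = "hT LY n s i"
  let ?Z = "hZ LY n s i" and ?Z' = "hZinv LY n s i"
  have dom: "i \<in> {1..<n}" using assms by simp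
  have Ti: "nc_Tinv s i \<in> carrier (free_algebra (loc_gens n))"
    using assms by (simp add: nc_Tinv_def class_closed)
  have Z: "nc_gen (GZ i) \<in> carrier (free_algebra (loc_gens n))" using assms by (simp add: class_closed)
  have "hecke_class LY n s (nc_gen (GZ (Suc i))) = hecke_class LY n s (crossing LY s i)"
    by (rule hecke_class_eq[OF hecke_rels_loc])
      (unfold hecke_rels_def, use dom in blast, use assms Ti in \<open>simp_all add: class_closed\<close>)
  then have Z1: "hZ LY n s (Suc i) = ?t \<otimes>\<^bsub>hecke_loc LY n s\<^esub> ?Z \<otimes>\<^bsub>hecke_loc LY n s\<^esub> ?t"
    using Ti Z by (simp add: hecke_class_hom(2) free_algebra_closed(4) hZ_def)
  note closed = nc_Tinv_inverse(1)[OF assms, of LY s] hecke_gen_closed(1)[OF assms, of LY s]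
    hecke_gen_closed(2,3)[of i n LY s] hecke_gen_closed(2,3)[of "Suc i" n LY s]
  have i: "i \<in> {1..n}" "Suc i \<in> {1..n}" using assms by auto
  have "hZ LY n s (Suc i) \<otimes>\<^bsub>hecke_loc LY n s\<^esub>
      (?T \<otimes>\<^bsub>hecke_loc LY n s\<^esub> ?Z' \<otimes>\<^bsub>hecke_loc LY n s\<^esub> ?T) =
    ?t \<otimes>\<^bsub>hecke_loc LY n s\<^esub> (?Z \<otimes>\<^bsub>hecke_loc LY n s\<^esub> (?t \<otimes>\<^bsub>hecke_loc LY n s\<^esub> ?T)
      \<otimes>\<^bsub>hecke_loc LY n s\<^esub> ?Z') \<otimes>\<^bsub>hecke_loc LY n s\<^esub> ?T"
    unfolding Z1 using closed i by (simp add: H.m_assoc)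
  also have "\<dots> = \<one>\<^bsub>hecke_loc LY n s\<^esub>"
    using closed i by (simp add: nc_Tinv_inverse(2,3)[OF assms] hZ_inverse)
  finally have r: "hZ LY n s (Suc i) \<otimes>\<^bsub>hecke_loc LY n s\<^esub>
      (?T \<otimes>\<^bsub>hecke_loc LY n s\<^esub> ?Z' \<otimes>\<^bsub>hecke_loc LY n s\<^esub> ?T) = \<one>\<^bsub>hecke_loc LY n s\<^esub>" .
  show ?thesis
    by (rule H.inv_unique[OF hZ_inverse(2)[OF i(2)] r]) (use closed i in simp_all)
qed

lemma affine_hecke_X:
  assumes "s \<noteq> 0"
  shows "affine_hecke_in_ring (hecke_loc LX n s) n (hconst LX n s) s (hT LX n s) (hZ LX n s) (hZinv LX n s)"
proof (intro affine_hecke_in_ring.intro affine_hecke_in_ring_axioms.intro)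
  interpret H: Ring.ring "hecke_loc LX n s" by (rule ring_hecke_loc)
  fix i j assume ij: "i \<in> {1..n}" "j \<in> {1..n}" "i \<noteq> j"
  show "hconst LX n s (inverse s) \<ominus>\<^bsub>hecke_loc LX n s\<^esub> hconst LX n s s \<otimes>\<^bsub>hecke_loc LX n s\<^esub>
      (hZ LX n s i \<otimes>\<^bsub>hecke_loc LX n s\<^esub> hZinv LX n s j) \<in> Units (hecke_loc LX n s)"
    by (rule linear_in_ratio_unit[OF ij]) (simp_all add: assms)
  show "\<one>\<^bsub>hecke_loc LX n s\<^esub> \<ominus>\<^bsub>hecke_loc LX n s\<^esub>
      hZ LX n s i \<otimes>\<^bsub>hecke_loc LX n s\<^esub> hZinv LX n s j \<in> Units (hecke_loc LX n s)"
    using linear_in_ratio_unit[OF ij, of 1 1 LX s] ij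
    by (simp add: hconst_hom hecke_gen_closed)
qed (rule assms ring_hecke_loc hconst_closed hconst_hom hconst_central hecke_gen_closed hT_square
      hT_far hT_braid hZ_comm hZ_inverse crossing_X hT_hZ_far; assumption)+

lemma affine_hecke_Y:
  assumes "s \<noteq> 0"
  shows "affine_hecke_in_ring (hecke_loc LY n s) n (hconst LY n s) s (hT LY n s) (hZinv LY n s) (hZ LY n s)"
proof (intro affine_hecke_in_ring.intro affine_hecke_in_ring_axioms.intro)
  interpret H: Ring.ring "hecke_loc LY n s" by (rule ring_hecke_loc)
  fix i j assume ij: "i \<in> {1..n}" "j \<in> {1..n}" "i \<noteq> j"
  note ji = ij(2,1) ij(3)[symmetric]
  note comm = hZ_hZinv_comm[OF ij(2,1), of LY s, symmetric]
  show "hconst LY n s (inverse s) \<ominus>\<^bsub>hecke_loc LY n s\<^esub> hconst LY n s s \<otimes>\<^bsub>hecke_loc LY n s\<^esub>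
      (hZinv LY n s i \<otimes>\<^bsub>hecke_loc LY n s\<^esub> hZ LY n s j) \<in> Units (hecke_loc LY n s)"
    unfolding comm by (rule linear_in_ratio_unit[OF ji]) (simp_all add: assms)
  show "\<one>\<^bsub>hecke_loc LY n s\<^esub> \<ominus>\<^bsub>hecke_loc LY n s\<^esub>
      hZinv LY n s i \<otimes>\<^bsub>hecke_loc LY n s\<^esub> hZ LY n s j \<in> Units (hecke_loc LY n s)"
    using linear_in_ratio_unit[OF ji, of 1 1 LY s] ij unfolding comm
    by (simp add: hconst_hom hecke_gen_closed)
qed (rule assms ring_hecke_loc hconst_closed hconst_hom hconst_central hecke_gen_closed hT_square
      hT_far hT_braid hZinv_comm hZ_inverse crossing_Y hT_hZinv_far; assumption)+

lemma ratio_eq: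
  assumes "i \<in> {1..n}" "j \<in> {1..n}"
  shows "ratio k n s i j = hZ k n s i \<otimes>\<^bsub>hecke_loc k n s\<^esub> hZinv k n s j"
    "ratio_inv k n s i j = hZinv k n s i \<otimes>\<^bsub>hecke_loc k n s\<^esub> hZ k n s j"
    "ratio_inv k n s i j = ratio k n s j i"
  using assms hZ_hZinv_comm[of j n i k s] by (simp_all add: ratio_def ratio_inv_def inv_hZ)

lemma map_intertwiner_reduced_word:
  assumes "\<And>i. 1 \<le> i \<Longrightarrow> i < n \<Longrightarrow> X i = intertwiner k n s i" "w permutes {1..n}"
  shows "map X (SOME js. reduced_word n w js) = map (intertwiner k n s) (SOME js. reduced_word n w js)"
  using permutes_reduced_word[OF assms(2)] assms(1) by (auto simp: reduced_word_def)

theorem symmetrizers_X: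
  assumes "s \<noteq> 0"
  shows "one_zero LX n s = p_zero LX n s \<otimes>\<^bsub>hecke_loc LX n s\<^esub> c_w0_inv LX n s"
    "eps_zero LX n s = c_w0 LX n s \<otimes>\<^bsub>hecke_loc LX n s\<^esub> e_zero LX n s"
proof -
  interpret H: affine_hecke_in_ring "hecke_loc LX n s" n "hconst LX n s" s "hT LX n s" "hZ LX n s" "hZinv LX n s"
    by (rule affine_hecke_X[OF assms])
  have C: "H.C i j = c_fun LX n s i j" if "i \<in> {1..n}" "j \<in> {1..n}" for i j
    using that by (simp add: H.C_def c_fun_def c_of_def ratio_eq)
  have X: "H.X i = intertwiner LX n s i" if "1 \<le> i" "i < n" for i
    using that by (simp add: H.X_def C C_simple_def)
  note word = arg_cong[OF map_intertwiner_reduced_word[OF X], of _ "hprod LX n s"]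
  have p: "p_zero LX n s = (\<Oplus>\<^bsub>hecke_loc LX n s\<^esub>w\<in>{w. w permutes {1..n}}.
      foldr (\<otimes>\<^bsub>hecke_loc LX n s\<^esub>) (map H.X (SOME js. reduced_word n w js)) \<one>\<^bsub>hecke_loc LX n s\<^esub>)"
    unfolding p_zero_def intertwiner_perm_def
    by (rule H.finsum_cong') (use word H.X_word_closed in \<open>auto simp: hprod_def\<close>)
  have e: "e_zero LX n s = (\<Oplus>\<^bsub>hecke_loc LX n s\<^esub>w\<in>{w. w permutes {1..n}}.
      hconst LX n s ((- 1) powi colength n w) \<otimes>\<^bsub>hecke_loc LX n s\<^esub>
      foldr (\<otimes>\<^bsub>hecke_loc LX n s\<^esub>) (map H.X (SOME js. reduced_word n w js)) \<one>\<^bsub>hecke_loc LX n s\<^esub>)"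
    unfolding e_zero_def intertwiner_perm_def
    by (rule H.finsum_cong') (use word H.X_word_closed in \<open>auto simp: hprod_def\<close>)
  have m: "map (\<lambda>(i, j). c_of LX n s (ratio_inv LX n s i j)) (index_pairs n) =
      map (\<lambda>(i, j). H.C j i) (index_pairs n)"
    "map (\<lambda>(i, j). c_fun LX n s i j) (index_pairs n) = map (\<lambda>(i, j). H.C i j) (index_pairs n)"
    by (auto simp: index_pairs_props C c_fun_def ratio_eq(3))
  show "one_zero LX n s = p_zero LX n s \<otimes>\<^bsub>hecke_loc LX n s\<^esub> c_w0_inv LX n s"
    unfolding p c_w0_inv_def m one_zero_def T_perm_def hprod_def by (rule H.symmetrizer_factorization)
  show "eps_zero LX n s = c_w0 LX n s \<otimes>\<^bsub>hecke_loc LX n s\<^esub> e_zero LX n s"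
    unfolding e c_w0_def m eps_zero_def T_perm_def hprod_def by (rule H.antisymmetrizer_factorization)
qed

theorem symmetrizers_Y:
  assumes "s \<noteq> 0"
  shows "one_zero LY n s = p_zero LY n s \<otimes>\<^bsub>hecke_loc LY n s\<^esub> c_w0 LY n s"
    "eps_zero LY n s = c_w0_inv LY n s \<otimes>\<^bsub>hecke_loc LY n s\<^esub> e_zero LY n s"
proof -
  interpret H: affine_hecke_in_ring "hecke_loc LY n s" n "hconst LY n s" s "hT LY n s" "hZinv LY n s" "hZ LY n s"
    by (rule affine_hecke_Y[OF assms])
  \<comment> \<open>As \<open>W\<close> is the inverse of Y, the indices of the c-functions are
    exchanged. This matches the normalization of the eta intertwiners and interchanges the roles of
    \<open>c_w0\<close> and \<open>c_w0_inv\<close> compared with the X case.\<close>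
  have C: "H.C i j = c_fun LY n s j i" if "i \<in> {1..n}" "j \<in> {1..n}" for i j
    using that by (simp add: H.C_def c_fun_def c_of_def flip: ratio_eq(2) ratio_eq(3))
  have X: "H.X i = intertwiner LY n s i" if "1 \<le> i" "i < n" for i
    using that by (simp add: H.X_def C C_simple_def)
  note word = arg_cong[OF map_intertwiner_reduced_word[OF X], of _ "hprod LY n s"]
  have p: "p_zero LY n s = (\<Oplus>\<^bsub>hecke_loc LY n s\<^esub>w\<in>{w. w permutes {1..n}}.
      foldr (\<otimes>\<^bsub>hecke_loc LY n s\<^esub>) (map H.X (SOME js. reduced_word n w js)) \<one>\<^bsub>hecke_loc LY n s\<^esub>)"
    unfolding p_zero_def intertwiner_perm_def
    by (rule H.finsum_cong') (use word H.X_word_closed in \<open>auto simp: hprod_def\<close>)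
  have e: "e_zero LY n s = (\<Oplus>\<^bsub>hecke_loc LY n s\<^esub>w\<in>{w. w permutes {1..n}}.
      hconst LY n s ((- 1) powi colength n w) \<otimes>\<^bsub>hecke_loc LY n s\<^esub>
      foldr (\<otimes>\<^bsub>hecke_loc LY n s\<^esub>) (map H.X (SOME js. reduced_word n w js)) \<one>\<^bsub>hecke_loc LY n s\<^esub>)"
    unfolding e_zero_def intertwiner_perm_def
    by (rule H.finsum_cong') (use word H.X_word_closed in \<open>auto simp: hprod_def\<close>)
  have m: "map (\<lambda>(i, j). c_of LY n s (ratio_inv LY n s i j)) (index_pairs n) =
      map (\<lambda>(i, j). H.C i j) (index_pairs n)"
    "map (\<lambda>(i, j). c_fun LY n s i j) (index_pairs n) = map (\<lambda>(i, j). H.C j i) (index_pairs n)"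
    by (auto simp: index_pairs_props C c_fun_def ratio_eq(3))
  show "one_zero LY n s = p_zero LY n s \<otimes>\<^bsub>hecke_loc LY n s\<^esub> c_w0 LY n s"
    unfolding p c_w0_def m one_zero_def T_perm_def hprod_def by (rule H.symmetrizer_factorization)
  show "eps_zero LY n s = c_w0_inv LY n s \<otimes>\<^bsub>hecke_loc LY n s\<^esub> e_zero LY n s"
    unfolding e c_w0_inv_def m eps_zero_def T_perm_def hprod_def by (rule H.antisymmetrizer_factorization)
qed

theorem proposition3p6:
  fixes n :: nat and s :: complex
  assumes "n \<ge> 1" and "s \<noteq> 0"
  shows "one_zero LX n s = p_zero LX n s \<otimes>\<^bsub>hecke_loc LX n s\<^esub> c_w0_inv LX n s \<and>
         eps_zero LX n s = c_w0 LX n s \<otimes>\<^bsub>hecke_loc LX n s\<^esub> e_zero LX n s \<and>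
         one_zero LY n s = p_zero LY n s \<otimes>\<^bsub>hecke_loc LY n s\<^esub> c_w0 LY n s \<and>
         eps_zero LY n s = c_w0_inv LY n s \<otimes>\<^bsub>hecke_loc LY n s\<^esub> e_zero LY n s"
  using symmetrizers_X[OF assms(2)] symmetrizers_Y[OF assms(2)] by blast

end
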